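(* For an integer $k\geq 2$, let $(F_n^{(k)})_{n\geq -(k-2)}$ be the $k$-generalized Fibonacci sequence, defined by $F_{-(k-2)}^{(k)}=\cdots=F_{0}^{(k)}=0$, $F_1^{(k)}=1$, and $F_{n+k}^{(k)}=F_{n+k-1}^{(k)}+F_{n+k-2}^{(k)}+\cdots+F_n^{(k)}$ for all $n\geq -(k-2)$. If $(m,n,k)$ is a solution of the Diophantine equation \[ F_n^{(k)}=m2^m+1 \] in positive integers $m,n$ and an integer $k\geq 2$, then \[ m<9.5\cdot 10^{23},\qquad n<2.4\cdot 10^{24},\qquad k\leq 158. \] *)

theory Defs
  imports Complex_Main
begin

text \<open>
  The \<open>k\<close>-generalized Fibonacci sequence, indexed by the integers. Only indices
  \<open>n \<ge> -(k - 2)\<close> belong to the sequence; the function takes the (irrelevant) value \<open>0\<close>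
  below that range. The lemmas \<open>gen_fib_initial\<close>, \<open>gen_fib_one\<close> and
  \<open>gen_fib_recurrence\<close> are the defining conditions in their usual form.
\<close>

function gen_fib :: "nat \<Rightarrow> int \<Rightarrow> int" where
  "gen_fib k n =
     (if n \<le> 0 then 0
      else if n = 1 then 1
      else (\<Sum>i=1..k. gen_fib k (n - int i)))"
  by pat_completeness auto
termination
  by (relation "measure (\<lambda>(k, n). nat n)") auto

declare gen_fib.simps [simp del]

lemma gen_fib_initial:
  assumes "- (int k - 2) \<le> n" and "n \<le> 0"
  shows "gen_fib k n = 0"
  using assms by (simp add: gen_fib.simps)

lemma gen_fib_one: "gen_fib k 1 = 1"
  by (simp add: gen_fib.simps)

lemma gen_fib_recurrence:
  assumes "n \<ge> - (int k - 2)"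
  shows "gen_fib k (n + int k) = (\<Sum>j<k. gen_fib k (n + int j))"
proof -
  have "gen_fib k (n + int k) = (\<Sum>i=1..k. gen_fib k (n + int k - int i))"
    using assms by (subst gen_fib.simps) auto
  also have "\<dots> = (\<Sum>j<k. gen_fib k (n + int j))"
    by (rule sum.reindex_bij_witness [where i = "\<lambda>j. k - j" and j = "\<lambda>i. k - i"])
       (auto simp: of_nat_diff algebra_simps)
  finally show ?thesis .
qed

end

theory Submission
  imports Defs "HOL-Analysis.Harmonic_Numbers" "HOL-Analysis.Kronecker_Approximation_Theorem"
    "Jordan_Normal_Form.Determinant" "HOL-Computational_Algebra.Computational_Algebra"
begin

text \<open>
  Let \<open>al\<close> be the dominant root of the characteristic polynomial, so that \<open>F n\<close> is within 1 of
  \<open>binet * al ^ (n - 1)\<close>. A solution makes \<open>al ^ (n - 1) / 2 ^ m\<close> extremely close to \<open>m / binet\<close>, that is, a high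
  power of \<open>al ^ p / 2 ^ r\<close> is extremely close to a number of small height. An interpolation argument for two
  logarithms (Siegel's lemma, Taylor coefficients, a Liouville inequality and a zero estimate for exponential
  polynomials) excludes this once \<open>n\<close> exceeds a fixed power of \<open>k * log n\<close>; here \<open>p / r\<close> comes from Dirichlet's
  theorem, or \<open>p = r = 1\<close> when \<open>k\<close> is large compared with \<open>log log n\<close>, since \<open>al\<close> is then very close to 2.

  The remaining \<open>n\<close> are excluded 2-adically. Expanding \<open>(1 - x) / (1 - 2 x + x ^ (k + 1))\<close> shows that \<open>F n\<close> is odd
  only if \<open>n\<close> is 1 or 2 modulo \<open>k + 1\<close>, and that \<open>2 ^ m\<close> cannot divide \<open>F n - 1\<close> unless \<open>k\<close> is 1 modulo 4 and
  \<open>n = (k + 1) q + 1\<close> with \<open>q\<close> even. In that case \<open>F n - 1\<close> is, up to a small factor, the value at \<open>q\<close> of a 2-adic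
  isometry, so \<open>q\<close> is 2-adically close to its unique zero. For \<open>k \<ge> 159\<close> this forces \<open>q\<close> to be of size about
  \<open>2 ^ (k / 2)\<close>, where the first argument applies; for \<open>k = 5, 9, \<dots>, 61\<close> enough binary digits of the zero are
  computed to see that \<open>q\<close> lies in the range covered by the first argument.
\<close>

section \<open>Approximation by powers of the dominant root\<close>

text \<open>The constants of the interpolation argument are too large to reach the stated bounds
  directly: for \<open>k = 5, 9, ..., 61\<close> it takes over only at sizes between about
  \<open>2 ^ 143\<close> (for \<open>k = 5\<close>) and \<open>2 ^ 189\<close> (for
  \<open>k = 61\<close>). The 2-adic argument bridges this gap.

  What is shown is \<open>n < 9.5 * 10 ^ 23\<close>; since \<open>m < n\<close>, this one threshold
  yields both numerical bounds. Its essential use is \<open>2 ^ 79 < 9.5 * 10 ^ 23\<close>: the bit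
  length \<open>nu\<close> of \<open>n\<close> is at least 80, so that \<open>k < 2 * nu\<close> for
  all \<open>k <= 158\<close>. For \<open>k >= 65\<close> these two inequalities already suffice for
  the Archimedean estimates: either \<open>2 ^ k\<close> is large against a power of
  \<open>k\<close> and \<open>nu\<close>, and \<open>p = r = 1\<close> works, or
  \<open>nu > 4 * k\<close>, and the Dirichlet version works. Only the fifteen smaller values of
  \<open>k\<close> that are 1 modulo 4 need computed digits. For \<open>k >= 159\<close> no lower
  bound for \<open>n\<close> is available in advance; there the 2-adic argument itself yields
  \<open>nu >= 80\<close> and \<open>k < 2 * nu\<close>.\<close>

definition kfib_seq :: "nat \<Rightarrow> nat \<Rightarrow> int" where
  "kfib_seq k i = gen_fib k (int i - (int k - 2))"

lemma kfib_seq_zero: "k \<ge> 2 \<Longrightarrow> i < k - 1 \<Longrightarrow> kfib_seq k i = 0"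
  unfolding kfib_seq_def by (rule gen_fib_initial) auto

lemma kfib_seq_one: "k \<ge> 2 \<Longrightarrow> kfib_seq k (k - 1) = 1"
  unfolding kfib_seq_def using gen_fib_one by (simp add: of_nat_diff)

text \<open>The index shift puts the \<open>k - 1\<close> zeros at indices \<open>0\<close> to
  \<open>k - 2\<close> and the value 1 at \<open>k - 1\<close>, so that the recurrence holds for
  natural indices without a side condition.\<close>

lemma kfib_seq_rec: "kfib_seq k (i + k) = (\<Sum>j<k. kfib_seq k (i + j))"
proof -
  have "kfib_seq k (i + k) = gen_fib k ((int i - (int k - 2)) + int k)"
    unfolding kfib_seq_def by (rule arg_cong[where f = "gen_fib k"]) simp
  also have "\<dots> = (\<Sum>j<k. gen_fib k ((int i - (int k - 2)) + int j))"
    by (rule gen_fib_recurrence) simp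
  also have "\<dots> = (\<Sum>j<k. kfib_seq k (i + j))"
    unfolding kfib_seq_def by (rule sum.cong[OF refl], rule arg_cong[where f = "gen_fib k"]) simp
  finally show ?thesis .
qed

lemma gen_fib_eq_kfib_seq: "k \<ge> 2 \<Longrightarrow> n \<ge> 1 \<Longrightarrow> gen_fib k (int n) = kfib_seq k ((n - 1) + (k - 1))"
  unfolding kfib_seq_def by (rule arg_cong[where f = "gen_fib k"]) (simp add: of_nat_diff)

section \<open>The dominant root and its Binet coefficient\<close>

text \<open>Multiplied by \<open>x - 1\<close>, the characteristic equation becomes
  \<open>x ^ k * (2 - x) = 1\<close>. The left side is 0 at 2, and Bernoulli's inequality makes it
  at least 1 at \<open>2 - 2 / 2 ^ k\<close>; this lower bound also keeps the spurious root 1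
  away.\<close>

lemma dominant_root_exists:
  fixes k :: nat
  assumes "k \<ge> 2"
  shows "\<exists>x::real. 2 - 2 / 2 ^ k \<le> x \<and> x < 2 \<and> x ^ k * (2 - x) = 1"
proof -
  have pow: "real k * 2 \<le> 2 ^ k"
    using assms
  proof (induction k rule: dec_induct)
    case (step n)
    then show ?case by simp
  qed simp
  let ?a = "2 - 2 / 2 ^ k :: real"
  let ?g = "\<lambda>x::real. x ^ k * (2 - x)"
  have k2: "(2::real) ^ k > 0" by simp
  have "1 + real k * (- (1 / 2 ^ k)) \<le> (1 + - (1 / 2 ^ k :: real)) ^ k"
    by (rule Bernoulli_inequality) simp
  hence b: "1 - real k / 2 ^ k \<le> (1 - 1 / 2 ^ k :: real) ^ k" by simp
  have "?a ^ k = (2 * (1 - 1 / 2 ^ k)) ^ k" by (simp add: algebra_simps)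
  also have "\<dots> = 2 ^ k * (1 - 1 / 2 ^ k) ^ k" by (rule power_mult_distrib)
  finally have "?g ?a = 2 * (1 - 1 / 2 ^ k) ^ k" by simp
  moreover have "real k / 2 ^ k \<le> 1 / 2" using pow by (simp add: field_simps)
  ultimately have ga: "?g ?a \<ge> 1" using b by linarith
  have "\<exists>x\<ge>?a. x \<le> 2 \<and> ?g x = 1"
    by (rule IVT2) (use ga in \<open>auto intro!: continuous_intros\<close>)
  then obtain x where x: "?a \<le> x" "x \<le> 2" "?g x = 1" by blast
  have "x \<noteq> 2" using x(3) by auto
  thus ?thesis using x by (intro exI[of _ x]) auto
qed

locale kfib =
  fixes k :: nat and al :: real
  assumes k2: "k \<ge> 2" and al_ge: "2 - 2 / 2 ^ k \<le> al" and al_lt: "al < 2"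
    and al_root: "al ^ k * (2 - al) = 1"
begin

lemma two_k_le_pow: "real k * 2 \<le> 2 ^ k"
  using k2
proof (induction k rule: dec_induct)
  case (step n)
  then show ?case by simp
qed simp

lemma al_ge_32: "al \<ge> 3 / 2"
proof -
  have "(2::real) ^ 2 \<le> 2 ^ k" using k2 by (intro power_increasing) auto
  hence "2 / 2 ^ k \<le> (2 / 4 :: real)" by (intro divide_left_mono) auto
  thus ?thesis using al_ge by linarith
qed

lemma k_mult_gap: "real k * (2 - al) \<le> 1"
proof -
  have "real k * (2 - al) \<le> real k * (2 / 2 ^ k)"
    using al_ge by (intro mult_left_mono) auto
  also have "\<dots> \<le> 1" using two_k_le_pow by (simp add: field_simps)
  finally show ?thesis .
qed

text \<open>Equal to \<open>1 / al + ... + 1 / al ^ (k - j)\<close>. These are the coordinates of a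
  left eigenvector of the companion matrix for the eigenvalue \<open>al\<close>: the pairing with
  \<open>k\<close> consecutive terms of the sequence is multiplied by \<open>al\<close> when the
  window moves by one.\<close>

definition weight :: "nat \<Rightarrow> real" where "weight j = (1 - al ^ j * (2 - al)) / (al - 1)"

text \<open>The coefficient of \<open>al ^ (n - 1)\<close> in the Binet formula, more often written
  \<open>(al - 1) / (2 + (k + 1) * (al - 2))\<close>.\<close>

definition binet :: real where "binet = (al - 1) / ((real k + 1) * al - 2 * real k)"

lemma binet_denom_ge: "(real k + 1) * al - 2 * real k \<ge> al - 1"
  using k_mult_gap by (simp add: algebra_simps)

lemma binet_denom_le: "(real k + 1) * al - 2 * real k \<le> 2"
proof -
  have "(real k + 1) * al \<le> (real k + 1) * 2" using al_lt by (intro mult_left_mono) auto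
  thus ?thesis by (simp add: algebra_simps)
qed

lemma binet_bounds: "1 / 4 \<le> binet" "binet \<le> 1"
proof -
  have p: "(real k + 1) * al - 2 * real k > 0" using binet_denom_ge al_ge_32 by linarith
  show "binet \<le> 1" unfolding binet_def using p binet_denom_ge by (simp add: divide_le_eq)
  show "1 / 4 \<le> binet" unfolding binet_def using p binet_denom_le al_ge_32
    by (simp add: field_simps)
qed

lemma weight_0: "weight 0 = 1" unfolding weight_def using al_ge_32 by simp
lemma weight_k: "weight k = 0" unfolding weight_def using al_root by simp
lemma weight_Suc: "weight (Suc j) = al * weight j - 1"
  unfolding weight_def using al_ge_32 by (simp add: field_simps)

lemma weight_pos: assumes "j < k" shows "weight j > 0"
proof -
  have "al ^ j < al ^ k" using assms al_ge_32 by (intro power_strict_increasing) auto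
  hence "al ^ j * (2 - al) < al ^ k * (2 - al)" using al_lt by (intro mult_strict_right_mono) auto
  thus ?thesis unfolding weight_def using al_root al_ge_32 by simp
qed

lemma weight_le_1: "weight j \<le> 1"
proof -
  have "al ^ j \<ge> 1" using al_ge_32 by (intro one_le_power) auto
  hence "al ^ j * (2 - al) \<ge> 1 * (2 - al)" using al_lt by (intro mult_right_mono) auto
  thus ?thesis unfolding weight_def using al_ge_32 by (simp add: divide_le_eq)
qed

lemma weight_diff_ge: "weight j - weight (Suc j) \<ge> 2 - al"
proof -
  have "(al - 1) * weight j \<le> (al - 1) * 1" using weight_le_1 al_ge_32 by (intro mult_left_mono) auto
  thus ?thesis unfolding weight_Suc by (simp add: algebra_simps)
qed

lemma sum_inverse_powers: "(\<Sum>j<k. 1 / al ^ j) = al"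
proof -
  have a1: "1 / al \<noteq> 1" using al_ge_32 by simp
  have "(\<Sum>j<k. 1 / al ^ j) = (\<Sum>j<k. (1 / al) ^ j)" by (simp add: power_one_over)
  also have "\<dots> = ((1 / al) ^ k - 1) / (1 / al - 1)" by (rule geometric_sum[OF a1])
  also have "(1 / al) ^ k = 2 - al"
    using al_root al_ge_32 by (simp add: power_one_over field_simps)
  also have "(2 - al - 1) / (1 / al - 1) = al" using al_ge_32 by (simp add: field_simps)
  finally show ?thesis .
qed

text \<open>This normalization gives the sequence and its geometric approximation the same pairing
  with the weights, so that the pairing with the error vanishes.\<close>

lemma weight_power_sum: "(\<Sum>j<k. weight j / al ^ j) * binet = 1"
proof -
  have nz: "al ^ j \<noteq> 0" for j using al_ge_32 by simp
  have "(\<Sum>j<k. weight j / al ^ j) = (\<Sum>j<k. (1 / al ^ j - (2 - al)) / (al - 1))"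
    unfolding weight_def using nz by (intro sum.cong) (auto simp: field_simps)
  also have "\<dots> = ((\<Sum>j<k. 1 / al ^ j) - (\<Sum>j<k. (2 - al))) / (al - 1)"
    by (simp only: sum_divide_distrib[symmetric] sum_subtractf)
  also have "\<dots> = ((real k + 1) * al - 2 * real k) / (al - 1)"
    unfolding sum_inverse_powers by (simp add: algebra_simps)
  finally show ?thesis unfolding binet_def using binet_denom_ge al_ge_32 by auto
qed

lemma weighted_sum_kfib: "(\<Sum>j<k. weight j * kfib_seq k (n + (k - 1) - j)) = al ^ n"
proof (induction n)
  case 0
  have "(\<Sum>j<k. weight j * kfib_seq k (0 + (k - 1) - j)) = (\<Sum>j<k. if j = 0 then 1 else 0)"
  proof (rule sum.cong[OF refl])
    fix j assume j: "j \<in> {..<k}"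
    show "weight j * kfib_seq k (0 + (k - 1) - j) = (if j = 0 then 1 else 0)"
      using j k2 kfib_seq_zero[of k "k - 1 - j"] kfib_seq_one[of k] weight_0 by auto
  qed
  thus ?case using k2 by simp
next
  case (Suc n)
  let ?G = "\<lambda>i. real_of_int (kfib_seq k i)"
  have "al * al ^ n = (\<Sum>j<k. al * (weight j * ?G (n + (k - 1) - j)))"
    unfolding Suc[symmetric] by (rule sum_distrib_left)
  also have "\<dots> = (\<Sum>j<k. weight (Suc j) * ?G (n + (k - 1) - j)) + (\<Sum>j<k. ?G (n + (k - 1) - j))"
    unfolding sum.distrib[symmetric] weight_Suc by (rule sum.cong) (auto simp: algebra_simps)
  also have "(\<Sum>j<k. ?G (n + (k - 1) - j)) = (\<Sum>j<k. ?G (n + j))"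
    by (rule sum.reindex_bij_witness[where i = "\<lambda>j. k - 1 - j" and j = "\<lambda>j. k - 1 - j"])
       (auto intro!: arg_cong[where f = "kfib_seq k"])
  also have "\<dots> = weight 0 * ?G (n + k)" by (simp add: kfib_seq_rec weight_0)
  also have "(\<Sum>j<k. weight (Suc j) * ?G (n + (k - 1) - j)) = (\<Sum>j<k. weight (Suc j) * ?G (n + k - Suc j))"
    by (rule sum.cong) (use k2 in \<open>auto intro!: arg_cong[where f = "kfib_seq k"]\<close>)
  also have "\<dots> + weight 0 * ?G (n + k) = (\<Sum>j<Suc k. weight j * ?G (n + k - j))"
    unfolding sum.lessThan_Suc_shift by simp
  also have "\<dots> = (\<Sum>j<k. weight j * ?G (n + k - j))" by (simp add: weight_k)
  also have "\<dots> = (\<Sum>j<k. weight j * ?G (Suc n + (k - 1) - j))"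
    using k2 by (intro sum.cong) auto
  finally show ?case by simp
qed

section \<open>Decay of the error and independence of the powers of \<open>al\<close>\<close>

definition binet_err :: "nat \<Rightarrow> real" where
  "binet_err i = kfib_seq k i - binet * al ^ i / al ^ (k - 1)"

lemma weighted_sum_err: "(\<Sum>j<k. weight j * binet_err (n + (k - 1) - j)) = 0"
proof -
  have nz: "al ^ j \<noteq> 0" for j using al_ge_32 by simp
  have "(\<Sum>j<k. weight j * (binet * al ^ (n + (k - 1) - j) / al ^ (k - 1))) = (\<Sum>j<k. weight j / al ^ j * (binet * al ^ n))"
  proof (rule sum.cong[OF refl])
    fix j assume "j \<in> {..<k}"
    hence "al ^ (n + (k - 1)) = al ^ (n + (k - 1) - j) * al ^ j"
      by (subst power_add[symmetric]) (auto intro!: arg_cong[where f = "power al"])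
    hence "al ^ n * al ^ (k - 1) = al ^ (n + (k - 1) - j) * al ^ j" by (simp add: power_add)
    thus "weight j * (binet * al ^ (n + (k - 1) - j) / al ^ (k - 1)) = weight j / al ^ j * (binet * al ^ n)"
      using nz[of j] nz[of "k - 1"] by (simp add: divide_eq_eq eq_divide_eq mult_ac)
  qed
  also have "\<dots> = (\<Sum>j<k. weight j / al ^ j) * binet * al ^ n"
    by (simp only: sum_distrib_right mult.assoc)
  also have "\<dots> = al ^ n" by (simp add: weight_power_sum)
  finally show ?thesis using weighted_sum_kfib[of n]
    by (simp add: binet_err_def right_diff_distrib sum_subtractf)
qed

text \<open>Difference of the vanishing weighted sums over two consecutive windows:
  \<open>weight 0 = 1\<close> isolates the newest error, and \<open>weight k = 0\<close> lets the
  rest be summed over the same \<open>k\<close> errors.\<close>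

lemma binet_err_rec: "binet_err (n + k) = (\<Sum>j<k. (weight j - weight (Suc j)) * binet_err (n + (k - 1) - j))"
proof -
  have "0 = (\<Sum>j<k. weight j * binet_err (Suc n + (k - 1) - j))" by (simp only: weighted_sum_err)
  also have "\<dots> = (\<Sum>j<k. weight j * binet_err (n + k - j))" using k2 by (intro sum.cong) auto
  also have "\<dots> = (\<Sum>j<Suc k. weight j * binet_err (n + k - j))" by (simp add: weight_k)
  also have "\<dots> = binet_err (n + k) + (\<Sum>j<k. weight (Suc j) * binet_err (n + k - Suc j))"
    unfolding sum.lessThan_Suc_shift by (simp add: weight_0)
  also have "(\<Sum>j<k. weight (Suc j) * binet_err (n + k - Suc j)) = (\<Sum>j<k. weight (Suc j) * binet_err (n + (k - 1) - j))"
    by (rule sum.cong) (use k2 in \<open>auto intro!: arg_cong[where f = binet_err]\<close>)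
  finally show ?thesis using weighted_sum_err[of n] by (simp add: left_diff_distrib sum_subtractf)
qed

lemma weights_sum: "(\<Sum>j<k. weight j - weight (Suc j)) = 1"
  by (subst sum_lessThan_telescope') (simp add: weight_0 weight_k)

text \<open>The coefficients \<open>weight j - weight (j + 1)\<close> of the recurrence for \<open>binet_err\<close> are positive with sum 1,
  and each is at least \<open>2 - al\<close>; since no block of \<open>k\<close> consecutive errors has constant sign, the maximum over
  a block contracts by the factor \<open>al - 1\<close>.\<close>

lemma binet_err_window_upper:
  fixes s :: real
  assumes s: "s = 1 \<or> s = -1" and M: "\<And>j. j < k \<Longrightarrow> s * binet_err (n + j) \<le> M"
  shows "s * binet_err (n + k) \<le> (al - 1) * M"
proof -
  have ex: "\<exists>j<k. s * binet_err (n + (k - 1) - j) \<le> 0"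
  proof (rule ccontr)
    assume "\<not> ?thesis"
    hence "\<And>j. j < k \<Longrightarrow> weight j * (s * binet_err (n + (k - 1) - j)) > 0" using weight_pos by (simp add: not_le)
    hence "(\<Sum>j<k. weight j * (s * binet_err (n + (k - 1) - j))) > 0"
      using k2 by (intro sum_pos) (auto simp: lessThan_empty_iff)
    also have "(\<Sum>j<k. weight j * (s * binet_err (n + (k - 1) - j))) = s * (\<Sum>j<k. weight j * binet_err (n + (k - 1) - j))"
      by (simp add: sum_distrib_left mult_ac)
    finally show False unfolding weighted_sum_err by simp
  qed
  then obtain i where i: "i < k" "s * binet_err (n + (k - 1) - i) \<le> 0" by blast
  have ex2: "\<exists>j<k. s * binet_err (n + (k - 1) - j) \<ge> 0"
  proof (rule ccontr)
    assume "\<not> ?thesis"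
    hence "\<And>j. j < k \<Longrightarrow> weight j * (- s * binet_err (n + (k - 1) - j)) > 0" using weight_pos by (simp add: not_le mult_pos_neg)
    hence "(\<Sum>j<k. weight j * (- s * binet_err (n + (k - 1) - j))) > 0"
      using k2 by (intro sum_pos) (auto simp: lessThan_empty_iff)
    also have "(\<Sum>j<k. weight j * (- s * binet_err (n + (k - 1) - j))) = - s * (\<Sum>j<k. weight j * binet_err (n + (k - 1) - j))"
      by (simp add: sum_distrib_left mult_ac sum_negf)
    finally show False unfolding weighted_sum_err by simp
  qed
  have M': "s * binet_err (n + (k - 1) - j) \<le> M" if "j < k" for j
    using M[of "k - 1 - j"] that k2 by (simp add: add_diff_assoc)
  have M0: "M \<ge> 0" using ex2 M' by force
  let ?w = "\<lambda>j. weight j - weight (Suc j)"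
  have wpos: "?w j \<ge> 0" for j using weight_diff_ge[of j] al_lt by linarith
  have "s * binet_err (n + k) = (\<Sum>j<k. ?w j * (s * binet_err (n + (k - 1) - j)))"
    unfolding binet_err_rec by (simp add: sum_distrib_left mult_ac)
  also have "\<dots> = ?w i * (s * binet_err (n + (k - 1) - i)) + (\<Sum>j\<in>{..<k}-{i}. ?w j * (s * binet_err (n + (k - 1) - j)))"
    using i by (subst sum.remove[of _ i]) auto
  also have "\<dots> \<le> 0 + (\<Sum>j\<in>{..<k}-{i}. ?w j * M)"
    using i wpos M' by (intro add_mono sum_mono mult_left_mono) (auto simp: mult_nonneg_nonpos)
  also have "(\<Sum>j\<in>{..<k}-{i}. ?w j * M) = ((\<Sum>j<k. ?w j) - ?w i) * M"
    using i by (subst sum.remove[of "{..<k}" i]) (auto simp: sum_distrib_right)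
  also have "\<dots> \<le> (al - 1) * M"
    unfolding weights_sum using weight_diff_ge[of i] M0 by (intro mult_right_mono) auto
  finally show ?thesis by simp
qed

lemma binet_err_window:
  assumes M: "\<And>j. j < k \<Longrightarrow> \<bar>binet_err (n + j)\<bar> \<le> M"
  shows "\<bar>binet_err (n + k)\<bar> \<le> (al - 1) * M"
proof -
  have "1 * binet_err (n + k) \<le> (al - 1) * M"
    using M by (intro binet_err_window_upper) (auto simp: abs_le_iff)
  moreover have "- 1 * binet_err (n + k) \<le> (al - 1) * M"
    using M by (intro binet_err_window_upper) (auto simp: abs_le_iff)
  ultimately show ?thesis by (simp add: abs_le_iff)
qed

lemma binet_err_bounded: "\<bar>binet_err i\<bar> \<le> 1"
proof (induction i rule: less_induct)
  case (less i)
  show ?case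
  proof (cases "i < k")
    case True
    have p: "al ^ (k - 1) > 0" using al_ge_32 by simp
    have "al ^ i \<le> al ^ (k - 1)" using True al_ge_32 by (intro power_increasing) auto
    hence "al ^ i / al ^ (k - 1) \<le> 1" using p by simp
    hence le: "binet * (al ^ i / al ^ (k - 1)) \<le> 1 * 1"
      using binet_bounds p al_ge_32 by (intro mult_mono) auto
    have ge: "binet * (al ^ i / al ^ (k - 1)) \<ge> 0" using binet_bounds p al_ge_32 by auto
    have "kfib_seq k i = 0 \<or> kfib_seq k i = 1"
      using True k2 kfib_seq_zero[of k i] kfib_seq_one[of k] by (cases "i = k - 1") auto
    thus ?thesis unfolding binet_err_def using le ge by auto
  next
    case False
    define n where "n = i - k"
    have i: "i = n + k" using False n_def by simp
    have "\<bar>binet_err (n + k)\<bar> \<le> (al - 1) * 1"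
      by (rule binet_err_window) (use less i in auto)
    also have "\<dots> \<le> 1" using al_lt by simp
    finally show ?thesis using i by simp
  qed
qed

lemma binet_err_tendsto_0: "binet_err \<longlonglongrightarrow> 0"
proof -
  \<comment> \<open>Every further \<open>k\<close> indices gain a factor
    \<open>al - 1 < 1\<close>.\<close>
  have geo: "\<exists>N. \<forall>i\<ge>N. \<bar>binet_err i\<bar> \<le> (al - 1) ^ t" for t
  proof (induction t)
    case (Suc t)
    then obtain N where N: "\<forall>i\<ge>N. \<bar>binet_err i\<bar> \<le> (al - 1) ^ t" by blast
    have "\<bar>binet_err i\<bar> \<le> (al - 1) ^ Suc t" if "i \<ge> N + k" for i
    proof -
      have "\<bar>binet_err ((i - k) + k)\<bar> \<le> (al - 1) * (al - 1) ^ t"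
        by (rule binet_err_window) (use N that in auto)
      thus ?thesis using that by simp
    qed
    thus ?case by blast
  qed (use binet_err_bounded in auto)
  show ?thesis
  proof (rule LIMSEQ_I)
    fix r :: real assume r: "r > 0"
    have "(\<lambda>t. (al - 1) ^ t) \<longlonglongrightarrow> 0" using al_ge_32 al_lt by (intro LIMSEQ_power_zero) auto
    then obtain t where "(al - 1) ^ t < r"
      using r order_tendstoD(2)[of "\<lambda>t. (al - 1) ^ t" 0 sequentially r] by (auto simp: eventually_sequentially)
    with geo[of t] show "\<exists>no. \<forall>n\<ge>no. norm (binet_err n - 0) < r" by force
  qed
qed

text \<open>An integer relation between the powers of \<open>al\<close> gives an integer sequence satisfying the Fibonacci
  recurrence and tending to 0, hence vanishing identically; this replaces irreducibility of the characteristic polynomial.\<close>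

lemma powers_independent:
  fixes c :: "nat \<Rightarrow> int"
  assumes "(\<Sum>i<k. c i * al ^ i) = 0" and "i < k"
  shows "c i = 0"
proof -
  define z where "z n = (\<Sum>i<k. c i * kfib_seq k (n + i))" for n
  have z_err: "real_of_int (z n) = (\<Sum>i<k. c i * binet_err (n + i))" for n
  proof -
    have "(\<Sum>i<k. c i * (binet * al ^ (n + i) / al ^ (k - 1))) = (\<Sum>i<k. c i * al ^ i) * (binet * al ^ n / al ^ (k - 1))"
      unfolding sum_distrib_right by (intro sum.cong) (auto simp: power_add)
    thus ?thesis unfolding z_def binet_err_def by (simp add: right_diff_distrib sum_subtractf assms(1))
  qed
  have "(\<lambda>n. \<Sum>i<k. c i * binet_err (n + i)) \<longlonglongrightarrow> (\<Sum>i<k. real_of_int (c i) * 0)"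
    by (intro tendsto_sum tendsto_mult tendsto_const LIMSEQ_ignore_initial_segment binet_err_tendsto_0)
  hence "(\<lambda>n. real_of_int (z n)) \<longlonglongrightarrow> 0" by (simp add: z_err)
  then obtain N where N: "\<forall>n\<ge>N. norm (real_of_int (z n) - 0) < 1" using LIMSEQ_D[of _ 0 1] by fastforce
  have ev: "z n = 0" if "n \<ge> N" for n using N that by force
  have rec: "z (n + k) = (\<Sum>j<k. z (n + j))" for n
  proof -
    have "z (n + k) = (\<Sum>i<k. c i * (\<Sum>j<k. kfib_seq k (n + i + j)))"
    proof -
      have "kfib_seq k (n + k + i) = (\<Sum>j<k. kfib_seq k (n + i + j))" for i
        using kfib_seq_rec[of k "n + i"] by (simp add: add_ac)
      thus ?thesis unfolding z_def by simp
    qed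
    also have "\<dots> = (\<Sum>i<k. \<Sum>j<k. c i * kfib_seq k (n + i + j))" by (simp add: sum_distrib_left)
    also have "\<dots> = (\<Sum>j<k. \<Sum>i<k. c i * kfib_seq k (n + i + j))" by (rule sum.swap)
    also have "\<dots> = (\<Sum>j<k. z (n + j))" unfolding z_def by (simp add: add_ac)
    finally show ?thesis .
  qed
  \<comment> \<open>The oldest term has coefficient 1 in the recurrence, so zeros propagate back to
    smaller indices.\<close>
  have all: "z n = 0" for n
  proof -
    have "\<forall>n\<ge>N - t. z n = 0" for t
    proof (induction t)
      case (Suc t)
      have "z n = 0" if "n \<ge> N - Suc t" for n
      proof (cases "n \<ge> N - t")
        case False
        have "{..<k} = insert 0 {1..<k}" using k2 by auto
        hence "z (n + k) = z n + (\<Sum>j=1..<k. z (n + j))" unfolding rec by simp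
        moreover have "(\<Sum>j=1..<k. z (n + j)) = 0" using Suc that False by (intro sum.neutral) auto
        moreover have "z (n + k) = 0" using Suc that False k2 by auto
        ultimately show ?thesis by simp
      qed (use Suc in auto)
      thus ?case by blast
    qed (use ev in auto)
    from this[of N] show ?thesis by simp
  qed
  \<comment> \<open>Started at \<open>t\<close>, the sequence is 0 before position
    \<open>k - 1 - t\<close> and 1 there. This gives a triangular system, solved from the last
    coefficient down.\<close>
  have "t < k \<Longrightarrow> c (k - 1 - t) = 0" for t
  proof (induction t rule: less_induct)
    case (less t)
    have "0 = (\<Sum>i<k. c i * kfib_seq k (t + i))" using all[of t] z_def by simp
    also have "\<dots> = (\<Sum>i<k. if i = k - 1 - t then c (k - 1 - t) else 0)"
    proof (rule sum.cong[OF refl])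
      fix i assume i: "i \<in> {..<k}"
      consider "i < k - 1 - t" | "i = k - 1 - t" | "i > k - 1 - t" by linarith
      thus "c i * kfib_seq k (t + i) = (if i = k - 1 - t then c (k - 1 - t) else 0)"
      proof cases
        case 1 thus ?thesis using kfib_seq_zero[of k "t + i"] k2 by simp
      next
        case 2 thus ?thesis using kfib_seq_one[of k] k2 less.prems by simp
      next
        case 3
        have "c (k - 1 - (k - 1 - i)) = 0" using 3 i less.prems by (intro less.IH) auto
        moreover have "k - 1 - (k - 1 - i) = i" using i by auto
        ultimately show ?thesis using 3 by simp
      qed
    qed
    also have "\<dots> = c (k - 1 - t)" using less.prems by simp
    finally show ?case by simp
  qed
  from this[of "k - 1 - i"] show ?thesis using assms(2) by auto
qed

lemma gen_fib_approx: 
  assumes "n \<ge> 1"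
  shows "\<bar>gen_fib k (int n) - binet * al ^ (n - 1)\<bar> \<le> 1"
proof -
  have "binet_err ((n - 1) + (k - 1)) = gen_fib k (int n) - binet * al ^ (n - 1)"
    unfolding binet_err_def gen_fib_eq_kfib_seq[OF k2 assms] using al_ge_32 by (simp add: power_add)
  thus ?thesis using binet_err_bounded[of "(n - 1) + (k - 1)"] by simp
qed

end

section \<open>Liouville inequality via integer matrices\<close>

text \<open>Expanding the product of the row sums gives one nonnegative term for every map from rows
  to columns; the Leibniz formula involves only those of the permutations.\<close>

lemma abs_det_le_prod_row_sums:
  fixes B :: "real mat"
  assumes B: "B \<in> carrier_mat n n"
  shows "\<bar>det B\<bar> \<le> (\<Prod>i=0..<n. \<Sum>j=0..<n. \<bar>B $$ (i, j)\<bar>)"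
proof -
  have fin: "finite {p. p permutes {0..<n}}" by (rule finite_permutations) simp
  have "\<bar>det B\<bar> \<le> (\<Sum>p | p permutes {0..<n}. \<bar>of_int (sign p) * (\<Prod>i=0..<n. B $$ (i, p i))\<bar>)"
    unfolding det_def'[OF B] by (rule sum_abs)
  also have "\<dots> = (\<Sum>p | p permutes {0..<n}. \<Prod>i=0..<n. \<bar>B $$ (i, p i)\<bar>)"
    by (intro sum.cong refl) (simp add: abs_mult abs_prod sign_def)
  also have "\<dots> \<le> (\<Sum>g\<in>{0..<n} \<rightarrow>\<^sub>E {0..<n}. \<Prod>i=0..<n. \<bar>B $$ (i, g i)\<bar>)"
  \<comment> \<open>Extensional maps are \<open>undefined\<close> outside the index range,
    permutations are the identity there; the witness translates between the two conventions.\<close>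
  proof (rule sum_le_included[where i = "\<lambda>g x. if x \<in> {0..<n} then g x else x"])
    show "\<forall>p\<in>{p. p permutes {0..<n}}. \<exists>g\<in>{0..<n} \<rightarrow>\<^sub>E {0..<n}.
       (\<lambda>x. if x \<in> {0..<n} then g x else x) = p \<and> (\<Prod>i=0..<n. \<bar>B $$ (i, p i)\<bar>) \<le> (\<Prod>i=0..<n. \<bar>B $$ (i, g i)\<bar>)"
    proof
      fix p assume "p \<in> {p. p permutes {0..<n}}"
      hence p: "p permutes {0..<n}" by simp
      let ?g = "restrict p {0..<n}"
      have "?g \<in> {0..<n} \<rightarrow>\<^sub>E {0..<n}" using permutes_in_image[OF p] by auto
      moreover have "(\<lambda>x. if x \<in> {0..<n} then ?g x else x) = p"
        using permutes_not_in[OF p] by (auto simp: fun_eq_iff)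
      moreover have "(\<Prod>i=0..<n. \<bar>B $$ (i, p i)\<bar>) \<le> (\<Prod>i=0..<n. \<bar>B $$ (i, ?g i)\<bar>)" by simp
      ultimately show "\<exists>g\<in>{0..<n} \<rightarrow>\<^sub>E {0..<n}.
       (\<lambda>x. if x \<in> {0..<n} then g x else x) = p \<and> (\<Prod>i=0..<n. \<bar>B $$ (i, p i)\<bar>) \<le> (\<Prod>i=0..<n. \<bar>B $$ (i, g i)\<bar>)"
        by blast
    qed
  qed (auto intro!: fin finite_PiE prod_nonneg)
  also have "\<dots> = (\<Prod>i=0..<n. \<Sum>j=0..<n. \<bar>B $$ (i, j)\<bar>)"
    by (rule prod_sum_PiE[symmetric]) auto
  finally show ?thesis .
qed

context kfib
begin

lemma al_pow_k: "al ^ k = (\<Sum>i<k. al ^ i)"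
proof -
  have "(al - 1) * (\<Sum>i<k. al ^ i) = al ^ k - 1" by (rule power_diff_1_eq[symmetric])
  also have "\<dots> = (al - 1) * al ^ k" using al_root by (simp add: algebra_simps)
  finally show ?thesis using al_ge_32 by simp
qed

text \<open>A substitute for heights: multiplication by \<open>x\<close> acts on \<open>1, al, \<dots>, al ^ (k - 1)\<close> through an
  integer matrix with row sums at most \<open>N\<close>.\<close>

definition mult_bounded :: "real \<Rightarrow> real \<Rightarrow> bool" where
  "mult_bounded x N \<longleftrightarrow> (\<exists>M::nat \<Rightarrow> nat \<Rightarrow> int. (\<forall>j<k. (\<Sum>i<k. al ^ i * M i j) = x * al ^ j) \<and>
     (\<forall>i<k. (\<Sum>j<k. \<bar>real_of_int (M i j)\<bar>) \<le> N))"

lemma mult_bounded_nonneg: "mult_bounded x N \<Longrightarrow> N \<ge> 0"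
proof -
  assume "mult_bounded x N"
  then obtain M :: "nat \<Rightarrow> nat \<Rightarrow> int" where "\<forall>i<k. (\<Sum>j<k. \<bar>real_of_int (M i j)\<bar>) \<le> N"
    unfolding mult_bounded_def by blast
  hence "(\<Sum>j<k. \<bar>real_of_int (M 0 j)\<bar>) \<le> N" using k2 by auto
  moreover have "(\<Sum>j<k. \<bar>real_of_int (M 0 j)\<bar>) \<ge> 0" by (rule sum_nonneg) auto
  ultimately show ?thesis by linarith
qed

lemma mult_bounded_mono: "mult_bounded x N \<Longrightarrow> N \<le> N' \<Longrightarrow> mult_bounded x N'"
  unfolding mult_bounded_def by (meson order_trans)

lemma mult_bounded_of_int: "mult_bounded (of_int c) \<bar>of_int c\<bar>"
  unfolding mult_bounded_def
proof (intro exI[of _ "\<lambda>i j. if i = j then c else 0"] conjI allI impI)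
  fix j assume "j < k"
  have "(\<Sum>i<k. al ^ i * real_of_int (if i = j then c else 0)) = (\<Sum>i<k. if i = j then al ^ j * of_int c else 0)"
    by (intro sum.cong) auto
  thus "(\<Sum>i<k. al ^ i * real_of_int (if i = j then c else 0)) = of_int c * al ^ j" using \<open>j < k\<close> by simp
next
  fix i assume "i < k"
  have "(\<Sum>j<k. \<bar>real_of_int (if i = j then c else 0)\<bar>) = (\<Sum>j<k. if i = j then \<bar>of_int c\<bar> else 0)"
    by (intro sum.cong) auto
  thus "(\<Sum>j<k. \<bar>real_of_int (if i = j then c else 0)\<bar>) \<le> \<bar>of_int c\<bar>" using \<open>i < k\<close> by simp
qed

lemma mult_bounded_add: assumes "mult_bounded x N" "mult_bounded y N'" shows "mult_bounded (x + y) (N + N')"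
proof -
  from assms obtain M M' :: "nat \<Rightarrow> nat \<Rightarrow> int" where
    M: "\<forall>j<k. (\<Sum>i<k. al ^ i * M i j) = x * al ^ j" "\<forall>i<k. (\<Sum>j<k. \<bar>real_of_int (M i j)\<bar>) \<le> N"
    and M': "\<forall>j<k. (\<Sum>i<k. al ^ i * M' i j) = y * al ^ j" "\<forall>i<k. (\<Sum>j<k. \<bar>real_of_int (M' i j)\<bar>) \<le> N'"
    unfolding mult_bounded_def by blast
  show ?thesis unfolding mult_bounded_def
  proof (intro exI[of _ "\<lambda>i j. M i j + M' i j"] conjI allI impI)
    fix j assume "j < k"
    thus "(\<Sum>i<k. al ^ i * real_of_int (M i j + M' i j)) = (x + y) * al ^ j"
      using M(1) M'(1) by (simp add: algebra_simps sum.distrib)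
  next
    fix i assume i: "i < k"
    have "(\<Sum>j<k. \<bar>real_of_int (M i j + M' i j)\<bar>) \<le> (\<Sum>j<k. \<bar>real_of_int (M i j)\<bar> + \<bar>real_of_int (M' i j)\<bar>)"
      by (intro sum_mono) auto
    thus "(\<Sum>j<k. \<bar>real_of_int (M i j + M' i j)\<bar>) \<le> N + N'"
      using M(2) M'(2) i by (fastforce simp: sum.distrib)
  qed
qed

lemma mult_bounded_mult: assumes "mult_bounded x N" "mult_bounded y N'" shows "mult_bounded (x * y) (N * N')"
proof -
  from assms obtain M M' :: "nat \<Rightarrow> nat \<Rightarrow> int" where
    M: "\<forall>j<k. (\<Sum>i<k. al ^ i * M i j) = x * al ^ j" "\<forall>i<k. (\<Sum>j<k. \<bar>real_of_int (M i j)\<bar>) \<le> N"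
    and M': "\<forall>j<k. (\<Sum>i<k. al ^ i * M' i j) = y * al ^ j" "\<forall>i<k. (\<Sum>j<k. \<bar>real_of_int (M' i j)\<bar>) \<le> N'"
    unfolding mult_bounded_def by blast
  have N': "N' \<ge> 0" using assms(2) by (rule mult_bounded_nonneg)
  show ?thesis unfolding mult_bounded_def
  proof (intro exI[of _ "\<lambda>i j. \<Sum>l<k. M i l * M' l j"] conjI allI impI)
    fix j assume j: "j < k"
    have "(\<Sum>i<k. al ^ i * real_of_int (\<Sum>l<k. M i l * M' l j)) = (\<Sum>i<k. \<Sum>l<k. al ^ i * M i l * M' l j)"
      by (simp add: sum_distrib_left mult.assoc)
    also have "\<dots> = (\<Sum>l<k. (\<Sum>i<k. al ^ i * M i l) * M' l j)"
      by (subst sum.swap) (simp add: sum_distrib_right)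
    also have "\<dots> = (\<Sum>l<k. x * (al ^ l * M' l j))" using M(1) by (intro sum.cong) auto
    also have "\<dots> = x * y * al ^ j" using M'(1) j by (simp add: sum_distrib_left[symmetric])
    finally show "(\<Sum>i<k. al ^ i * real_of_int (\<Sum>l<k. M i l * M' l j)) = x * y * al ^ j" .
  next
    fix i assume i: "i < k"
    have "(\<Sum>j<k. \<bar>real_of_int (\<Sum>l<k. M i l * M' l j)\<bar>) \<le> (\<Sum>j<k. \<Sum>l<k. \<bar>real_of_int (M i l)\<bar> * \<bar>real_of_int (M' l j)\<bar>)"
      by (intro sum_mono) (simp add: abs_mult[symmetric] sum_abs)
    also have "\<dots> = (\<Sum>l<k. \<bar>real_of_int (M i l)\<bar> * (\<Sum>j<k. \<bar>real_of_int (M' l j)\<bar>))"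
      by (subst sum.swap) (simp add: sum_distrib_left)
    also have "\<dots> \<le> (\<Sum>l<k. \<bar>real_of_int (M i l)\<bar> * N')"
      using M'(2) by (intro sum_mono mult_left_mono) auto
    also have "\<dots> = (\<Sum>l<k. \<bar>real_of_int (M i l)\<bar>) * N'" by (simp add: sum_distrib_right)
    also have "\<dots> \<le> N * N'" using M(2) i N' by (intro mult_right_mono) auto
    finally show "(\<Sum>j<k. \<bar>real_of_int (\<Sum>l<k. M i l * M' l j)\<bar>) \<le> N * N'" .
  qed
qed

lemma mult_bounded_power: "mult_bounded x N \<Longrightarrow> mult_bounded (x ^ e) (N ^ e)"
proof (induction e)
  case 0 show ?case using mult_bounded_of_int[of 1] by simp
qed (auto intro: mult_bounded_mult)

lemma mult_bounded_sum:
  assumes "finite I" "\<And>i. i \<in> I \<Longrightarrow> mult_bounded (x i) (N i)"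
  shows "mult_bounded (\<Sum>i\<in>I. x i) (\<Sum>i\<in>I. N i)"
  using assms
proof (induction I rule: finite_induct)
  case empty show ?case using mult_bounded_of_int[of 0] by simp
qed (auto intro: mult_bounded_add)

lemma mult_bounded_al: "mult_bounded al 2"
  unfolding mult_bounded_def
proof (intro exI[of _ "\<lambda>i j. if j = k - 1 then 1 else if i = Suc j then 1 else 0"] conjI allI impI)
  fix j assume j: "j < k"
  show "(\<Sum>i<k. al ^ i * real_of_int (if j = k - 1 then 1 else if i = Suc j then 1 else 0)) = al * al ^ j"
  proof (cases "j = k - 1")
    case True
    hence "al * al ^ j = al ^ k" using k2 by (simp flip: power_Suc)
    thus ?thesis using True by (simp add: al_pow_k)
  next
    case False
    have "(\<Sum>i<k. al ^ i * real_of_int (if j = k - 1 then 1 else if i = Suc j then 1 else 0)) = (\<Sum>i<k. if i = Suc j then al ^ Suc j else 0)"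
      using False by (intro sum.cong) auto
    also have "\<dots> = al ^ Suc j" using False j by simp
    finally show ?thesis by simp
  qed
next
  fix i assume i: "i < k"
  have "(\<Sum>j<k. \<bar>real_of_int (if j = k - 1 then 1 else if i = Suc j then 1 else 0)\<bar>) \<le> (\<Sum>j<k. (if j = k - 1 then 1 else 0) + (if j = i - 1 then 1 else 0))"
    by (intro sum_mono) auto
  also have "\<dots> \<le> 2" using i by (simp add: sum.distrib)
  finally show "(\<Sum>j<k. \<bar>real_of_int (if j = k - 1 then 1 else if i = Suc j then 1 else 0)\<bar>) \<le> 2" .
qed

text \<open>\<open>al\<close> is a unit: dividing \<open>al_pow_k\<close> by \<open>al\<close>
  writes the inverse as \<open>al ^ (k - 1)\<close> minus all lower powers, which is column 0 of the
  matrix.\<close>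

lemma mult_bounded_al_inverse: "mult_bounded (1 / al) 2"
  unfolding mult_bounded_def
proof (intro exI[of _ "\<lambda>i j. if j = 0 then (if i = k - 1 then 1 else -1) else if i = j - 1 then 1 else 0"] conjI allI impI)
  fix j assume j: "j < k"
  show "(\<Sum>i<k. al ^ i * real_of_int (if j = 0 then (if i = k - 1 then 1 else -1) else if i = j - 1 then 1 else 0)) = 1 / al * al ^ j"
  proof (cases "j = 0")
    case True
    have kk: "{..<k} = insert (k - 1) {..<k - 1}" using k2 by auto
    have "k = Suc (k - 1)" using k2 by simp
    hence "al ^ k = (\<Sum>i<Suc (k - 1). al ^ i)" unfolding al_pow_k by simp
    hence "al ^ k = 1 + (\<Sum>i<k - 1. al ^ Suc i)" by (simp only: sum.lessThan_Suc_shift power_0)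
    hence "al * al ^ (k - 1) = 1 + al * (\<Sum>i<k - 1. al ^ i)"
      using k2 by (simp add: sum_distrib_left flip: power_Suc)
    hence "al ^ (k - 1) - (\<Sum>i<k - 1. al ^ i) = 1 / al" using al_ge_32 by (simp add: field_simps)
    moreover have "(\<Sum>i<k. al ^ i * real_of_int (if i = k - 1 then 1 else -1)) = al ^ (k - 1) - (\<Sum>i<k - 1. al ^ i)"
      unfolding kk by (simp add: sum_negf)
    ultimately show ?thesis using True by simp
  next
    case False
    have "(\<Sum>i<k. al ^ i * real_of_int (if j = 0 then (if i = k - 1 then 1 else -1) else if i = j - 1 then 1 else 0)) = (\<Sum>i<k. if i = j - 1 then al ^ (j - 1) else 0)"
      using False by (intro sum.cong) auto
    also have "\<dots> = al ^ (j - 1)" using False j by auto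
    also have "\<dots> = 1 / al * al ^ j" using False al_ge_32 by (cases j) auto
    finally show ?thesis .
  qed
next
  fix i assume i: "i < k"
  have "(\<Sum>j<k. \<bar>real_of_int (if j = 0 then (if i = k - 1 then 1 else -1) else if i = j - 1 then 1 else 0)\<bar>) \<le> (\<Sum>j<k. (if j = 0 then 1 else 0) + (if j = Suc i then 1 else 0))"
    by (intro sum_mono) auto
  also have "\<dots> \<le> 2" using i by (simp add: sum.distrib)
  finally show "(\<Sum>j<k. \<bar>real_of_int (if j = 0 then (if i = k - 1 then 1 else -1) else if i = j - 1 then 1 else 0)\<bar>) \<le> 2" .
qed

lemma sum_al_powers_le: "(\<Sum>j<k. al ^ j) \<le> 2 ^ k"
proof -
  have "(\<Sum>j<k. al ^ j) \<le> (\<Sum>j<k. 2 ^ j)" using al_lt al_ge_32 by (intro sum_mono power_mono) auto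
  also have "\<dots> = 2 ^ k - 1" using geometric_sum[of "2::real" k] by simp
  finally show ?thesis by simp
qed

text \<open>The determinant of the integer matrix of \<open>x\<close> is a nonzero integer, since a
  kernel vector would be an integer relation between the powers of \<open>al\<close>. The unimodular
  matrix \<open>E\<close> replaces row 0 by the combination of all rows with coefficients
  \<open>al ^ i\<close>, that is by the entries \<open>x * al ^ j\<close>. So one row sum carries
  the factor \<open>x\<close> and the other \<open>k - 1\<close> are at most
  \<open>N\<close>.\<close>

lemma liouville:
  assumes "mult_bounded x N" "x \<noteq> 0"
  shows "1 \<le> \<bar>x\<bar> * 2 ^ k * N ^ (k - 1)"
proof -
  from assms(1) obtain M :: "nat \<Rightarrow> nat \<Rightarrow> int" where
    M: "\<forall>j<k. (\<Sum>i<k. al ^ i * M i j) = x * al ^ j" "\<forall>i<k. (\<Sum>j<k. \<bar>real_of_int (M i j)\<bar>) \<le> N"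
    unfolding mult_bounded_def by blast
  define A where "A = mat k k (\<lambda>(i,j). M i j)"
  have A: "A \<in> carrier_mat k k" unfolding A_def by simp
  have nz: "det A \<noteq> 0"
  proof
    assume "det A = 0"
    then obtain v where v: "v \<in> carrier_vec k" "v \<noteq> 0\<^sub>v k" "A *\<^sub>v v = 0\<^sub>v k"
      using det_0_iff_vec_prod_zero[OF A] by blast
    have row: "(\<Sum>j<k. M i j * v $ j) = 0" if "i < k" for i
    proof -
      have "(A *\<^sub>v v) $ i = 0" using v(3) that by simp
      thus ?thesis using that v(1) by (simp add: A_def scalar_prod_def lessThan_atLeast0)
    qed
    have "0 = (\<Sum>i<k. al ^ i * real_of_int (\<Sum>j<k. M i j * v $ j))" using row by simp
    also have "\<dots> = (\<Sum>i<k. \<Sum>j<k. al ^ i * M i j * v $ j)" by (simp add: sum_distrib_left mult.assoc)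
    also have "\<dots> = (\<Sum>j<k. (\<Sum>i<k. al ^ i * M i j) * v $ j)" by (subst sum.swap) (simp add: sum_distrib_right)
    also have "\<dots> = (\<Sum>j<k. x * (v $ j * al ^ j))" using M(1) by (intro sum.cong) auto
    finally have "(\<Sum>j<k. v $ j * al ^ j) = 0" using assms(2) by (simp add: sum_distrib_left[symmetric])
    hence "\<And>j. j < k \<Longrightarrow> v $ j = 0" using powers_independent[of "\<lambda>j. v $ j"] by simp
    hence "v = 0\<^sub>v k" using v(1) by (intro eq_vecI) auto
    thus False using v(2) by simp
  qed
  define E :: "real mat" where "E = mat k k (\<lambda>(i,j). if i = 0 then al ^ j else if i = j then 1 else 0)"
  have E: "E \<in> carrier_mat k k" unfolding E_def by simp
  have "upper_triangular E" unfolding E_def upper_triangular_def by auto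
  hence "det E = prod_list (diag_mat E)" using E by (rule det_upper_triangular)
  also have "diag_mat E = replicate k 1" unfolding diag_mat_def E_def
    by (rule nth_equalityI) auto
  finally have detE: "det E = 1" by simp
  define R where "R = map_mat real_of_int A"
  have R: "R \<in> carrier_mat k k" unfolding R_def using A by simp
  have "det (E * R) = real_of_int (det A)" using det_mult[OF E R] detE by (simp add: R_def)
  hence "1 \<le> \<bar>det (E * R)\<bar>" using nz by simp
  also have "\<dots> \<le> (\<Prod>i=0..<k. \<Sum>j=0..<k. \<bar>(E * R) $$ (i, j)\<bar>)"
    by (rule abs_det_le_prod_row_sums) (use E R in simp)
  also have "\<dots> \<le> (\<Prod>i=0..<k. if i = 0 then \<bar>x\<bar> * 2 ^ k else N)"
  proof (rule prod_mono)
    fix i assume i: "i \<in> {0..<k}"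
    have "(\<Sum>j=0..<k. \<bar>(E * R) $$ (i, j)\<bar>) \<le> (if i = 0 then \<bar>x\<bar> * 2 ^ k else N)"
    proof (cases "i = 0")
      case True
      have "(E * R) $$ (0, j) = x * al ^ j" if "j < k" for j
        using that M(1) i True unfolding E_def R_def A_def
        by (simp add: times_mat_def scalar_prod_def lessThan_atLeast0)
      hence "(\<Sum>j=0..<k. \<bar>(E * R) $$ (i, j)\<bar>) = (\<Sum>j<k. \<bar>x\<bar> * al ^ j)"
        using True al_ge_32 by (auto simp: lessThan_atLeast0 abs_mult intro!: sum.cong)
      also have "\<dots> \<le> \<bar>x\<bar> * 2 ^ k"
        unfolding sum_distrib_left[symmetric] using sum_al_powers_le by (intro mult_left_mono) auto
      finally show ?thesis using True by simp
    next
      case False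
      have "(E * R) $$ (i, j) = M i j" if "j < k" for j
      proof -
        have "(E * R) $$ (i, j) = (\<Sum>l=0..<k. (if i = l then 1 else 0) * real_of_int (M l j))"
          using that i False unfolding E_def R_def A_def
          by (simp add: times_mat_def scalar_prod_def)
        also have "\<dots> = (\<Sum>l=0..<k. if l = i then real_of_int (M i j) else 0)" by (intro sum.cong) auto
        finally show ?thesis using i by simp
      qed
      hence "(\<Sum>j=0..<k. \<bar>(E * R) $$ (i, j)\<bar>) = (\<Sum>j<k. \<bar>real_of_int (M i j)\<bar>)"
        by (auto simp: lessThan_atLeast0 intro!: sum.cong)
      thus ?thesis using M(2) i False by auto
    qed
    thus "0 \<le> (\<Sum>j=0..<k. \<bar>(E * R) $$ (i, j)\<bar>) \<and> (\<Sum>j=0..<k. \<bar>(E * R) $$ (i, j)\<bar>) \<le> (if i = 0 then \<bar>x\<bar> * 2 ^ k else N)"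
      by (auto intro!: sum_nonneg)
  qed
  also have "\<dots> = \<bar>x\<bar> * 2 ^ k * N ^ (k - 1)"
  proof -
    have kk: "{0..<k} = insert 0 {1..<k}" using k2 by auto
    have "(\<Prod>i=1..<k. if i = 0 then \<bar>x\<bar> * 2 ^ k else N) = (\<Prod>i=1..<k. N)" by (rule prod.cong) auto
    thus ?thesis unfolding kk by simp
  qed
  finally show ?thesis .
qed

end

section \<open>Siegel lemma and zero estimate\<close>

text \<open>Pigeonhole on the vectors with entries in \<open>0..P\<close>: each form takes its
  values in an interval of length \<open>2 * P * G\<close>, which is cut into cells of
  \<open>1 / K\<close> of that length. Two vectors that share all cells differ by the required
  \<open>p\<close>.\<close>

lemma siegel_real:
  fixes c :: "nat \<Rightarrow> 'u \<Rightarrow> real" and G :: real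
  assumes I: "finite I" and P: "P \<ge> 1" and K: "K \<ge> 1" and G: "G > 0"
    and c: "\<And>i. i < T \<Longrightarrow> (\<Sum>u\<in>I. \<bar>c i u\<bar>) \<le> G"
    and count: "(K + 1) ^ T < (P + 1) ^ card I"
  shows "\<exists>p::'u \<Rightarrow> int. (\<forall>u. \<bar>p u\<bar> \<le> int P) \<and> (\<exists>u\<in>I. p u \<noteq> 0) \<and>
    (\<forall>i<T. \<bar>\<Sum>u\<in>I. p u * c i u\<bar> \<le> 2 * real P * G / real K)"
proof -
  define D where "D = I \<rightarrow>\<^sub>E {0..int P}"
  define L where "L p i = (\<Sum>u\<in>I. real_of_int (p u) * c i u)" for p i
  define H where "H = 2 * real P * G"
  have H: "H > 0" using P G by (simp add: H_def)
  \<comment> \<open>Index \<open>K\<close> occurs only at the right end of the interval, hence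
    \<open>K + 1\<close> cells per form.\<close>
  define cell where "cell p i = nat \<lfloor>(L p i + real P * G) * real K / H\<rfloor>" for p i
  have Lb: "\<bar>L p i\<bar> \<le> real P * G" if "p \<in> D" "i < T" for p i
  proof -
    have "\<bar>L p i\<bar> \<le> (\<Sum>u\<in>I. \<bar>real_of_int (p u) * c i u\<bar>)" unfolding L_def by (rule sum_abs)
    also have "\<dots> \<le> (\<Sum>u\<in>I. real P * \<bar>c i u\<bar>)"
    proof (rule sum_mono)
      fix u assume "u \<in> I"
      hence "p u \<in> {0..int P}" using that(1) by (auto simp: D_def)
      hence "\<bar>real_of_int (p u)\<bar> \<le> real P" by simp
      thus "\<bar>real_of_int (p u) * c i u\<bar> \<le> real P * \<bar>c i u\<bar>" unfolding abs_mult by (rule mult_right_mono) simp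
    qed
    also have "\<dots> \<le> real P * G" unfolding sum_distrib_left[symmetric] using c[OF that(2)] by (intro mult_left_mono) auto
    finally show ?thesis .
  qed
  have arg: "0 \<le> (L p i + real P * G) * real K / H" "(L p i + real P * G) * real K / H \<le> real K"
    if "p \<in> D" "i < T" for p i
  proof -
    have b: "0 \<le> L p i + real P * G" "L p i + real P * G \<le> H" using Lb[OF that] unfolding H_def abs_le_iff by linarith+
    show "0 \<le> (L p i + real P * G) * real K / H" using b H by simp
    show "(L p i + real P * G) * real K / H \<le> real K" using mult_right_mono[OF b(2), of "real K"] H
      by (simp only: pos_divide_le_eq mult.commute[of "real K" H])
  qed
  define f where "f p = restrict (cell p) {..<T}" for p
  have fD: "f ` D \<subseteq> {..<T} \<rightarrow>\<^sub>E {0..K}"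
  proof -
    have "cell p i \<le> K" if "p \<in> D" "i < T" for p i
      using arg[OF that] unfolding cell_def by (simp add: floor_le_iff nat_le_iff)
    thus ?thesis unfolding f_def by (intro image_subsetI) (simp add: restrict_PiE_iff)
  qed
  have "card (f ` D) \<le> card ({..<T} \<rightarrow>\<^sub>E {0..K})" by (rule card_mono[OF _ fD]) (auto intro: finite_PiE)
  also have "\<dots> = (K + 1) ^ T" by (simp add: card_PiE)
  also have "\<dots> < (P + 1) ^ card I" by (rule count)
  also have "\<dots> = card D"
  proof -
    have "nat (int P + 1) = P + 1" by linarith
    thus ?thesis using I by (simp add: D_def card_PiE)
  qed
  finally have "\<not> inj_on f D" by (rule pigeonhole)
  then obtain p q where pq: "p \<in> D" "q \<in> D" "p \<noteq> q" "f p = f q" unfolding inj_on_def by blast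
  define r where "r u = (if u \<in> I then p u - q u else 0)" for u
  have "\<exists>u\<in>I. p u \<noteq> q u"
  proof (rule ccontr)
    assume "\<not> ?thesis"
    hence "p = q" using pq(1,2) unfolding D_def by (intro PiE_ext) auto
    thus False using pq(3) by simp
  qed
  hence nz: "\<exists>u\<in>I. r u \<noteq> 0" by (auto simp: r_def)
  have bd: "\<bar>r u\<bar> \<le> int P" for u
  proof (cases "u \<in> I")
    case True
    hence "p u \<in> {0..int P}" "q u \<in> {0..int P}" using pq(1,2) by (auto simp: D_def)
    thus ?thesis using True by (auto simp: r_def)
  qed (simp add: r_def)
  have "\<bar>\<Sum>u\<in>I. r u * c i u\<bar> \<le> 2 * real P * G / real K" if i: "i < T" for i
  proof -
    have "cell p i = cell q i" using fun_cong[OF pq(4), of i] i by (simp add: f_def)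
    hence "\<lfloor>(L p i + real P * G) * real K / H\<rfloor> = \<lfloor>(L q i + real P * G) * real K / H\<rfloor>"
      unfolding cell_def using arg[OF pq(1) i] arg[OF pq(2) i] by (simp add: nat_eq_iff)
    hence "\<bar>(L p i + real P * G) * real K / H - (L q i + real P * G) * real K / H\<bar> \<le> 1" by linarith
    also have "(L p i + real P * G) * real K / H - (L q i + real P * G) * real K / H = (L p i - L q i) * (real K / H)"
      by (simp add: diff_divide_distrib[symmetric] left_diff_distrib[symmetric])
    finally have "\<bar>L p i - L q i\<bar> * (real K / H) \<le> 1" using K H by (simp add: abs_mult)
    hence "\<bar>L p i - L q i\<bar> \<le> H / real K" using K H by (simp add: field_simps)
    moreover have "L p i - L q i = (\<Sum>u\<in>I. r u * c i u)"
      unfolding L_def sum_subtractf[symmetric] by (intro sum.cong) (auto simp: r_def algebra_simps)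
    ultimately show ?thesis by (simp add: H_def)
  qed
  thus ?thesis using nz bd by blast
qed

section \<open>Exponential tails, and zeros of exponential polynomials\<close>

text \<open>Multiplying the term of index \<open>j + n\<close> by \<open>exp j >= 1\<close> turns
  the tail into \<open>exp (- n)\<close> times a tail of the series of
  \<open>exp (exp 1 * |z|)\<close>, and \<open>exp 1 <= 3\<close>.\<close>

lemma exp_taylor_tail:
  fixes z :: real
  shows "\<bar>exp z - (\<Sum>j<n. z ^ j / fact j)\<bar> \<le> exp (3 * \<bar>z\<bar> - real n)"
proof -
  have s1: "summable (\<lambda>j. z ^ j / fact j)" using summable_exp[of z] by (simp add: field_simps)
  have s2: "summable (\<lambda>j. (exp 1 * \<bar>z\<bar>) ^ j / fact j)"
    using summable_exp[of "exp 1 * \<bar>z\<bar>"] by (simp add: field_simps)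
  have e1: "exp y = (\<Sum>j. y ^ j / fact j)" for y :: real
    by (simp add: exp_def divide_inverse mult.commute)
  have "exp z - (\<Sum>j<n. z ^ j / fact j) = (\<Sum>j. z ^ (j + n) / fact (j + n))"
    unfolding e1 using suminf_split_initial_segment[OF s1, of n] by simp
  also have "\<bar>\<dots>\<bar> \<le> (\<Sum>j. exp (- real n) * ((exp 1 * \<bar>z\<bar>) ^ (j + n) / fact (j + n)))"
  proof (rule order_trans[OF summable_rabs suminf_le])
    have sm: "summable (\<lambda>j. (exp 1 * \<bar>z\<bar>) ^ (j + n) / fact (j + n))" using s2 by (rule summable_ignore_initial_segment)
    thus b: "summable (\<lambda>j. exp (- real n) * ((exp 1 * \<bar>z\<bar>) ^ (j + n) / fact (j + n)))" by (rule summable_mult)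
    have t: "\<bar>z ^ (j + n) / fact (j + n)\<bar> \<le> exp (- real n) * ((exp 1 * \<bar>z\<bar>) ^ (j + n) / fact (j + n))" for j
    proof -
      have "exp (- real n) * exp 1 ^ (j + n) = exp (real j)"
        by (simp add: exp_of_nat_mult[symmetric] exp_add[symmetric])
      hence "1 \<le> exp (- real n) * exp 1 ^ (j + n)" by simp
      hence "1 * (\<bar>z\<bar> ^ (j + n) / fact (j + n)) \<le> exp (- real n) * exp 1 ^ (j + n) * (\<bar>z\<bar> ^ (j + n) / fact (j + n))"
        by (rule mult_right_mono) auto
      thus ?thesis by (simp add: power_mult_distrib power_abs mult.assoc)
    qed
    show "\<bar>z ^ (j + n) / fact (j + n)\<bar> \<le> exp (- real n) * ((exp 1 * \<bar>z\<bar>) ^ (j + n) / fact (j + n))" for j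
      by (rule t)
    show "summable (\<lambda>j. \<bar>z ^ (j + n) / fact (j + n)\<bar>)"
      by (rule summable_comparison_test'[OF b, of 0]) (use t in auto)
    show "summable (\<lambda>j. \<bar>z ^ (j + n) / fact (j + n)\<bar>)"
      by (rule summable_comparison_test'[OF b, of 0]) (use t in auto)
  qed
  also have "\<dots> = exp (- real n) * (\<Sum>j. (exp 1 * \<bar>z\<bar>) ^ (j + n) / fact (j + n))"
    by (rule suminf_mult) (rule summable_ignore_initial_segment[OF s2])
  also have "\<dots> \<le> exp (- real n) * exp (exp 1 * \<bar>z\<bar>)"
  proof (rule mult_left_mono)
    have "exp (exp 1 * \<bar>z\<bar>) = (\<Sum>j. (exp 1 * \<bar>z\<bar>) ^ (j + n) / fact (j + n)) + (\<Sum>j<n. (exp 1 * \<bar>z\<bar>) ^ j / fact j)"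
      unfolding e1[of "exp 1 * \<bar>z\<bar>"] by (rule suminf_split_initial_segment[OF s2])
    moreover have "(\<Sum>j<n. (exp 1 * \<bar>z\<bar>) ^ j / fact j) \<ge> 0" by (intro sum_nonneg) auto
    ultimately show "(\<Sum>j. (exp 1 * \<bar>z\<bar>) ^ (j + n) / fact (j + n)) \<le> exp (exp 1 * \<bar>z\<bar>)" by linarith
  qed simp
  also have "\<dots> \<le> exp (- real n) * exp (3 * \<bar>z\<bar>)"
    using exp_le by (intro mult_left_mono) (auto intro!: mult_right_mono)
  also have "\<dots> = exp (3 * \<bar>z\<bar> - real n)" by (simp add: exp_add[symmetric])
  finally show ?thesis .
qed

lemma degree_prod_le_sum:
  fixes f :: "'i \<Rightarrow> real poly"
  assumes "finite I" "\<And>i. i \<in> I \<Longrightarrow> degree (f i) \<le> n i"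
  shows "degree (\<Prod>i\<in>I. f i) \<le> (\<Sum>i\<in>I. n i)"
  using assms
proof (induction I rule: finite_induct)
  case (insert x F)
  have "degree (f x * (\<Prod>i\<in>F. f i)) \<le> degree (f x) + degree (\<Prod>i\<in>F. f i)" by (rule degree_mult_le)
  also have "\<dots> \<le> n x + (\<Sum>i\<in>F. n i)" using insert by (intro add_mono) auto
  finally show ?case using insert by simp
qed simp

lemma coeff_mult_top:
  fixes p q :: "real poly"
  assumes "degree p \<le> m" "degree q \<le> n"
  shows "coeff (p * q) (m + n) = coeff p m * coeff q n"
proof -
  have "coeff (p * q) (m + n) = (\<Sum>i\<le>m + n. coeff p i * coeff q (m + n - i))" by (rule coeff_mult)
  also have "\<dots> = (\<Sum>i\<le>m + n. if i = m then coeff p m * coeff q n else 0)"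
  proof (rule sum.cong[OF refl])
    fix i assume "i \<in> {..m + n}"
    consider "i < m" | "i = m" | "i > m" by linarith
    thus "coeff p i * coeff q (m + n - i) = (if i = m then coeff p m * coeff q n else 0)"
    proof cases
      case 1 thus ?thesis using assms coeff_eq_0[of q "m + n - i"] by simp
    next
      case 2 thus ?thesis by simp
    next
      case 3 thus ?thesis using assms coeff_eq_0[of p i] by simp
    qed
  qed
  finally show ?thesis by simp
qed

lemma coeff_prod_top:
  fixes f :: "'i \<Rightarrow> real poly"
  assumes "finite I" "\<And>i. i \<in> I \<Longrightarrow> degree (f i) \<le> n i"
  shows "coeff (\<Prod>i\<in>I. f i) (\<Sum>i\<in>I. n i) = (\<Prod>i\<in>I. coeff (f i) (n i))"
  using assms
proof (induction I rule: finite_induct)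
  case (insert x F)
  have "coeff (f x * (\<Prod>i\<in>F. f i)) (n x + (\<Sum>i\<in>F. n i)) = coeff (f x) (n x) * coeff (\<Prod>i\<in>F. f i) (\<Sum>i\<in>F. n i)"
    using insert by (intro coeff_mult_top degree_prod_le_sum) auto
  thus ?case using insert by simp
qed simp

text \<open>A kernel vector of the transpose would be the coefficient list of a nonzero polynomial
  of degree below \<open>n\<close> with the \<open>n\<close> roots \<open>z j\<close>.\<close>

lemma vandermonde_det_nonzero:
  fixes z c :: "nat \<Rightarrow> real"
  assumes "inj_on z {0..<n}" "\<And>j. j < n \<Longrightarrow> c j \<noteq> 0"
  shows "det (mat n n (\<lambda>(t, j). z j ^ t * c j)) \<noteq> 0"
proof
  let ?A = "mat n n (\<lambda>(t, j). z j ^ t * c j)"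
  let ?B = "mat n n (\<lambda>(j, t). z j ^ t * c j)"
  have "?B = transpose_mat ?A" by auto
  moreover assume "det ?A = 0"
  ultimately have "det ?B = 0" by (simp add: det_transpose[of ?A n])
  then obtain v where v: "v \<in> carrier_vec n" "v \<noteq> 0\<^sub>v n" "?B *\<^sub>v v = 0\<^sub>v n"
    using det_0_iff_vec_prod_zero[of ?B n] by auto
  define p where "p = (\<Sum>t<n. monom (v $ t) t)"
  have cp: "coeff p t = (if t < n then v $ t else 0)" for t
    unfolding p_def by (simp add: coeff_sum)
  have root: "poly p (z j) = 0" if "j < n" for j
  proof -
    have "(?B *\<^sub>v v) $ j = 0" using v(3) that by simp
    hence "(\<Sum>t=0..<n. z j ^ t * c j * v $ t) = 0" using that v(1) by (simp add: scalar_prod_def)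
    hence "c j * (\<Sum>t<n. v $ t * z j ^ t) = 0" by (simp add: sum_distrib_left mult_ac lessThan_atLeast0)
    hence "(\<Sum>t<n. v $ t * z j ^ t) = 0" using assms(2) that by simp
    thus ?thesis by (simp add: p_def poly_sum poly_monom)
  qed
  have "p = 0"
  proof (rule ccontr)
    assume p: "p \<noteq> 0"
    have "n > 0" using v by (cases n) auto
    hence "degree p \<le> n - 1" by (intro degree_le) (auto simp: cp)
    moreover have "n = card (z ` {0..<n})" using assms(1) by (simp add: card_image)
    moreover have "card (z ` {0..<n}) \<le> card {x. poly p x = 0}"
      using root poly_roots_finite[OF p] by (intro card_mono) auto
    moreover have "card {x. poly p x = 0} \<le> degree p" by (rule card_poly_roots_bound[OF p])
    ultimately show False using \<open>n > 0\<close> by linarith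
  qed
  hence "v $ t = 0" if "t < n" for t using cp[of t] that by simp
  hence "v = 0\<^sub>v n" using v(1) by (intro eq_vecI) auto
  thus False using v(2) by simp
qed

text \<open>Writing the function as \<open>\<Sum>l. P l x * y ^ l\<close>, the determinant of the matrix with entries
  \<open>P l (x + t) * be ^ (t * l)\<close> is a nonzero polynomial in \<open>x\<close> (its leading coefficient is a Vandermonde
  determinant) of degree less than \<open>A * B\<close>, and it vanishes on \<open>X\<close>.\<close>

lemma exp_poly_zero_estimate:
  fixes rho :: "nat \<Rightarrow> nat \<Rightarrow> real" and be :: real
  assumes be: "be > 0" "be \<noteq> 1" and X: "finite X" "card X \<ge> A * B"
    and zero: "\<And>x. x \<in> X \<Longrightarrow> \<exists>y. y \<noteq> 0 \<and> (\<forall>t<B. (\<Sum>a<A. \<Sum>l<B. rho a l * (x + real t) ^ a * (be ^ t * y) ^ l) = 0)"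
    and al: "a < A" "l < B"
  shows "rho a l = 0"
proof (rule ccontr)
  assume nz: "rho a l \<noteq> 0"
  define q where "q l = (\<Sum>a<A. monom (rho a l) a)" for l
  have cq: "coeff (q l) a = (if a < A then rho a l else 0)" for l a
    unfolding q_def by (simp add: coeff_sum)
  have pq: "poly (q l) x = (\<Sum>a<A. rho a l * x ^ a)" for l x
    unfolding q_def by (simp add: poly_sum poly_monom)
  \<comment> \<open>Only exponents with a nonzero coefficient polynomial are kept, so that all
    leading coefficients are nonzero. Their number \<open>n\<close> is at most \<open>B\<close>,
    hence the \<open>n\<close> shifts used are among those of the hypothesis.\<close>
  define Ls where "Ls = {l. l < B \<and> q l \<noteq> 0}"
  have finL: "finite Ls" unfolding Ls_def by simp
  define n where "n = card Ls"
  obtain h where h: "bij_betw h {0..<n} Ls" using ex_bij_betw_nat_finite[OF finL] n_def by blast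
  have hL: "h j < B" "q (h j) \<noteq> 0" if "j < n" for j
    using bij_betwE[OF h] that by (auto simp: Ls_def)
  have nB: "n \<le> B" unfolding n_def using card_mono[of "{..<B}" Ls] by (auto simp: Ls_def)
  have "q l \<noteq> 0" using cq[of l a] nz al by auto
  hence "l \<in> Ls" using al by (simp add: Ls_def)
  hence n0: "n > 0" unfolding n_def using finL by (auto simp: card_gt_0_iff)
  define M :: "real poly mat" where
    "M = mat n n (\<lambda>(t, j). smult ((be ^ h j) ^ t) (pcompose (q (h j)) [:real t, 1:]))"
  define R where "R = det M"
  have M: "M \<in> carrier_mat n n" unfolding M_def by simp
  define d where "d j = degree (q (h j))" for j
  have dA: "d j \<le> A - 1" if "j < n" for j
    unfolding d_def by (rule degree_le) (use al in \<open>auto simp: cq\<close>)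
  have entry: "M $$ (t, j) = smult ((be ^ h j) ^ t) (pcompose (q (h j)) [:real t, 1:])" if "t < n" "j < n" for t j
    unfolding M_def using that by simp
  have deg: "degree (M $$ (t, j)) \<le> d j" if "t < n" "j < n" for t j
    unfolding entry[OF that] d_def
    by (rule order_trans[OF degree_smult_le]) (simp add: degree_pcompose)
  have lead: "coeff (M $$ (t, j)) (d j) = (be ^ h j) ^ t * lead_coeff (q (h j))" if "t < n" "j < n" for t j
  proof -
    have "lead_coeff (pcompose (q (h j)) [:real t, 1:]) = lead_coeff (q (h j))"
      by (subst lead_coeff_comp) auto
    moreover have "degree (pcompose (q (h j)) [:real t, 1:]) = d j" by (simp add: degree_pcompose d_def)
    ultimately show ?thesis unfolding entry[OF that] by simp
  qed
  \<comment> \<open>All permutation terms share one degree bound, so the coefficient of the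
    determinant at that degree is the determinant of the leading coefficients.\<close>
  have perm_sum: "(\<Sum>t=0..<n. d (p t)) = (\<Sum>j=0..<n. d j)" if "p permutes {0..<n}" for p
    using sum.permute[OF that, of d] by (simp add: o_def)
  have degR: "degree R \<le> (\<Sum>j=0..<n. d j)"
    unfolding R_def det_def'[OF M]
  proof (rule degree_sum_le)
    show "finite {p. p permutes {0..<n}}" by (rule finite_permutations) simp
    fix p assume "p \<in> {p. p permutes {0..<n}}"
    hence p: "p permutes {0..<n}" by simp
    have pin: "p t < n" if "t < n" for t using permutes_in_image[OF p, of t] that by simp
    have "degree (of_int (sign p) * (\<Prod>t=0..<n. M $$ (t, p t))) \<le> degree (\<Prod>t=0..<n. M $$ (t, p t))"
      by (simp add: sign_def)
    also have "\<dots> \<le> (\<Sum>t=0..<n. d (p t))" using deg pin by (intro degree_prod_le_sum) auto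
    finally show "degree (of_int (sign p) * (\<Prod>t=0..<n. M $$ (t, p t))) \<le> (\<Sum>j=0..<n. d j)"
      using perm_sum[OF p] by simp
  qed
  have "coeff R (\<Sum>j=0..<n. d j) = det (mat n n (\<lambda>(t, j). (be ^ h j) ^ t * lead_coeff (q (h j))))"
  proof -
    have "coeff (of_int (sign p) * (\<Prod>t=0..<n. M $$ (t, p t))) (\<Sum>j=0..<n. d j)
        = of_int (sign p) * (\<Prod>t=0..<n. mat n n (\<lambda>(t, j). (be ^ h j) ^ t * lead_coeff (q (h j))) $$ (t, p t))"
      if p: "p permutes {0..<n}" for p
    proof -
      have pin: "p t < n" if "t < n" for t using permutes_in_image[OF p, of t] that by simp
      have "coeff (\<Prod>t=0..<n. M $$ (t, p t)) (\<Sum>t=0..<n. d (p t)) = (\<Prod>t=0..<n. coeff (M $$ (t, p t)) (d (p t)))"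
        using deg pin by (intro coeff_prod_top) auto
      also have "\<dots> = (\<Prod>t=0..<n. mat n n (\<lambda>(t, j). (be ^ h j) ^ t * lead_coeff (q (h j))) $$ (t, p t))"
        using lead pin by (intro prod.cong) auto
      finally show ?thesis unfolding perm_sum[OF p] by (simp add: sign_def)
    qed
    thus ?thesis unfolding R_def det_def'[OF M] det_def'[OF mat_carrier] coeff_sum
      by (intro sum.cong) auto
  qed
  also have "\<dots> \<noteq> 0"
  proof (rule vandermonde_det_nonzero)
    show "inj_on (\<lambda>j. be ^ h j) {0..<n}"
    proof (rule inj_onI)
      fix i j assume ij: "i \<in> {0..<n}" "j \<in> {0..<n}" "be ^ h i = be ^ h j"
      hence "real (h i) * ln be = real (h j) * ln be" using be by (simp add: ln_realpow[symmetric])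
      moreover have "ln be \<noteq> 0" using be by simp
      ultimately have "h i = h j" by simp
      thus "i = j" using ij h by (auto simp: bij_betw_def inj_on_def)
    qed
  qed (use hL in auto)
  finally have R0: "R \<noteq> 0" by auto
  have "poly R x = 0" if xX: "x \<in> X" for x
  proof -
    obtain y where y: "y \<noteq> 0" "\<forall>t<B. (\<Sum>a<A. \<Sum>l<B. rho a l * (x + real t) ^ a * (be ^ t * y) ^ l) = 0"
      using zero[OF xX] by blast
    define N where "N = mat n n (\<lambda>(t, j). (be ^ h j) ^ t * poly (q (h j)) (x + real t))"
    have N: "N \<in> carrier_mat n n" unfolding N_def by simp
    have "poly R x = det N"
    proof -
      have "poly (of_int (sign p) * (\<Prod>t=0..<n. M $$ (t, p t))) x = of_int (sign p) * (\<Prod>t=0..<n. N $$ (t, p t))"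
        if p: "p permutes {0..<n}" for p
      proof -
        have pin: "p t < n" if "t < n" for t using permutes_in_image[OF p, of t] that by simp
        have "poly (\<Prod>t=0..<n. M $$ (t, p t)) x = (\<Prod>t=0..<n. N $$ (t, p t))"
          unfolding poly_prod using pin by (intro prod.cong) (auto simp: entry N_def poly_pcompose add.commute)
        thus ?thesis by (simp add: sign_def)
      qed
      thus ?thesis unfolding R_def det_def'[OF M] det_def'[OF N] poly_sum by (intro sum.cong) auto
    qed
    also have "det N = 0"
    proof -
      \<comment> \<open>The powers of \<open>y\<close> form a nonzero kernel vector of the evaluated
        matrix: each row is one of the assumed vanishing sums.\<close>
      define v where "v = vec n (\<lambda>j. y ^ h j)"
      have v: "v \<in> carrier_vec n" unfolding v_def by simp
      have "v $ 0 \<noteq> 0" using n0 y by (simp add: v_def)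
      hence v0: "v \<noteq> 0\<^sub>v n" using n0 by auto
      have "(N *\<^sub>v v) $ t = 0" if t: "t < n" for t
      proof -
        have "(N *\<^sub>v v) $ t = (\<Sum>j=0..<n. (be ^ h j) ^ t * poly (q (h j)) (x + real t) * y ^ h j)"
          using t by (simp add: N_def v_def scalar_prod_def)
        also have "\<dots> = (\<Sum>l\<in>Ls. (be ^ l) ^ t * poly (q l) (x + real t) * y ^ l)"
          by (rule sum.reindex_bij_betw[OF h])
        also have "\<dots> = (\<Sum>l<B. (be ^ l) ^ t * poly (q l) (x + real t) * y ^ l)"
          by (rule sum.mono_neutral_left) (auto simp: Ls_def)
        also have "\<dots> = (\<Sum>l<B. \<Sum>a<A. rho a l * (x + real t) ^ a * (be ^ t * y) ^ l)"
          unfolding pq by (intro sum.cong refl)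
             (simp add: sum_distrib_left sum_distrib_right power_mult_distrib mult_ac flip: power_mult)
        also have "\<dots> = (\<Sum>a<A. \<Sum>l<B. rho a l * (x + real t) ^ a * (be ^ t * y) ^ l)"
          by (rule sum.swap)
        finally show ?thesis using y(2) t nB by simp
      qed
      hence "N *\<^sub>v v = 0\<^sub>v n" using N by (intro eq_vecI) auto
      thus ?thesis using det_0_iff_vec_prod_zero[OF N] v v0 by blast
    qed
    finally show ?thesis .
  qed
  hence "card X \<le> card {x. poly R x = 0}" using poly_roots_finite[OF R0] by (intro card_mono) auto
  also have "\<dots> \<le> degree R" by (rule card_poly_roots_bound[OF R0])
  also have "\<dots> \<le> (\<Sum>j=0..<n. d j)" by (rule degR)
  also have "\<dots> \<le> (\<Sum>j=0..<n. A - 1)" using dA by (intro sum_mono) auto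
  also have "\<dots> = n * (A - 1)" by simp
  also have "\<dots> \<le> B * (A - 1)" using nB by simp
  also have "\<dots> < A * B" using al by (cases A) auto
  finally show False using X(2) by simp
qed

section \<open>Two logarithms\<close>

text \<open>The three summands are the Siegel part, the Taylor tail and the error from replacing
  \<open>be ^ b\<close> by \<open>ga\<close>; the last factor is a common denominator times the
  Liouville factor. Each product is at most 1/3: the first because \<open>P\<close> has the size of
  \<open>(Z * Q) ^ 2\<close>, so that \<open>2 * U / P ^ 2\<close> is at most
  \<open>4 * w / (Z * Q)\<close>, the other two because \<open>E\<close> cancels
  \<open>(Z * Q) ^ (4 * k)\<close>.\<close>

lemma smallness_arith:
  fixes Z Q P w T N tau E :: real and k :: nat
  assumes k: "k \<ge> 3" and Z: "Z \<ge> 1" and Q: "Q \<ge> 1" and P: "P \<ge> 1" and w: "w \<ge> 1" and T: "T \<ge> 0"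
    and P1: "P \<le> Z^2 * Q^2" and P2: "Z^2 * Q^2 \<le> 2 * P" and Zb: "24 * T * k * w + 1 \<le> Z" and Zw: "6 * w \<le> Z"
    and E: "Z ^ (4 * k) * Q ^ (4 * k) * E \<le> 1" "E \<ge> 0" and N: "2 * N \<le> Q" "N \<ge> 0" and tau: "0 \<le> tau" "tau \<le> E"
  shows "(T * (2 * P * (k * w * Z * Q) / P ^ (2 * k)) + w * P * Z * (Q ^ 3 * E) + w * P * Z * Q * (2 * N * tau))
           * (Q * 2 ^ k * (w * P * Z * Q) ^ (k - 1)) < 1"
proof -
  define U where "U = w * P * Z * Q"
  have U0: "U > 0" using w P Z Q by (simp add: U_def)
  obtain k' where k': "k = Suc k'" using k by (cases k) auto
  have Uk: "U * U ^ (k - 1) = U ^ k" using k' by simp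
  have "T * (2 * P * (k * w * Z * Q) / P ^ (2 * k)) * (Q * 2 ^ k * U ^ (k - 1)) =
        2 * T * k * Q * 2 ^ k * ((U * U ^ (k - 1)) / P ^ (2 * k))"
    by (simp add: U_def)
  also have "\<dots> = 2 * T * k * Q * (2 ^ k * (U / P ^ 2) ^ k)"
    unfolding Uk by (simp add: power_divide power_mult)
  also have "2 ^ k * (U / P ^ 2) ^ k = (2 * (w * Z * Q / P)) ^ k"
    using P unfolding power_mult_distrib[symmetric] by (simp add: U_def power2_eq_square mult.assoc)
  also have "\<dots> \<le> (4 * w / (Z * Q)) ^ k"
  proof (rule power_mono)
    have "w * Z * Q / P \<le> w * Z * Q / (Z^2 * Q^2 / 2)"
      using P2 w Z Q P by (intro divide_left_mono mult_pos_pos) auto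
    also have "\<dots> = 2 * w / (Z * Q)" using Z Q by (simp add: field_simps power2_eq_square)
    finally show "2 * (w * Z * Q / P) \<le> 4 * w / (Z * Q)" by simp
  qed (use w Z Q P in auto)
  also have "\<dots> \<le> (4 * w / (Z * Q)) ^ 1"
  proof (rule power_decreasing)
    have "4 * w \<le> Z * Q" using Zw w Q Z mult_left_mono[of 1 Q Z] by linarith
    thus "4 * w / (Z * Q) \<le> 1" using Z Q by simp
  qed (use k w Z Q in auto)
  finally have "T * (2 * P * (k * w * Z * Q) / P ^ (2 * k)) * (Q * 2 ^ k * U ^ (k - 1)) \<le> 2 * T * k * Q * (4 * w / (Z * Q))"
    using T Q by (simp add: mult_left_mono)
  also have "\<dots> = 8 * T * k * w / Z" using Q by simp
  also have "\<dots> < 1 / 3" using Zb Z by (simp add: field_simps)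
  finally have t1: "T * (2 * P * (k * w * Z * Q) / P ^ (2 * k)) * (Q * 2 ^ k * U ^ (k - 1)) < 1 / 3" .
  have "2 * U \<le> (Z ^ 4 * Q ^ 3) / 3"
  proof -
    have "2 * U = 2 * w * Z * Q * P" by (simp add: U_def)
    also have "\<dots> \<le> (Z / 3) * Z * Q * (Z^2 * Q^2)"
      using Zw P1 w Z Q P by (intro mult_mono) auto
    finally show ?thesis by (simp add: power2_eq_square power3_eq_cube power4_eq_xxxx mult_ac)
  qed
  hence "(2 * U) ^ k \<le> ((Z ^ 4 * Q ^ 3) / 3) ^ k" using U0 by (intro power_mono) auto
  also have "\<dots> = (Z ^ 4 * Q ^ 3) ^ k / 3 ^ k" by (rule power_divide)
  also have "\<dots> \<le> (Z ^ 4 * Q ^ 3) ^ k / 3"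
    using k Z Q self_le_power[of "3::real" k] by (intro divide_left_mono) auto
  finally have U2: "(2 * U) ^ k \<le> (Z ^ 4 * Q ^ 3) ^ k / 3" .
  have key: "(2 * U) ^ k * (Q ^ 3 * E) \<le> 1 / 3"
  proof -
    have "(2 * U) ^ k * (Q ^ 3 * E) \<le> (Z ^ 4 * Q ^ 3) ^ k / 3 * (Q ^ k * E)"
      using U2 k Q E Z U0 by (intro mult_mono power_increasing) auto
    also have "\<dots> = Z ^ (4 * k) * Q ^ (4 * k) * E / 3"
      by (simp add: power_mult_distrib power_mult[symmetric] power_add[symmetric] mult_ac)
    finally show ?thesis using E by simp
  qed
  have "w * P * Z * (Q ^ 3 * E) * (Q * 2 ^ k * U ^ (k - 1)) = 2 ^ k * (U * U ^ (k - 1)) * (Q ^ 3 * E)"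
    by (simp add: U_def)
  also have "\<dots> = (2 * U) ^ k * (Q ^ 3 * E)" unfolding Uk by (simp add: power_mult_distrib)
  finally have t2: "w * P * Z * (Q ^ 3 * E) * (Q * 2 ^ k * U ^ (k - 1)) \<le> 1 / 3"
    using key by linarith
  have "w * P * Z * Q * (2 * N * tau) * (Q * 2 ^ k * U ^ (k - 1)) = 2 ^ k * (U * U ^ (k - 1)) * (2 * N * tau * Q)"
    by (simp add: U_def)
  also have "\<dots> = (2 * U) ^ k * (2 * N * tau * Q)" unfolding Uk by (simp add: power_mult_distrib)
  also have "\<dots> \<le> (2 * U) ^ k * (Q ^ 3 * E)"
  proof (rule mult_left_mono)
    have "2 * N * tau * Q \<le> Q * E * Q" using N tau Q E by (intro mult_mono) auto
    also have "\<dots> = Q ^ 2 * E" by (simp add: power2_eq_square)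
    also have "\<dots> \<le> Q ^ 3 * E" using Q E by (intro mult_right_mono power_increasing) auto
    finally show "2 * N * tau * Q \<le> Q ^ 3 * E" .
  qed (use U0 in auto)
  also note key
  finally have t3: "w * P * Z * Q * (2 * N * tau) * (Q * 2 ^ k * U ^ (k - 1)) \<le> 1 / 3" .
  show ?thesis using t1 t2 t3 unfolding U_def[symmetric] distrib_right by linarith
qed

text \<open>Supplies the strict counting condition of Siegel's lemma for
  \<open>K = P ^ n\<close>.\<close>

lemma Suc_power_gt: fixes P :: nat assumes "P \<ge> 1" "n \<ge> 2" shows "P ^ n + 1 < (P + 1) ^ n"
  using assms(2)
proof (induction n rule: dec_induct)
  case base show ?case using assms(1) by (simp add: power2_eq_square)
next
  case (step n)
  have "P ^ Suc n + 1 \<le> (P ^ n + 1) * (P + 1)" by (simp add: algebra_simps)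
  also have "\<dots> < (P + 1) ^ n * (P + 1)" using step by (intro mult_strict_right_mono) auto
  finally show ?case by (simp only: power_Suc2)
qed

lemma power_over_fact_le_exp:
  fixes y :: real
  assumes "y \<ge> 0"
  shows "y ^ n / fact n \<le> exp y"
proof -
  have s: "summable (\<lambda>j. y ^ j / fact j)" using summable_exp[of y] by (simp add: field_simps)
  have "exp y = (\<Sum>j. y ^ j / fact j)" by (simp add: exp_def divide_inverse mult.commute)
  moreover have "sum (\<lambda>j. y ^ j / fact j) {n} \<le> (\<Sum>j. y ^ j / fact j)"
    using assms by (intro sum_le_suminf[OF s]) auto
  ultimately show ?thesis by simp
qed

lemma one_plus_power_minus_one_le:
  fixes t :: real
  assumes "0 \<le> t" "real n * t \<le> 1"
  shows "(1 + t) ^ n - 1 \<le> 2 * (real n * t)"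
proof -
  have "(1 + t) ^ n \<le> exp t ^ n" using assms exp_ge_add_one_self[of t] by (intro power_mono) auto
  also have "\<dots> = exp (real n * t)" by (simp add: exp_of_nat_mult)
  also have "\<dots> \<le> 1 + real n * t + (real n * t)\<^sup>2" using assms by (intro exp_bound) auto
  also have "(real n * t)\<^sup>2 \<le> real n * t * 1" unfolding power2_eq_square using assms by (intro mult_left_mono) auto
  finally show ?thesis by (simp add: algebra_simps)
qed

text \<open>With \<open>y = A * L\<close> the left side is the quantity
  \<open>24 * T * k * w + 1\<close> of the interpolation argument; \<open>262144 = 64 * 4096\<close>
  is the constant in \<open>A\<close>.\<close>

lemma exp_dominates:
  fixes y :: real and k :: nat
  assumes k: "k \<ge> 5" and y: "y \<ge> 262144 * real k ^ 3"
  shows "24 * (16 * k * y) * k * (32 * k * y * 2 ^ k) + 1 \<le> exp y"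
proof -
  have "real k ^ 3 \<ge> 5 ^ 3" using k by (intro power_mono) auto
  hence k3: "real k ^ 3 \<ge> 125" by simp
  have y0: "y \<ge> 32768000" using y k3 by simp
  have ky: "real k ^ 3 \<le> y" using y k3 by linarith
  have "real k \<le> real k ^ 3" using k by (intro self_le_power) auto
  hence "real k \<le> y / 4" using y k3 by linarith
  moreover have "(2::real) ^ k \<le> exp (real k)"
  proof -
    have "(2::real) ^ k \<le> exp 1 ^ k" using exp_ge_add_one_self[of 1] by (intro power_mono) auto
    thus ?thesis by (simp add: exp_of_nat_mult[symmetric])
  qed
  ultimately have p2: "(2::real) ^ k \<le> exp (y / 4)" by (smt (verit) exp_le_cancel_iff)
  have e: "exp (y / 16) \<ge> y / 16" using exp_ge_add_one_self[of "y / 16"] by linarith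
  have "24 * (16 * k * y) * k * (32 * k * y * 2 ^ k) = 12288 * (real k ^ 3 * y ^ 2) * 2 ^ k"
    by (simp add: power2_eq_square power3_eq_cube)
  also have "\<dots> \<le> 12288 * (y * y ^ 2) * exp (y / 4)"
    using ky p2 y0 by (intro mult_mono) auto
  also have "12288 * (y * y ^ 2) \<le> (y / 16) ^ 5"
  proof -
    have "12288 * 16 ^ 5 \<le> y * y" using mult_mono[OF y0 y0] y0 by simp
    hence "12288 * 16 ^ 5 * (y ^ 3) \<le> y * y * y ^ 3" using y0 by (intro mult_right_mono) auto
    thus ?thesis by (simp add: power_divide eval_nat_numeral)
  qed
  hence "12288 * (y * y ^ 2) * exp (y / 4) \<le> (y / 16) ^ 5 * exp (y / 4)" by (intro mult_right_mono) auto
  also have "\<dots> \<le> exp (y / 16) ^ 5 * exp (y / 4)"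
    using e y0 by (intro mult_right_mono power_mono) auto
  also have "\<dots> = exp (9 * y / 16)" by (simp add: exp_of_nat_mult[symmetric] exp_add[symmetric])
  also have "\<dots> \<le> exp y - 1"
  proof -
    have "exp (9 * y / 16) + 1 \<le> 2 * exp (9 * y / 16)" using y0 by simp
    also have "\<dots> \<le> exp 1 * exp (9 * y / 16)" using exp_ge_add_one_self[of 1] by (intro mult_right_mono) auto
    also have "\<dots> = exp (1 + 9 * y / 16)" by (simp add: exp_add)
    also have "\<dots> \<le> exp y" using y0 by simp
    finally show ?thesis by simp
  qed
  finally show ?thesis by simp
qed

context kfib
begin

text \<open>Siegel's lemma provides \<open>f x = (\<Sum>a l. rho a l * x ^ a * be ^ (l * x))\<close>, with coefficients integral
  over \<open>al\<close>, whose first Taylor coefficients are tiny. Then \<open>f\<close> is tiny at all points \<open>s1 + b * s3\<close>; replacing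
  \<open>be ^ b\<close> by \<open>ga\<close> there gives numbers of small size, which vanish by Liouville, contradicting the zero estimate.\<close>

lemma two_logarithms:
  fixes be ga bn bd gn gd tau :: real and b h1 h2 L S1 S3 A B :: nat
  assumes k5: "k \<ge> 5"
    and be: "be = bn / bd" "bn > 0" "bd > 0" "be \<noteq> 1" and ga: "ga = gn / gd" "gn > 0" "gd > 0"
    and sb: "mult_bounded bn (exp h1)" "mult_bounded bd (exp h1)" "bd \<le> exp h1" "\<bar>ln be\<bar> \<le> h1"
    and sg: "mult_bounded gn (exp h2)" "mult_bounded gd (exp h2)" "gd \<le> exp h2" "\<bar>ln ga\<bar> \<le> real h2 - 1"
    and rel: "be ^ b = ga * (1 + tau)" "0 \<le> tau"
    and h: "h1 \<ge> 1" "h2 \<ge> 1" "L \<ge> 1"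
    and S1: "S1 = 4096 * k^2 * L * h2" and S3: "S3 = 4096 * k^2 * L * h1"
    and A: "A = 64 * k * (4096 * k^2 * L) * h1 * h2" and B: "B = 32 * k * L"
    and X: "real (S1 + b * S3) \<le> exp L" and b: "b \<ge> S1"
    and small: "tau \<le> exp (- (real A * real B / 4))"
  shows False
proof -
  \<comment> \<open>Bounds the logarithmic height of \<open>be ^ s1 * ga ^ s3\<close> for
    \<open>s1 <= S1\<close> and \<open>s3 <= S3\<close>; \<open>S1\<close> and \<open>S3\<close> are
    chosen so that both summands are equal.\<close>
  define V :: real where "V = S1 * h1 + S3 * h2"
  have VA: "real A = 32 * k * V" unfolding V_def A S1 S3 by (simp add: algebra_simps)
  define X where "X = real (S1 + b * S3)"
  define lam where "lam = ln be"
  have be0: "be > 0" using be by simp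
  have ga0: "ga > 0" using ga by simp
  have k0: "k > 0" using k5 by simp
  have A0: "A \<ge> 1" unfolding A using h k0 by simp
  have B0: "B \<ge> 4" unfolding B using h k0 by simp
  have S10: "S1 \<ge> 1" and S30: "S3 \<ge> 1" unfolding S1 S3 using h k0 by simp_all
  have X1: "X \<ge> 1" unfolding X_def using S10 by (simp del: of_nat_add of_nat_mult)
  have V0: "V \<ge> 0" unfolding V_def by simp
  \<comment> \<open>\<open>Z\<close> bounds the powers \<open>x ^ a\<close>; \<open>Q\<close> bounds
    the exponential factors and the common denominator.\<close>
  define Z where "Z = exp (real A * real L)"
  define Q where "Q = exp (real B * V)"
  have Z1: "Z \<ge> 1" unfolding Z_def by simp
  have Q1: "Q \<ge> 1" unfolding Q_def using V0 by simp
  have XA: "x ^ a \<le> Z" if "0 \<le> x" "x \<le> X" "a \<le> A" for x a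
  proof -
    have "x ^ a \<le> X ^ a" using that by (intro power_mono) auto
    also have "\<dots> \<le> X ^ A" using X1 that by (intro power_increasing) auto
    also have "\<dots> \<le> exp L ^ A" using X X1 unfolding X_def by (intro power_mono) simp_all
    also have "\<dots> = Z" unfolding Z_def by (simp add: exp_of_nat_mult)
    finally show ?thesis .
  qed
  define P where "P = nat \<lfloor>Z^2 * Q^2\<rfloor>"
  have ZQ1: "Z^2 * Q^2 \<ge> 1" using Z1 Q1 by (metis one_le_power mult_ge1_I)
  have Ple: "real P \<le> Z^2 * Q^2" unfolding P_def using ZQ1 by (simp add: of_nat_nat)
  have P1: "P \<ge> 1" unfolding P_def using ZQ1 by (simp add: le_nat_iff le_floor_iff)
  have "Z^2 * Q^2 \<le> real P + 1" unfolding P_def using ZQ1 by (simp add: of_nat_nat)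
  hence Pge: "Z^2 * Q^2 \<le> 2 * real P" using P1 by linarith
  \<comment> \<open>\<open>T\<close> conditions on Taylor coefficients face
    \<open>A * B * k = 2 * k * T\<close> integer unknowns, which is why every condition can be met
    up to a quantity with \<open>P ^ (2 * k)\<close> in the denominator.\<close>
  define T where "T = 16 * k * L * A"
  have AB: "A * B = 2 * T" unfolding T_def B by simp
  define w where "w = real A * real B * 2 ^ k"
  define I where "I = {..<A} \<times> {..<B} \<times> {..<k}"
  have finI: "finite I" unfolding I_def by simp
  have cardI: "card I = T * (2 * k)" unfolding I_def using AB by (simp add: card_cartesian_product)
  \<comment> \<open>The coefficient of \<open>th ^ i\<close> in
    \<open>al ^ j * x ^ a * exp (l * lam * x)\<close> at \<open>x = th * X\<close>.\<close>
  define c where "c i = (\<lambda>(a, l, j). if a \<le> i then al ^ j * (X ^ a * (real l * lam * X) ^ (i - a) / fact (i - a)) else 0)" for i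
  \<comment> \<open>Here the relation enters: \<open>b * lam\<close> differs from
    \<open>ln ga\<close> by at most 1, so \<open>lam\<close> is at most \<open>h2 / b\<close>, and
    the exponentials stay below \<open>Q\<close> although \<open>X\<close> has the size of
    \<open>b * S3\<close>.\<close>
  have lamX: "\<bar>lam\<bar> * X \<le> V"
  proof -
    have "real b * lam = ln (be ^ b)" using be0 by (simp add: lam_def ln_realpow)
    also have "\<dots> = ln ga + ln (1 + tau)" unfolding rel(1) using ga0 rel(2) by (simp add: ln_mult)
    finally have e: "real b * lam = ln ga + ln (1 + tau)" .
    have "tau \<le> 1" using small by (rule order_trans) simp
    hence "0 \<le> ln (1 + tau)" "ln (1 + tau) \<le> 1" using rel(2) ln_add_one_self_le_self[of tau] by auto
    hence "\<bar>real b * lam\<bar> \<le> h2" unfolding e using sg(4) by linarith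
    hence "\<bar>lam\<bar> * b \<le> h2" by (simp add: abs_mult mult.commute)
    hence "\<bar>lam\<bar> * b * S3 \<le> real h2 * S3" by (intro mult_right_mono) auto
    moreover have "\<bar>lam\<bar> * S1 \<le> real h1 * S1" using sb(4) by (intro mult_right_mono) (auto simp: lam_def)
    ultimately show ?thesis unfolding X_def V_def by (simp add: algebra_simps)
  qed
  have lx: "real l * \<bar>lam\<bar> * x \<le> real B * V" if "l \<le> B" "0 \<le> x" "x \<le> X" for l x
  proof -
    have "\<bar>lam\<bar> * x \<le> V" using lamX that mult_left_mono[of x X "\<bar>lam\<bar>"] by auto
    hence "real l * (\<bar>lam\<bar> * x) \<le> real B * V" using that by (intro mult_mono) auto
    thus ?thesis by (simp add: mult.assoc)
  qed
  have al_j: "al ^ j \<le> 2 ^ k" if "j < k" for j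
  proof -
    have "al ^ j \<le> 2 ^ j" using al_lt al_ge_32 by (intro power_mono) auto
    also have "\<dots> \<le> (2::real) ^ k" using that by (intro power_increasing) auto
    finally show ?thesis .
  qed
  have cb: "\<bar>c i u\<bar> \<le> 2 ^ k * (Z * Q)" if "u \<in> I" for i u
  proof -
    obtain a l j where u: "u = (a, l, j)" "a < A" "l < B" "j < k" using \<open>u \<in> I\<close> unfolding I_def by auto
    have "\<bar>(real l * lam * X) ^ (i - a) / fact (i - a)\<bar> = (real l * \<bar>lam\<bar> * X) ^ (i - a) / fact (i - a)"
      using X1 by (simp add: abs_mult power_abs)
    also have "\<dots> \<le> exp (real l * \<bar>lam\<bar> * X)" using X1 by (intro power_over_fact_le_exp) auto
    also have "\<dots> \<le> Q" unfolding Q_def using lx[of l X] u X1 by simp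
    finally have q: "\<bar>(real l * lam * X) ^ (i - a) / fact (i - a)\<bar> \<le> Q" .
    have "\<bar>al ^ j * (X ^ a * ((real l * lam * X) ^ (i - a) / fact (i - a)))\<bar> = al ^ j * (X ^ a * \<bar>(real l * lam * X) ^ (i - a) / fact (i - a)\<bar>)"
      using al_ge_32 X1 by (simp add: abs_mult)
    also have "\<dots> \<le> 2 ^ k * (Z * Q)"
      using q al_j[OF u(4)] XA[of X a] X1 u al_ge_32 Z1 by (intro mult_mono) auto
    finally show ?thesis using u Z1 Q1 unfolding c_def by auto
  qed
  define G where "G = real k * w * Z * Q"
  have cG: "(\<Sum>u\<in>I. \<bar>c i u\<bar>) \<le> G" for i
  proof -
    have "(\<Sum>u\<in>I. \<bar>c i u\<bar>) \<le> (\<Sum>u\<in>I. 2 ^ k * (Z * Q))" using cb by (intro sum_mono) auto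
    also have "\<dots> = G" unfolding G_def w_def I_def by (simp add: card_cartesian_product)
    finally show ?thesis .
  qed
  have w1: "w \<ge> 1"
  proof -
    have "real (A * B * 2 ^ k) \<ge> 1" using A0 B0 by (simp del: of_nat_mult of_nat_power)
    thus ?thesis unfolding w_def by simp
  qed
  have G0: "G > 0" unfolding G_def using k0 w1 Z1 Q1 by simp
  have "(P ^ (2 * k) + 1) ^ T < ((P + 1) ^ (2 * k)) ^ T"
    using Suc_power_gt[OF P1, of "2 * k"] k0 A0 h by (intro power_strict_mono) (auto simp: T_def)
  hence count: "(P ^ (2 * k) + 1) ^ T < (P + 1) ^ card I" unfolding cardI by (simp add: power_mult[symmetric] mult.commute)
  obtain p :: "nat \<times> nat \<times> nat \<Rightarrow> int" where p: "\<forall>u. \<bar>p u\<bar> \<le> int P" "\<exists>u\<in>I. p u \<noteq> 0"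
    "\<forall>i<T. \<bar>\<Sum>u\<in>I. p u * c i u\<bar> \<le> 2 * real P * G / real P ^ (2 * k)"
    using siegel_real[OF finI P1 _ G0 _ count, of c] cG P1 by auto
  define rho where "rho a l = (\<Sum>j<k. p (a, l, j) * al ^ j)" for a l
  have pb: "\<bar>real_of_int (p u)\<bar> \<le> real P" for u using p(1) by (metis of_int_abs of_int_le_iff of_int_of_nat_eq)
  have sum2: "(\<Sum>j<k. (2::real) ^ j) \<le> 2 ^ k" using geometric_sum[of "2::real" k] by simp
  have rho_abs: "\<bar>rho a l\<bar> \<le> real P * 2 ^ k" for a l
  proof -
    have "\<bar>rho a l\<bar> \<le> (\<Sum>j<k. \<bar>p (a, l, j) * al ^ j\<bar>)" unfolding rho_def by (rule sum_abs)
    also have "\<dots> \<le> (\<Sum>j<k. real P * al ^ j)"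
      using pb al_ge_32 by (intro sum_mono) (auto simp: abs_mult intro!: mult_right_mono)
    also have "\<dots> \<le> real P * 2 ^ k" unfolding sum_distrib_left[symmetric] using sum_al_powers_le by (intro mult_left_mono) auto
    finally show ?thesis .
  qed
  have rho_sz: "mult_bounded (rho a l) (real P * 2 ^ k)" for a l
  proof -
    have "mult_bounded (rho a l) (\<Sum>j<k. real P * 2 ^ j)" unfolding rho_def
    proof (rule mult_bounded_sum)
      fix j
      have "mult_bounded (of_int (p (a, l, j))) P" using mult_bounded_mono[OF mult_bounded_of_int] pb by blast
      thus "mult_bounded (p (a, l, j) * al ^ j) (real P * 2 ^ j)" using mult_bounded_al by (intro mult_bounded_mult mult_bounded_power)
    qed simp
    thus ?thesis by (rule mult_bounded_mono) (unfold sum_distrib_left[symmetric], use sum2 in \<open>intro mult_left_mono, auto\<close>)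
  qed
  define f where "f x = (\<Sum>a<A. \<Sum>l<B. rho a l * x ^ a * exp (real l * lam * x))" for x
  define E where "E = exp (- (real A * real B / 4))"
  have TA: "real T - real A \<ge> real A * real B / 4"
  proof -
    have "real A * real B = 2 * real T" using AB by (metis of_nat_mult of_nat_numeral)
    moreover have "real A * 4 \<le> real A * real B" using B0 by (intro mult_left_mono) auto
    ultimately show ?thesis by linarith
  qed
  have T_ge_A: "A \<le> T" using TA A0 by (smt (verit) divide_nonneg_pos mult_nonneg_nonneg of_nat_0_le_iff of_nat_le_iff)
  have f_small: "\<bar>f x\<bar> \<le> T * (2 * real P * G / real P ^ (2 * k)) + w * P * Z * (Q ^ 3 * E)" if x: "0 \<le> x" "x \<le> X" for x
  proof -
    define th where "th = x / X"
    have th: "0 \<le> th" "th \<le> 1" "x = th * X" using x X1 by (auto simp: th_def)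
    \<comment> \<open>The Taylor expansion truncated below total order \<open>T\<close>, the part
      that Siegel's lemma makes small.\<close>
    define main where "main = (\<Sum>a<A. \<Sum>l<B. rho a l * (x ^ a * (\<Sum>j<T - a. (real l * lam * x) ^ j / fact j)))"
    have "main = (\<Sum>a<A. \<Sum>l<B. \<Sum>j<k. p (a, l, j) * (\<Sum>i<T. th ^ i * c i (a, l, j)))"
      unfolding main_def
    proof (intro sum.cong refl)
      fix a l assume a: "a \<in> {..<A}"
      have inner: "x ^ a * (\<Sum>j<T - a. (real l * lam * x) ^ j / fact j) * al ^ j' = (\<Sum>i<T. th ^ i * c i (a, l, j'))" for j'
      proof -
        have "(\<Sum>i<T. th ^ i * c i (a, l, j')) = (\<Sum>i\<in>{a..<T}. th ^ i * c i (a, l, j'))"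
          by (rule sum.mono_neutral_right) (auto simp: c_def)
        also have "\<dots> = (\<Sum>j<T - a. th ^ (j + a) * c (j + a) (a, l, j'))"
          by (rule sum.reindex_bij_witness[where i = "\<lambda>j. j + a" and j = "\<lambda>i. i - a"]) auto
        also have "\<dots> = (\<Sum>j<T - a. x ^ a * al ^ j' * ((real l * lam * x) ^ j / fact j))"
          by (intro sum.cong refl) (simp add: c_def th(3) power_mult_distrib power_add mult_ac)
        finally show ?thesis by (simp add: sum_distrib_left mult_ac)
      qed
      show "rho a l * (x ^ a * (\<Sum>j<T - a. (real l * lam * x) ^ j / fact j)) = (\<Sum>j<k. p (a, l, j) * (\<Sum>i<T. th ^ i * c i (a, l, j)))"
        unfolding inner[symmetric] rho_def sum_distrib_right by (simp only: mult_ac)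
    qed
    also have "\<dots> = (\<Sum>u\<in>I. p u * (\<Sum>i<T. th ^ i * c i u))"
      unfolding I_def by (simp add: sum.cartesian_product case_prod_unfold)
    also have "\<dots> = (\<Sum>i<T. th ^ i * (\<Sum>u\<in>I. p u * c i u))"
      unfolding sum_distrib_left by (subst sum.swap) (simp add: mult_ac)
    finally have main_eq: "main = (\<Sum>i<T. th ^ i * (\<Sum>u\<in>I. p u * c i u))" .
    have "\<bar>main\<bar> \<le> (\<Sum>i<T. \<bar>th ^ i * (\<Sum>u\<in>I. p u * c i u)\<bar>)" unfolding main_eq by (rule sum_abs)
    also have "\<dots> \<le> (\<Sum>i<T. 2 * real P * G / real P ^ (2 * k))"
    proof (rule sum_mono)
      fix i assume "i \<in> {..<T}"
      hence "\<bar>\<Sum>u\<in>I. p u * c i u\<bar> \<le> 2 * real P * G / real P ^ (2 * k)" using p(3) by simp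
      moreover have "th ^ i \<le> 1" using th by (intro power_le_one) auto
      ultimately have "th ^ i * \<bar>\<Sum>u\<in>I. p u * c i u\<bar> \<le> 1 * (2 * real P * G / real P ^ (2 * k))"
        using th by (intro mult_mono) auto
      thus "\<bar>th ^ i * (\<Sum>u\<in>I. p u * c i u)\<bar> \<le> 2 * real P * G / real P ^ (2 * k)" using th by (simp add: abs_mult)
    qed
    also have "\<dots> = T * (2 * real P * G / real P ^ (2 * k))" by simp
    finally have m1: "\<bar>main\<bar> \<le> T * (2 * real P * G / real P ^ (2 * k))" .
    have "f x - main = (\<Sum>a<A. \<Sum>l<B. rho a l * x ^ a * (exp (real l * lam * x) - (\<Sum>j<T - a. (real l * lam * x) ^ j / fact j)))"
      unfolding f_def main_def sum_subtractf[symmetric] by (intro sum.cong refl) (simp add: algebra_simps)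
    also have "\<bar>\<dots>\<bar> \<le> (\<Sum>a<A. \<Sum>l<B. real P * 2 ^ k * Z * (Q ^ 3 * E))"
    proof (rule order_trans[OF sum_abs], rule sum_mono, rule order_trans[OF sum_abs], rule sum_mono)
      fix a l assume al: "a \<in> {..<A}" "l \<in> {..<B}"
      have "\<bar>exp (real l * lam * x) - (\<Sum>j<T - a. (real l * lam * x) ^ j / fact j)\<bar> \<le> exp (3 * \<bar>real l * lam * x\<bar> - real (T - a))"
        by (rule exp_taylor_tail)
      also have "\<dots> \<le> exp (3 * (real B * V) - real A * real B / 4)"
      proof -
        have "\<bar>real l * lam * x\<bar> \<le> real B * V" using lx[of l x] x al by (simp add: abs_mult)
        moreover have "real (T - a) \<ge> real A * real B / 4" using TA al T_ge_A by (simp add: of_nat_diff)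
        ultimately show ?thesis by simp
      qed
      also have "\<dots> = Q ^ 3 * E" unfolding Q_def E_def by (simp add: exp_of_nat_mult[symmetric] exp_add[symmetric])
      finally have t: "\<bar>exp (real l * lam * x) - (\<Sum>j<T - a. (real l * lam * x) ^ j / fact j)\<bar> \<le> Q ^ 3 * E" .
      have xa: "x ^ a \<le> Z" using XA x al by auto
      show "\<bar>rho a l * x ^ a * (exp (real l * lam * x) - (\<Sum>j<T - a. (real l * lam * x) ^ j / fact j))\<bar> \<le> real P * 2 ^ k * Z * (Q ^ 3 * E)"
        unfolding abs_mult using rho_abs[of a l] t xa x Z1 by (intro mult_mono) auto
    qed
    also have "\<dots> = w * P * Z * (Q ^ 3 * E)" by (simp add: w_def)
    finally show ?thesis using m1 by linarith
  qed
  define Y where "Y s1 s3 = be ^ s1 * ga ^ s3" for s1 s3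
  define W where "W s1 s3 = (\<Sum>a<A. \<Sum>l<B. rho a l * real (s1 + b * s3) ^ a * Y s1 s3 ^ l)" for s1 s3
  \<comment> \<open>The balance behind \<open>A = 32 * k * V\<close> and
    \<open>B = 32 * k * L\<close>: each summand is \<open>A * B / 8\<close>, so that
    \<open>E\<close> exactly absorbs \<open>(Z * Q) ^ (4 * k)\<close>.\<close>
  have kV: "(4 * k) * (real A * real L) + (4 * k) * (real B * V) = real A * real B / 4"
    unfolding VA B by simp
  have S3B: "2 * real (S3 * B) \<le> Q"
  proof -
    have "2 * real (S3 * B) \<le> real B * V"
    proof -
      have "V = 2 * (S3 * h2)" unfolding V_def S1 S3 by (simp add: algebra_simps)
      hence "real B * V = 2 * real (S3 * B) * h2" by (simp add: mult_ac)
      moreover have "2 * real (S3 * B) * 1 \<le> 2 * real (S3 * B) * h2" using h by (intro mult_left_mono) auto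
      ultimately show ?thesis by linarith
    qed
    also have "\<dots> \<le> Q" unfolding Q_def using exp_ge_add_one_self[of "real B * V"] by linarith
    finally show ?thesis .
  qed
  have QE: "Q * E \<le> 1"
  proof -
    have "1 * (real B * V) \<le> (4 * k) * (real B * V)" using k0 V0 by (intro mult_right_mono) auto
    moreover have "0 \<le> (4 * k) * (real A * real L)" by simp
    ultimately have "real B * V \<le> real A * real B / 4" using kV by linarith
    thus ?thesis unfolding Q_def E_def by (simp add: exp_add[symmetric])
  qed
  have Zbig: "24 * real T * k * w + 1 \<le> Z"
  proof -
    have "real A * real L \<ge> 262144 * real k ^ 3"
    proof -
      have "262144 * k ^ 3 * 1 \<le> 262144 * k ^ 3 * (L * h1 * h2 * L)" using h by (intro mult_le_mono2) simp
      also have "\<dots> = A * L" unfolding A by (simp add: power2_eq_square power3_eq_cube)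
      finally have "real (262144 * k ^ 3) \<le> real (A * L)" by (simp only: of_nat_le_iff mult_1_right)
      thus ?thesis by simp
    qed
    from exp_dominates[OF k5 this] show ?thesis unfolding Z_def T_def w_def B by (simp add: mult_ac)
  qed
  have Zw: "6 * w \<le> Z"
  proof -
    have "1 \<le> real T * k"
    proof -
      have "1 \<le> T * k" unfolding T_def using k0 h A0 by simp
      thus ?thesis by (metis of_nat_1 of_nat_le_iff of_nat_mult)
    qed
    hence "1 * w \<le> (real T * k) * w" using w1 by (intro mult_right_mono) auto
    thus ?thesis using Zbig w1 by linarith
  qed
  have W_zero: "W s1 s3 = 0" if s: "s1 < S1" "s3 < S3" for s1 s3
  proof (rule ccontr)
    assume nz: "W s1 s3 \<noteq> 0"
    define x where "x = real (s1 + b * s3)"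
    have x: "0 \<le> x" "x \<le> X" unfolding x_def X_def using s by (auto intro!: add_mono mult_left_mono)
    have Y0: "Y s1 s3 > 0" unfolding Y_def using be0 ga0 by simp
    have bx: "exp (lam * x) = Y s1 s3 * (1 + tau) ^ s3"
    proof -
      have "exp (lam * x) = exp lam ^ (s1 + b * s3)" unfolding x_def by (simp only: exp_of_nat_mult[symmetric] mult.commute)
      also have "exp lam = be" unfolding lam_def using be0 by simp
      also have "be ^ (s1 + b * s3) = be ^ s1 * (be ^ b) ^ s3" by (simp add: power_add power_mult)
      finally show ?thesis unfolding rel(1) Y_def by (simp add: power_mult_distrib)
    qed
    have expl: "exp (real l * lam * x) = Y s1 s3 ^ l * (1 + tau) ^ (s3 * l)" for l
    proof -
      have "exp (real l * lam * x) = exp (lam * x) ^ l" by (simp add: exp_of_nat_mult[symmetric] mult_ac)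
      thus ?thesis unfolding bx by (simp add: power_mult_distrib power_mult)
    qed
    have Yl: "Y s1 s3 ^ l \<le> Q" if "l \<le> B" for l
    proof -
      have "Y s1 s3 ^ l * 1 \<le> Y s1 s3 ^ l * (1 + tau) ^ (s3 * l)" using Y0 rel(2) by (intro mult_left_mono one_le_power) auto
      also have "\<dots> = exp (real l * lam * x)" by (simp add: expl)
      also have "\<dots> \<le> exp (real l * \<bar>lam\<bar> * x)" using x by (intro exp_le_cancel_iff[THEN iffD2] mult_right_mono mult_left_mono) auto
      also have "\<dots> \<le> Q" unfolding Q_def using lx[OF that x] by simp
      finally show ?thesis by simp
    qed
    define N where "N = real (S3 * B)"
    have tE: "tau \<le> E" using small by (simp add: E_def)
    have Ntau: "N * tau \<le> 1"
    proof -
      have "N * tau \<le> Q * E" using S3B tE rel(2) Q1 unfolding N_def by (intro mult_mono) auto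
      thus ?thesis using QE by linarith
    qed
    have "f x - W s1 s3 = (\<Sum>a<A. \<Sum>l<B. rho a l * x ^ a * Y s1 s3 ^ l * ((1 + tau) ^ (s3 * l) - 1))"
      unfolding f_def W_def x_def[symmetric] sum_subtractf[symmetric] expl by (intro sum.cong refl) (simp add: algebra_simps)
    also have "\<bar>\<dots>\<bar> \<le> (\<Sum>a<A. \<Sum>l<B. real P * 2 ^ k * Z * Q * (2 * N * tau))"
    proof (rule order_trans[OF sum_abs], rule sum_mono, rule order_trans[OF sum_abs], rule sum_mono)
      fix a l assume al: "a \<in> {..<A}" "l \<in> {..<B}"
      have n: "s3 * l \<le> S3 * B" using s al by (intro mult_le_mono) auto
      have ge: "(1 + tau) ^ (s3 * l) - 1 \<ge> 0" using rel(2) by simp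
      have "(1 + tau) ^ (s3 * l) - 1 \<le> (1 + tau) ^ (S3 * B) - 1"
        using rel(2) n by (simp add: power_increasing)
      also have "\<dots> \<le> 2 * (N * tau)" unfolding N_def using rel(2) Ntau by (intro one_plus_power_minus_one_le) (auto simp: N_def)
      finally have t: "\<bar>(1 + tau) ^ (s3 * l) - 1\<bar> \<le> 2 * N * tau" using ge by simp
      have xa: "\<bar>x ^ a\<bar> \<le> Z" using XA[of x a] x al by auto
      have yl: "\<bar>Y s1 s3 ^ l\<bar> \<le> Q" using Yl[of l] al Y0 by auto
      show "\<bar>rho a l * x ^ a * Y s1 s3 ^ l * ((1 + tau) ^ (s3 * l) - 1)\<bar> \<le> real P * 2 ^ k * Z * Q * (2 * N * tau)"
        unfolding abs_mult using rho_abs[of a l] t xa yl Z1 Q1 by (intro mult_mono) (auto simp: abs_mult)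
    qed
    also have "\<dots> = w * P * Z * Q * (2 * N * tau)" by (simp add: w_def)
    finally have Wb: "\<bar>W s1 s3\<bar> \<le> T * (2 * real P * G / real P ^ (2 * k)) + w * P * Z * (Q ^ 3 * E) + w * P * Z * Q * (2 * N * tau)"
      using f_small[OF x] by linarith
    \<comment> \<open>Clears the denominators of all powers \<open>Y s1 s3 ^ l\<close> with
      \<open>l < B\<close> at once.\<close>
    define den where "den = (bd ^ s1 * gd ^ s3) ^ B"
    have den0: "den > 0" unfolding den_def using be ga by simp
    have eV: "exp h1 ^ s1 * exp h2 ^ s3 \<le> exp V"
    proof -
      have "exp h1 ^ s1 * exp h2 ^ s3 = exp (real s1 * h1 + real s3 * h2)" by (simp add: exp_of_nat_mult exp_add)
      also have "\<dots> \<le> exp V" unfolding V_def of_nat_add of_nat_mult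
        using s by (intro exp_le_cancel_iff[THEN iffD2] add_mono mult_right_mono) auto
      finally show ?thesis .
    qed
    have denQ: "den \<le> Q"
    proof -
      have "bd ^ s1 * gd ^ s3 \<le> exp h1 ^ s1 * exp h2 ^ s3" using sb sg be ga by (intro mult_mono power_mono) auto
      also note eV
      finally have "den \<le> exp V ^ B" unfolding den_def using be ga by (intro power_mono) auto
      thus ?thesis unfolding Q_def by (simp add: exp_of_nat_mult)
    qed
    have "den * W s1 s3 = (\<Sum>a<A. \<Sum>l<B. rho a l * x ^ a * ((bn ^ s1 * gn ^ s3) ^ l * (bd ^ s1 * gd ^ s3) ^ (B - l)))"
      unfolding W_def sum_distrib_left x_def[symmetric]
    proof (intro sum.cong refl)
      fix a l assume "l \<in> {..<B}"
      hence "(bd ^ s1 * gd ^ s3) ^ B = (bd ^ s1 * gd ^ s3) ^ l * (bd ^ s1 * gd ^ s3) ^ (B - l)"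
        by (simp add: power_add[symmetric])
      moreover have "bd ^ s1 * gd ^ s3 * Y s1 s3 = bn ^ s1 * gn ^ s3"
        unfolding Y_def be(1) ga(1) using be ga by (simp add: power_divide)
      hence "(bd ^ s1 * gd ^ s3) ^ l * Y s1 s3 ^ l = (bn ^ s1 * gn ^ s3) ^ l" by (simp only: power_mult_distrib[symmetric])
      ultimately show "den * (rho a l * x ^ a * Y s1 s3 ^ l) = rho a l * x ^ a * ((bn ^ s1 * gn ^ s3) ^ l * (bd ^ s1 * gd ^ s3) ^ (B - l))"
        unfolding den_def by (simp add: mult_ac)
    qed
    moreover have "mult_bounded \<dots> (\<Sum>a<A. \<Sum>l<B. real P * 2 ^ k * Z * Q)"
    proof (intro mult_bounded_sum)
      fix a l assume al: "a \<in> {..<A}" "l \<in> {..<B}"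
      have "mult_bounded (of_int (int (s1 + b * s3))) \<bar>of_int (int (s1 + b * s3))\<bar>" by (rule mult_bounded_of_int)
      hence "mult_bounded x x" unfolding x_def by simp
      hence "mult_bounded (x ^ a) (x ^ a)" by (rule mult_bounded_power)
      hence sx: "mult_bounded (x ^ a) Z" by (rule mult_bounded_mono) (use XA x al in auto)
      have "mult_bounded ((bn ^ s1 * gn ^ s3) ^ l * (bd ^ s1 * gd ^ s3) ^ (B - l))
            ((exp h1 ^ s1 * exp h2 ^ s3) ^ l * (exp h1 ^ s1 * exp h2 ^ s3) ^ (B - l))"
        using sb sg by (intro mult_bounded_mult mult_bounded_power)
      hence "mult_bounded ((bn ^ s1 * gn ^ s3) ^ l * (bd ^ s1 * gd ^ s3) ^ (B - l)) Q"
      proof (rule mult_bounded_mono)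
        have "(exp h1 ^ s1 * exp h2 ^ s3) ^ l * (exp h1 ^ s1 * exp h2 ^ s3) ^ (B - l) = (exp h1 ^ s1 * exp h2 ^ s3) ^ B"
          using al by (simp add: power_add[symmetric])
        also have "\<dots> \<le> exp V ^ B" using eV by (intro power_mono) auto
        also have "\<dots> = Q" unfolding Q_def by (simp add: exp_of_nat_mult)
        finally show "(exp h1 ^ s1 * exp h2 ^ s3) ^ l * (exp h1 ^ s1 * exp h2 ^ s3) ^ (B - l) \<le> Q" .
      qed
      thus "mult_bounded (rho a l * x ^ a * ((bn ^ s1 * gn ^ s3) ^ l * (bd ^ s1 * gd ^ s3) ^ (B - l))) (real P * 2 ^ k * Z * Q)"
        using rho_sz sx by (intro mult_bounded_mult)
    qed auto
    moreover have "(\<Sum>a<A. \<Sum>l<B. real P * 2 ^ k * Z * Q) = w * P * Z * Q" by (simp add: w_def)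
    ultimately have "mult_bounded (den * W s1 s3) (w * P * Z * Q)" by metis
    moreover have "den * W s1 s3 \<noteq> 0" using nz den0 by simp
    ultimately have "1 \<le> \<bar>den * W s1 s3\<bar> * 2 ^ k * (w * P * Z * Q) ^ (k - 1)" by (rule liouville)
    also have "\<dots> = \<bar>W s1 s3\<bar> * (den * 2 ^ k * (w * P * Z * Q) ^ (k - 1))" using den0 by (simp add: abs_mult)
    also have "\<dots> \<le> (T * (2 * real P * G / real P ^ (2 * k)) + w * P * Z * (Q ^ 3 * E) + w * P * Z * Q * (2 * N * tau)) * (Q * 2 ^ k * (w * P * Z * Q) ^ (k - 1))"
      using Wb denQ den0 w1 Z1 Q1 by (intro mult_mono) auto
    also have "\<dots> < 1" unfolding G_def
    proof (rule smallness_arith)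
      have "Z ^ (4 * k) * Q ^ (4 * k) * E = exp ((4 * k) * (real A * real L) + (4 * k) * (real B * V) - real A * real B / 4)"
        unfolding Z_def Q_def E_def by (simp add: exp_of_nat_mult[symmetric] exp_add[symmetric])
      thus "Z ^ (4 * k) * Q ^ (4 * k) * E \<le> 1" unfolding kV by simp
      show "2 * N \<le> Q" using S3B unfolding N_def .
    qed (use k5 Z1 Q1 P1 w1 Ple Pge Zbig Zw tE rel(2) in \<open>auto simp: E_def N_def\<close>)
    finally show False by simp
  qed
  have rho0: "rho a l = 0" if al: "a < A" "l < B" for a l
  \<comment> \<open>The range of \<open>s1\<close> is shortened by \<open>B\<close> so that shifts
    by \<open>t < B\<close> stay below \<open>S1\<close>. As \<open>S1 >= 2 * B\<close> and
    \<open>S1 * S3 = 2 * (A * B)\<close>, at least \<open>A * B\<close> points remain; they are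
    distinct because \<open>b >= S1\<close> makes \<open>s1\<close> a remainder modulo
    \<open>b\<close>.\<close>
  proof (rule exp_poly_zero_estimate[where A = A and B = B and rho = rho and be = be
        and X = "(\<lambda>(s1, s3). real (s1 + b * s3)) ` ({..<S1 - B} \<times> {..<S3})"])
    have inj: "inj_on (\<lambda>(s1, s3). real (s1 + b * s3)) ({..<S1 - B} \<times> {..<S3})"
    proof (rule inj_onI, clarify)
      fix s t s' t' assume *: "s < S1 - B" "s' < S1 - B" "real (s + b * t) = real (s' + b * t')"
      have eq: "s + b * t = s' + b * t'" using *(3) by (simp only: of_nat_eq_iff)
      have "(s + b * t) mod b = s" "(s' + b * t') mod b = s'" using * b by simp_all
      hence "s = s'" using eq by simp
      thus "s = s' \<and> t = t'" using eq b S10 by auto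
    qed
    have "S1 \<ge> 2 * B"
    proof -
      have "2 * B = 64 * k * L * 1" unfolding B by simp
      also have "\<dots> \<le> 4096 * k^2 * L * h2" using h k0 by (intro mult_le_mono) (auto simp: power2_eq_square)
      finally show ?thesis unfolding S1 .
    qed
    hence "S1 \<le> 2 * (S1 - B)" by simp
    hence "S1 * S3 \<le> 2 * ((S1 - B) * S3)" by simp
    moreover have "2 * (A * B) = S1 * S3" unfolding A B S1 S3 by (simp add: power2_eq_square)
    ultimately show "A * B \<le> card ((\<lambda>(s1, s3). real (s1 + b * s3)) ` ({..<S1 - B} \<times> {..<S3}))"
      unfolding card_image[OF inj] card_cartesian_product card_lessThan by linarith
    fix x assume "x \<in> (\<lambda>(s1, s3). real (s1 + b * s3)) ` ({..<S1 - B} \<times> {..<S3})"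
    then obtain s1 s3 where s: "s1 < S1 - B" "s3 < S3" "x = real (s1 + b * s3)" by auto
    have "(\<Sum>a<A. \<Sum>l<B. rho a l * (x + real t) ^ a * (be ^ t * Y s1 s3) ^ l) = 0" if t: "t < B" for t
    proof -
      have "W (s1 + t) s3 = 0" using s t by (intro W_zero) auto
      moreover have "be ^ t * Y s1 s3 = Y (s1 + t) s3" unfolding Y_def by (simp add: power_add mult_ac)
      moreover have "x + real t = real (s1 + t + b * s3)" using s by simp
      ultimately show ?thesis unfolding W_def by metis
    qed
    moreover have "Y s1 s3 \<noteq> 0" unfolding Y_def using be0 ga0 by simp
    ultimately show "\<exists>y. y \<noteq> 0 \<and> (\<forall>t<B. (\<Sum>a<A. \<Sum>l<B. rho a l * (x + real t) ^ a * (be ^ t * y) ^ l) = 0)" by blast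
  qed (use be be0 al in auto)
  obtain u where u: "u \<in> I" "p u \<noteq> 0" using p(2) by blast
  then obtain a l j where alj: "u = (a, l, j)" "a < A" "l < B" "j < k" unfolding I_def by auto
  have "(\<Sum>j<k. p (a, l, j) * al ^ j) = 0" using rho0[OF alj(2,3)] unfolding rho_def .
  from powers_independent[OF this alj(4)] show False using u alj by simp
qed

end

section \<open>Archimedean bounds for solutions\<close>

lemma exp_1_ge: "exp 1 \<ge> (27 / 10 :: real)"
proof -
  have s: "summable (\<lambda>j. (1::real) ^ j / fact j)" using summable_exp[of "1::real"] by (simp add: field_simps)
  have "exp 1 = (\<Sum>j. (1::real) ^ j / fact j)" by (simp add: exp_def divide_inverse mult.commute)
  moreover have "(\<Sum>j<5. (1::real) ^ j / fact j) \<le> (\<Sum>j. (1::real) ^ j / fact j)"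
    by (intro sum_le_suminf[OF s]) auto
  moreover have "(\<Sum>j<5. (1::real) ^ j / fact j) = 65 / 24" by (simp add: eval_nat_numeral fact_numeral)
  ultimately show ?thesis by linarith
qed

lemma two_power_le_exp: "(2::real) ^ n \<le> exp (real n)"
proof -
  have "(2::real) ^ n \<le> exp 1 ^ n" using exp_ge_add_one_self[of 1] by (intro power_mono) auto
  thus ?thesis by (simp add: exp_of_nat_mult[symmetric])
qed

lemma four_k_le_pow: "k \<ge> 5 \<Longrightarrow> 4 * real k + 2 \<le> 2 ^ k"
proof (induction k rule: dec_induct)
  case (step n)
  hence "4 * real (Suc n) + 2 \<le> 2 ^ n + 4" by simp
  also have "(4::real) \<le> 2 ^ n" using step.hyps power_increasing[of 2 n "2::real"] by simp
  finally show ?case by simp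
qed simp

context kfib
begin

text \<open>Since \<open>al\<close> is a unit, \<open>1 / al ^ p\<close> is an integer combination
  of the basis powers. If it were \<open>1 / 2 ^ r\<close> with \<open>r >= 1\<close>, independence
  would force an integer multiple of \<open>2 ^ r\<close> to be 1.\<close>

lemma al_power_neq_two_power: assumes "p \<ge> 1" shows "al ^ p \<noteq> 2 ^ r"
proof
  assume eq: "al ^ p = 2 ^ r"
  have "al ^ p > 1" using assms al_ge_32 by (intro one_less_power) auto
  hence r: "r \<ge> 1" using eq by (cases r) auto
  have "mult_bounded ((1 / al) ^ p) (2 ^ p)" using mult_bounded_al_inverse by (rule mult_bounded_power)
  then obtain M :: "nat \<Rightarrow> nat \<Rightarrow> int" where M: "\<forall>j<k. (\<Sum>i<k. al ^ i * M i j) = (1 / al) ^ p * al ^ j"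
    unfolding mult_bounded_def by blast
  have "(\<Sum>i<k. al ^ i * M i 0) = 1 / 2 ^ r" using M k2 eq by (simp add: power_one_over)
  hence "(\<Sum>i<k. al ^ i * M i 0) * 2 ^ r = 1" by simp
  hence e: "(\<Sum>i<k. 2 ^ r * M i 0 * al ^ i) = 1" unfolding sum_distrib_right by (simp add: mult_ac)
  have "(\<Sum>i<k. real_of_int (2 ^ r * M i 0 - (if i = 0 then 1 else 0)) * al ^ i) = (\<Sum>i<k. 2 ^ r * M i 0 * al ^ i) - (\<Sum>i<k. (if i = 0 then 1 else 0) * al ^ i)"
    unfolding sum_subtractf[symmetric] by (intro sum.cong refl) (simp add: algebra_simps)
  also have "(\<Sum>i<k. (if i = 0 then 1 else 0) * al ^ i) = (\<Sum>i<k. (if i = 0 then 1 else 0))" by (intro sum.cong) auto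
  also have "\<dots> = 1" using k2 by simp
  finally have "(\<Sum>i<k. real_of_int (2 ^ r * M i 0 - (if i = 0 then 1 else 0)) * al ^ i) = 0" using e by simp
  from powers_independent[OF this, of 0] k2 have o: "2 ^ r * M 0 0 = 1" by simp
  have "even (2 ^ r * M 0 0)" using r by simp
  thus False unfolding o by simp
qed

text \<open>The \<open>+ 1\<close> of the equation moves the error interval from
  \<open>-1..1\<close> to \<open>0..2\<close>, hence \<open>tau\<close> is nonnegative.\<close>

lemma solution_relation:
  assumes n: "n \<ge> 1" and m: "m \<ge> 1" and eq: "gen_fib k (int n) = int m * 2 ^ m + 1"
  shows "\<exists>tau. 0 \<le> tau \<and> tau \<le> 2 / 2 ^ m \<and> binet * al ^ (n - 1) = real m * 2 ^ m * (1 + tau)"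
proof -
  define D where "D = real m * 2 ^ m"
  have D: "D \<ge> 2 ^ m" unfolding D_def using m by simp
  have D0: "D > 0" using D by (rule less_le_trans[rotated]) simp
  have e: "real_of_int (gen_fib k (int n)) = D + 1" unfolding eq D_def by simp
  have "\<bar>D + 1 - binet * al ^ (n - 1)\<bar> \<le> 1" using gen_fib_approx[OF n] unfolding e .
  hence "D \<le> binet * al ^ (n - 1)" "binet * al ^ (n - 1) \<le> D + 2" by auto
  define tau where "tau = binet * al ^ (n - 1) / D - 1"
  have "tau \<ge> 0" unfolding tau_def using \<open>D \<le> _\<close> D0 by simp
  moreover have "tau \<le> 2 / D"
  proof -
    have "binet * al ^ (n - 1) / D \<le> (D + 2) / D" using \<open>_ \<le> D + 2\<close> D0 by (intro divide_right_mono) auto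
    also have "\<dots> = 1 + 2 / D" using D0 by (simp add: add_divide_distrib)
    finally show ?thesis by (simp add: tau_def)
  qed
  moreover have "2 / D \<le> 2 / 2 ^ m" using D D0 by (intro divide_left_mono) auto
  ultimately have "0 \<le> tau" "tau \<le> 2 / 2 ^ m" by linarith+
  moreover have "binet * al ^ (n - 1) = D * (1 + tau)" unfolding tau_def using D0 by simp
  ultimately show ?thesis unfolding D_def by blast
qed

lemma solution_m_less:
  assumes n: "n \<ge> 1" and m: "m \<ge> 1" and eq: "gen_fib k (int n) = int m * 2 ^ m + 1"
  shows "m \<le> n - 1"
proof -
  obtain tau where tau: "0 \<le> tau" "binet * al ^ (n - 1) = real m * 2 ^ m * (1 + tau)"
    using solution_relation[OF assms] by blast
  have "(2::real) ^ m * 1 \<le> (real m * 2 ^ m) * (1 + tau)" using m tau by (intro mult_mono) auto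
  also have "\<dots> \<le> 1 * 2 ^ (n - 1)" unfolding tau(2)[symmetric]
    using binet_bounds al_lt al_ge_32 by (intro mult_mono power_mono) auto
  finally have "(2::real) ^ m \<le> 2 ^ (n - 1)" by simp
  thus ?thesis by (simp only: power_increasing_iff one_less_numeral_iff semiring_norm)
qed

text \<open>Comparison of binary logarithms in \<open>solution_relation\<close>: the factor
  \<open>m\<close> costs \<open>nu\<close>, and replacing \<open>al\<close> by
  \<open>2 * (1 - 1 / 2 ^ k)\<close> costs \<open>2 * n / 2 ^ k\<close>.\<close>

lemma solution_m_lower:
  assumes n: "n \<ge> 1" and m: "m \<ge> 1" and eq: "gen_fib k (int n) = int m * 2 ^ m + 1" and nu: "n < 2 ^ nu"
  shows "real m \<ge> real n - 4 - real nu - 2 * real n / 2 ^ k"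
proof -
  obtain tau where tau: "0 \<le> tau" "tau \<le> 2 / 2 ^ m" "binet * al ^ (n - 1) = real m * 2 ^ m * (1 + tau)"
    using solution_relation[OF n m eq] by blast
  define ep :: real where "ep = 1 / 2 ^ k"
  have "(2::real) ^ 2 \<le> 2 ^ k" using k2 by (intro power_increasing) auto
  hence ep: "0 < ep" "ep \<le> 1 / 4" unfolding ep_def by (auto simp: divide_simps)
  have "m < 2 ^ nu" using solution_m_less[OF n m eq] nu n by linarith
  hence "real (m + 1) \<le> real (2 ^ nu)" by (simp only: of_nat_le_iff)
  hence mnu: "real m + 1 \<le> 2 ^ nu" by simp
  have "2 * (1 - ep) \<le> al" using al_ge by (simp add: ep_def)
  hence "1 / 4 * (2 * (1 - ep)) ^ (n - 1) \<le> binet * al ^ (n - 1)"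
    using binet_bounds ep by (intro mult_mono power_mono) auto
  also have "\<dots> \<le> real m * 2 ^ m * (1 + 2 / 2 ^ m)" unfolding tau(3) using tau by (intro mult_left_mono) auto
  also have "\<dots> = real m * (2 ^ m + 2)" by (simp add: field_simps)
  also have "\<dots> \<le> 2 ^ nu * (2 ^ m * 2)"
  proof (rule mult_mono)
    have "(2::real) ^ 1 \<le> 2 ^ m" using m by (intro power_increasing) auto
    thus "(2::real) ^ m + 2 \<le> 2 ^ m * 2" by simp
    show "real m \<le> 2 ^ nu" using mnu by linarith
  qed auto
  finally have "1 / 4 * (2 ^ (n - 1) * (1 - ep) ^ (n - 1)) \<le> 2 ^ nu * (2 ^ m * 2)" by (simp only: power_mult_distrib)
  moreover have "(2::real) ^ (nu + m + 3) = 4 * (2 ^ nu * (2 ^ m * 2))" by (simp add: power_add)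
  ultimately have "2 ^ (n - 1) * (1 - ep) ^ (n - 1) \<le> 2 ^ (nu + m + 3)" by linarith
  hence "ln (2 ^ (n - 1) * (1 - ep) ^ (n - 1)) \<le> ln (2 ^ (nu + m + 3))" using ep by (subst ln_le_cancel_iff) auto
  hence l: "real (n - 1) * ln 2 + real (n - 1) * ln (1 - ep) \<le> real (nu + m + 3) * ln 2"
    using ep by (simp add: ln_mult ln_realpow del: of_nat_add)
  have "ln (1 - ep) \<ge> - (4 / 3 * ep)"
  proof -
    have "- ln (1 - ep) = ln (1 / (1 - ep))" using ep by (simp add: ln_div)
    also have "\<dots> \<le> 1 / (1 - ep) - 1" using ep by (intro ln_le_minus_one) auto
    also have "\<dots> = ep / (1 - ep)" using ep by (simp add: field_simps)
    also have "\<dots> \<le> ep / (3 / 4)" using ep by (intro divide_left_mono) auto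
    finally show ?thesis by simp
  qed
  moreover have "4 / 3 * ep \<le> 2 * ep * ln 2" using ln2_ge_two_thirds ep by simp
  ultimately have "real (n - 1) * ln (1 - ep) \<ge> real (n - 1) * (- (2 * ep * ln 2))" by (intro mult_left_mono) auto
  with l have "(real (n - 1) - 2 * ep * real (n - 1)) * ln 2 \<le> real (nu + m + 3) * ln 2" by (simp add: algebra_simps)
  hence "real (n - 1) - 2 * ep * real (n - 1) \<le> real (nu + m + 3)" by simp
  moreover have "2 * ep * real (n - 1) \<le> 2 * ep * real n" using ep by (intro mult_left_mono) auto
  ultimately have "real n - 1 - 2 * ep * real n \<le> real nu + real m + 3" using n by (simp add: of_nat_diff)
  thus ?thesis unfolding ep_def by simp
qed

text \<open>The interpolation argument for \<open>be = al ^ p / 2 ^ r\<close> with exponent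
  \<open>b\<close>. What is left over, namely \<open>m\<close>, \<open>binet\<close>,
  \<open>al ^ n0\<close> and \<open>2 ^ (m - b * r)\<close>, forms \<open>ga\<close>, of logarithmic
  height at most \<open>nu + k + p + mm\<close>. The constant is \<open>3 / 2 * 2097152\<close>:
  \<open>A * B / 4\<close> has the constant \<open>64 * 4096 * 32 / 4 = 2097152\<close>, and
  \<open>3 / 2\<close> comes from \<open>ln 2 >= 2 / 3\<close>.\<close>

lemma no_solution_of_approximation:
  assumes k5: "k \<ge> 5" and n: "n \<ge> 1" and m: "m \<ge> 1" and eq: "gen_fib k (int n) = int m * 2 ^ m + 1"
    and p: "p \<ge> 1" and r: "r \<le> p" and bn: "n - 1 = b * p + n0" "n0 < p"
    and nu: "n < 2 ^ nu" and mm: "mm = nat \<bar>int m - int (b * r)\<bar>"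
    and big: "3145728 * k ^ 4 * nu ^ 2 * p * (nu + k + p + mm) + 1 \<le> m"
    and nu2: "4097 * real k ^ 2 * real nu \<le> (27 / 20) ^ nu"
  shows False
proof -
  define h2 where "h2 = nu + k + p + mm"
  define S1 where "S1 = 4096 * k^2 * nu * h2"
  define S3 where "S3 = 4096 * k^2 * nu * p"
  define A where "A = 64 * k * (4096 * k^2 * nu) * p * h2"
  define B where "B = 32 * k * nu"
  define c1 where "c1 = (real k + 1) * al - 2 * real k"
  define c0 where "c0 = al - 1"
  have c0: "c0 > 0" "c0 < 1" unfolding c0_def using al_ge_32 al_lt by auto
  have c1: "c1 > 0" unfolding c1_def using binet_denom_ge al_ge_32 by linarith
  have bin: "binet = c0 / c1" unfolding binet_def c0_def c1_def ..
  have nu1: "nu \<ge> 1" using nu n by (cases nu) auto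
  obtain tau where tau: "0 \<le> tau" "tau \<le> 2 / 2 ^ m" "binet * al ^ (n - 1) = real m * 2 ^ m * (1 + tau)"
    using solution_relation[OF n m eq] by blast
  have m_n: "m \<le> n - 1" by (rule solution_m_less[OF n m eq])
  \<comment> \<open>\<open>up / dn\<close> is \<open>2 ^ (m - b * r)\<close>, whose exponent may be
    negative.\<close>
  define up where "up = (if m \<ge> b * r then (2::real) ^ mm else 1)"
  define dn where "dn = (if m \<ge> b * r then 1 else (2::real) ^ mm)"
  have updn: "2 ^ m * dn = 2 ^ (b * r) * up"
  proof (cases "m \<ge> b * r")
    case True
    hence "m = b * r + mm" unfolding mm by linarith
    thus ?thesis using True by (simp add: up_def dn_def power_add)
  next
    case False
    hence "b * r = m + mm" unfolding mm by linarith
    thus ?thesis using False by (simp add: up_def dn_def power_add)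
  qed
  have up: "1 \<le> up" "up \<le> 2 ^ mm" and dn: "1 \<le> dn" "dn \<le> 2 ^ mm" unfolding up_def dn_def by auto
  have sz2: "mult_bounded (2 ^ j) (2 ^ j)" for j using mult_bounded_power[OF mult_bounded_of_int[of 2], of j] by simp
  have sz1: "mult_bounded 1 1" using mult_bounded_of_int[of 1] by simp
  have mult_bounded_up: "mult_bounded up (2 ^ mm)" and mult_bounded_dn: "mult_bounded dn (2 ^ mm)"
    unfolding up_def dn_def using sz2 mult_bounded_mono[OF sz1, of "2 ^ mm"] by auto
  define gn where "gn = real m * up * (1 / al) ^ n0 * c1"
  define gd where "gd = dn * c0"
  have g0: "gn > 0" "gd > 0" unfolding gn_def gd_def using m up dn c0 c1 al_ge_32 by auto
  define ga where "ga = gn / gd"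
  have rel: "(al ^ p / 2 ^ r) ^ b = ga * (1 + tau)"
  proof -
    have nz: "al ^ n0 \<noteq> 0" "(2::real) ^ (b * r) \<noteq> 0" "dn \<noteq> 0" using al_ge_32 dn by auto
    have a: "al ^ (n - 1) = (al ^ p) ^ b * al ^ n0" unfolding bn by (simp add: power_add power_mult[symmetric] mult.commute)
    have "c0 * ((al ^ p) ^ b * al ^ n0) = real m * 2 ^ m * (1 + tau) * c1"
      using tau(3) c1 unfolding bin a by (simp add: field_simps)
    hence "c0 * ((al ^ p) ^ b * al ^ n0) * dn = real m * (2 ^ m * dn) * (1 + tau) * c1" by simp
    hence "c0 * ((al ^ p) ^ b * al ^ n0) * dn = real m * (2 ^ (b * r) * up) * (1 + tau) * c1" by (simp only: updn)
    hence "(al ^ p) ^ b / 2 ^ (b * r) = real m * up * (1 / al ^ n0) * c1 / (dn * c0) * (1 + tau)"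
      using nz c0 by (simp add: field_simps)
    thus ?thesis unfolding ga_def gn_def gd_def by (simp add: power_divide power_mult[symmetric] mult.commute power_one_over)
  qed
  have e2: "(2::real) ^ j \<le> exp (real i)" if "j \<le> i" for i j
    using order_trans[OF two_power_le_exp[of j]] that by simp
  have sbn: "mult_bounded (al ^ p) (exp p)" using mult_bounded_mono[OF mult_bounded_power[OF mult_bounded_al, of p]] e2[of p p] by simp
  have sbd: "mult_bounded (2 ^ r) (exp p)" using mult_bounded_mono[OF sz2[of r]] e2[OF r] by simp
  have lb: "\<bar>ln (al ^ p / 2 ^ r)\<bar> \<le> p"
  proof -
    have l2: "ln 2 \<le> (1::real)" using ln_le_minus_one[of "2::real"] by simp
    have la: "0 \<le> ln al" "ln al \<le> ln 2" using al_ge_32 al_lt by auto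
    have "ln (al ^ p / 2 ^ r) = real p * ln al - real r * ln 2" using al_ge_32 by (simp add: ln_div ln_realpow)
    moreover have "0 \<le> real p * ln al" "0 \<le> real r * ln 2" using la by auto
    moreover have "real p * ln al \<le> real p * 1" using la l2 by (intro mult_left_mono) auto
    moreover have "real r * ln 2 \<le> real p * 1" using l2 r by (intro mult_mono) auto
    ultimately show ?thesis unfolding abs_le_iff by linarith
  qed
  have "m \<le> 2 ^ nu" using m_n nu n by linarith
  hence "real m \<le> real (2 ^ nu)" by (simp only: of_nat_le_iff)
  hence m2: "real m \<le> 2 ^ nu" by simp
  have k4: "4 * real k + 2 \<le> 2 ^ k" by (rule four_k_le_pow[OF k5])
  have sgn: "mult_bounded gn (exp h2)"
  proof -
    have c: "mult_bounded c1 (4 * real k + 2)"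
    proof -
      have "mult_bounded (of_int (int k + 1) * al + of_int (- 2 * int k)) (\<bar>of_int (int k + 1)\<bar> * 2 + \<bar>of_int (- 2 * int k)\<bar>)"
        by (intro mult_bounded_add mult_bounded_mult mult_bounded_of_int mult_bounded_al)
      thus ?thesis by (simp add: c1_def algebra_simps)
    qed
    have "mult_bounded (real m) (real m)" using mult_bounded_of_int[of "int m"] by simp
    hence "mult_bounded gn (real m * 2 ^ mm * 2 ^ n0 * (4 * real k + 2))"
      unfolding gn_def using c mult_bounded_up mult_bounded_al_inverse by (intro mult_bounded_mult mult_bounded_power)
    moreover have "real m * 2 ^ mm * 2 ^ n0 * (4 * real k + 2) \<le> exp h2"
    proof -
      have "real m * 2 ^ mm * 2 ^ n0 * (4 * real k + 2) \<le> 2 ^ nu * 2 ^ mm * 2 ^ p * 2 ^ k"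
        using m2 k4 bn by (intro mult_mono power_increasing) auto
      also have "\<dots> = 2 ^ (nu + mm + p + k)" by (simp add: power_add)
      also have "\<dots> \<le> exp h2" unfolding h2_def by (rule e2) simp
      finally show ?thesis .
    qed
    ultimately show ?thesis by (rule mult_bounded_mono)
  qed
  have sgd: "mult_bounded gd (exp h2)"
  proof -
    have "mult_bounded (al + of_int (-1)) (2 + \<bar>of_int (-1)\<bar>)" by (intro mult_bounded_add mult_bounded_of_int mult_bounded_al)
    hence "mult_bounded c0 3" unfolding c0_def by simp
    hence g: "mult_bounded gd (2 ^ mm * 3)" unfolding gd_def using mult_bounded_dn by (intro mult_bounded_mult)
    have "(3::real) \<le> 2 ^ k" using k4 k5 by linarith
    hence "2 ^ mm * (3::real) \<le> 2 ^ (mm + k)" by (simp add: power_add)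
    also have "\<dots> \<le> exp h2" unfolding h2_def by (rule e2) simp
    finally have "2 ^ mm * (3::real) \<le> exp h2" .
    with g show ?thesis by (rule mult_bounded_mono)
  qed
  have gd_le: "gd \<le> exp h2"
  proof -
    have "gd \<le> 2 ^ mm * 1" unfolding gd_def using dn c0 by (intro mult_mono) auto
    thus ?thesis using e2[of mm h2] unfolding h2_def by simp
  qed
  have lg: "\<bar>ln ga\<bar> \<le> real h2 - 1"
  proof -
    have l2: "0 \<le> ln (2::real)" "ln 2 \<le> (1::real)" using ln_le_minus_one[of "2::real"] by simp_all
    have pw: "ln ((2::real) ^ j) \<le> real j" for j using l2 mult_left_mono[of "ln 2" 1 "real j"] by (simp add: ln_realpow)
    have "ga = real m * up * (1 / al) ^ n0 * (1 / binet) / dn" unfolding ga_def gn_def gd_def bin using c0 by (simp add: field_simps)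
    hence lnga: "ln ga = ln (real m) + ln up - real n0 * ln al - ln binet - ln dn"
      using m up dn al_ge_32 binet_bounds by (simp add: ln_mult ln_div ln_realpow power_one_over)
    have a1: "0 \<le> ln (real m)" "ln (real m) \<le> real nu"
    proof -
      show "0 \<le> ln (real m)" using m by simp
      have "ln (real m) \<le> ln (2 ^ nu)" using m m2 by (subst ln_le_cancel_iff) auto
      thus "ln (real m) \<le> real nu" using pw[of nu] by linarith
    qed
    have a2: "0 \<le> ln up" "0 \<le> ln dn" "ln up + ln dn \<le> real mm"
      using up dn pw[of mm] by (auto simp: up_def dn_def)
    have a3: "0 \<le> real n0 * ln al" "real n0 * ln al \<le> real p"
    proof -
      have "0 \<le> ln al" "ln al \<le> 1" using al_ge_32 al_lt ln_le_minus_one[of al] by auto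
      thus "0 \<le> real n0 * ln al" "real n0 * ln al \<le> real p" using bn mult_mono[of "real n0" "real p" "ln al" 1] by auto
    qed
    have a4: "ln binet \<le> 0" "- ln binet \<le> 2"
    proof -
      show "ln binet \<le> 0" using binet_bounds by simp
      have "ln (1 / 4) \<le> ln binet" using binet_bounds by (subst ln_le_cancel_iff) auto
      moreover have "ln (1 / 4 :: real) = - ln (2 ^ 2)" by (simp add: ln_div)
      ultimately show "- ln binet \<le> 2" using pw[of 2] by simp
    qed
    show ?thesis unfolding lnga h2_def using a1 a2 a3 a4 k5 by (simp add: abs_le_iff)
  qed
  have small: "tau \<le> exp (- (real A * real B / 4))"
  proof -
    define H where "H = 2097152 * k ^ 4 * nu ^ 2 * p * h2"
    have AB: "real A * real B / 4 = real H" unfolding A_def B_def H_def by (simp add: power4_eq_xxxx power2_eq_square)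
    have "3 * H + 2 \<le> 2 * m" using big unfolding H_def h2_def by simp
    hence "3 * real H + 2 \<le> 2 * real m" 
    proof -
      have "real (3 * H + 2) \<le> real (2 * m)" using \<open>3 * H + 2 \<le> 2 * m\<close> by (simp only: of_nat_le_iff)
      thus ?thesis by simp
    qed
    hence "real H \<le> (real m - 1) * (2 / 3)" by simp
    also have "\<dots> \<le> (real m - 1) * ln 2" using ln2_ge_two_thirds m by (intro mult_left_mono) auto
    finally have "exp (real H) \<le> exp ((real m - 1) * ln 2)" by simp
    also have "\<dots> = 2 ^ (m - 1)" using m exp_of_nat_mult[of "m - 1" "ln (2::real)"] by (simp add: of_nat_diff)
    finally have "exp (real H) \<le> 2 ^ (m - 1)" .
    hence "inverse (2 ^ (m - 1)) \<le> inverse (exp (real H))" by (intro le_imp_inverse_le) auto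
    moreover have "2 / 2 ^ m = inverse ((2::real) ^ (m - 1))" using m by (cases m) (auto simp: field_simps)
    ultimately show ?thesis unfolding AB exp_minus using tau(2) by linarith
  qed
  have h2p: "h2 \<ge> 1" unfolding h2_def using p by simp
  have b_ge: "b \<ge> S1"
  proof (rule ccontr)
    assume "\<not> ?thesis"
    hence "b + 1 \<le> S1" by simp
    have "n - 1 < (b + 1) * p" using bn by simp
    also have "\<dots> \<le> S1 * p" using mult_le_mono1[OF \<open>b + 1 \<le> S1\<close>, of p] .
    also have "S1 * p = 4096 * (k ^ 2 * nu) * (p * h2)" unfolding S1_def by simp
    also have "\<dots> \<le> 3145728 * (k ^ 4 * nu ^ 2) * (p * h2)"
    proof (intro mult_le_mono)
      show "k ^ 2 \<le> k ^ 4" using k5 by (intro power_increasing) auto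
      show "nu \<le> nu ^ 2" using nu1 by (simp add: power2_eq_square)
    qed auto
    also have "\<dots> \<le> m" using big unfolding h2_def by (simp add: mult_ac)
    finally show False using m_n by simp
  qed
  \<comment> \<open>The points are at most \<open>2 ^ nu * 4097 * k ^ 2 * nu\<close>. Hypothesis
    \<open>nu2\<close> has base \<open>27 / 20\<close> because its double \<open>27 / 10\<close> is
    below \<open>exp 1\<close>.\<close>
  have X: "real (S1 + b * S3) \<le> exp nu"
  proof -
    have "S1 + b * S3 \<le> b * (1 + S3)" using b_ge by simp
    also have "\<dots> \<le> b * (p * (1 + 4096 * k^2 * nu))" using p unfolding S3_def by (intro mult_le_mono2) (simp add: algebra_simps)
    also have "\<dots> \<le> n * (1 + 4096 * k^2 * nu)"
    proof -
      have "b * p \<le> n" using bn(1) by linarith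
      thus ?thesis by (simp only: mult.assoc[symmetric] mult_le_mono1)
    qed
    also have "\<dots> \<le> 2 ^ nu * (4097 * k^2 * nu)"
    proof (rule mult_le_mono)
      have "1 \<le> k^2 * nu" using k5 nu1 by simp
      thus "1 + 4096 * k^2 * nu \<le> 4097 * k^2 * nu" by simp
    qed (use nu in simp)
    finally have "real (S1 + b * S3) \<le> real (2 ^ nu * (4097 * k^2 * nu))" by (simp only: of_nat_le_iff)
    also have "\<dots> = 2 ^ nu * (4097 * real k ^ 2 * real nu)" by simp
    also have "\<dots> \<le> 2 ^ nu * (27 / 20) ^ nu" using nu2 by (intro mult_left_mono) auto
    also have "\<dots> = (27 / 10) ^ nu" unfolding power_mult_distrib[symmetric] by simp
    also have "\<dots> \<le> exp 1 ^ nu" using exp_1_ge by (intro power_mono) auto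
    also have "\<dots> = exp nu" by (simp add: exp_of_nat_mult[symmetric])
    finally show ?thesis .
  qed
  show False
  proof (rule two_logarithms[where be = "al ^ p / 2 ^ r" and bn = "al ^ p" and bd = "2 ^ r" and ga = ga and gn = gn and gd = gd
        and tau = tau and b = b and ?h1.0 = p and ?h2.0 = h2 and L = nu and ?S1.0 = S1 and ?S3.0 = S3 and A = A and B = B])
    show "al ^ p / 2 ^ r \<noteq> 1" using al_power_neq_two_power[OF p, of r] by auto
    show "(2::real) ^ r \<le> exp p" using e2[OF r] .
  qed (use k5 al_ge_32 g0 sbn sbd lb sgn sgd gd_le lg rel tau p h2p nu1 X b_ge small in
      \<open>auto simp: ga_def S1_def S3_def A_def B_def\<close>)
qed

end

section \<open>Two choices of the exponents \<open>p\<close> and \<open>r\<close>\<close>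

context kfib
begin

lemma solution_m_half:
  assumes k5: "k \<ge> 5" and n: "n \<ge> 1" and m: "m \<ge> 1" and eq: "gen_fib k (int n) = int m * 2 ^ m + 1" and nu: "n < 2 ^ nu"
  shows "real m \<ge> 15 / 16 * real n - 4 - real nu"
proof -
  have "(2::real) ^ 5 \<le> 2 ^ k" using k5 by (intro power_increasing) auto
  hence "2 * real n / 2 ^ k \<le> 2 * real n / 32" by (intro divide_left_mono) auto
  thus ?thesis using solution_m_lower[OF n m eq nu] by simp
qed

text \<open>With \<open>p = r = 1\<close> the defect \<open>mm\<close> is \<open>n - 1 - m\<close>,
  at most \<open>nu + 3 + 2 * n / 2 ^ k\<close>. By \<open>8 * K <= 2 ^ k\<close> the last part,
  multiplied by \<open>K\<close>, is at most \<open>n / 4\<close>, so \<open>n\<close> need only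
  exceed a multiple of \<open>K * (nu + k)\<close>, not of \<open>K ^ 3\<close>.\<close>

lemma no_solution_near_two:
  assumes k5: "k \<ge> 5" and n: "n \<ge> 1" and m: "m \<ge> 1" and eq: "gen_fib k (int n) = int m * 2 ^ m + 1"
    and nu: "n < 2 ^ nu" and K: "K = 3145728 * k ^ 4 * nu ^ 2"
    and k_big: "8 * K \<le> 2 ^ k" and n_big: "4 * K * (2 * nu + k + 6) + 8 \<le> n"
    and nu2: "4097 * real k ^ 2 * real nu \<le> (27 / 20) ^ nu"
  shows False
proof -
  have nu1: "nu \<ge> 1" using nu n by (cases nu) auto
  have K1: "K \<ge> 1" unfolding K using k5 nu1 by simp
  have m_n: "m \<le> n - 1" by (rule solution_m_less[OF n m eq])
  define mm where "mm = nat \<bar>int m - int ((n - 1) * 1)\<bar>"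
  have mm: "mm = n - 1 - m" using m_n unfolding mm_def by linarith
  have r: "real mm = real n - 1 - real m" unfolding mm using m_n n by (simp add: of_nat_diff)
  have l: "real m \<ge> real n - 4 - real nu - 2 * real n / 2 ^ k" by (rule solution_m_lower[OF n m eq nu])
  have "real (8 * K) \<le> real (2 ^ k)" using k_big by (simp only: of_nat_le_iff)
  hence "8 * real K \<le> 2 ^ k" by simp
  hence "real K * (2 * real n / 2 ^ k) \<le> (2 ^ k / 8) * (2 * real n / 2 ^ k)" by (intro mult_right_mono) auto
  also have "\<dots> = real n / 4" by simp
  finally have kn: "real K * (2 * real n / 2 ^ k) \<le> real n / 4" .
  have "real K * real mm \<le> real K * (3 + real nu + 2 * real n / 2 ^ k)" using r l by (intro mult_left_mono) auto
  also have "\<dots> = real K * (3 + real nu) + real K * (2 * real n / 2 ^ k)" by (simp add: distrib_left)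
  also have "\<dots> \<le> real K * (3 + real nu) + real n / 4" using kn by simp
  finally have a: "real K * real mm \<le> real K * (3 + real nu) + real n / 4" .
  have "real (4 * K * (2 * nu + k + 6) + 8) \<le> real n" using n_big by (simp only: of_nat_le_iff)
  hence b: "real K * (2 * real nu + real k + 6) + 2 \<le> real n / 4" by simp
  have d: "2 * real nu + real k + 6 \<le> real K * (2 * real nu + real k + 6)"
    using mult_right_mono[of 1 "real K" "2 * real nu + real k + 6"] K1 by simp
  have c: "2 * real nu + 8 \<le> real n / 4"
  proof -
    have "2 * real nu + 8 \<le> (2 * real nu + real k + 6) + 2" by simp
    also have "\<dots> \<le> real K * (2 * real nu + real k + 6) + 2" using d by (rule add_right_mono)
    also note b
    finally show ?thesis .
  qed
  have "real K * (real nu + real k + 1 + real mm) + 1 \<le> real m"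
  proof -
    have "real K * (real nu + real k + 1 + real mm) = real K * (real nu + real k + 1) + real K * real mm" by (simp add: distrib_left)
    also have "\<dots> \<le> real K * (real nu + real k + 1) + real K * (3 + real nu) + real n / 4" using a by simp
    also have "\<dots> = real K * (2 * real nu + real k + 4) + real n / 4" by (simp add: algebra_simps)
    also have "\<dots> \<le> real K * (2 * real nu + real k + 6) + real n / 4" by (intro add_right_mono mult_left_mono) auto
    finally show ?thesis using b c solution_m_half[OF k5 n m eq nu] by linarith
  qed
  hence "real (K * (nu + k + 1 + mm) + 1) \<le> real m" by (simp add: algebra_simps)
  hence "K * (nu + k + 1 + mm) + 1 \<le> m" by (simp only: of_nat_le_iff)
  hence big: "3145728 * k ^ 4 * nu ^ 2 * 1 * (nu + k + 1 + mm) + 1 \<le> m" unfolding K by simp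
  have t: "(1::nat) \<le> 1" "(0::nat) < 1" "n - 1 = (n - 1) * 1 + 0" by auto
  show False
    by (rule no_solution_of_approximation[OF k5 n m eq t(1) t(1) t(3) t(2) nu mm_def big nu2])
qed

text \<open>Dirichlet's theorem for \<open>m / (n - 1)\<close> with denominators up to
  \<open>Y = 4 * K\<close> gives \<open>p * mm <= n / Y + Y ^ 2\<close>. Multiplied by
  \<open>K\<close>, the first part is \<open>n / 4\<close>; the remaining terms sum to
  \<open>36 * K ^ 3\<close>, again at most \<open>n / 4\<close>, whence the constant 145.\<close>

lemma no_solution_large:
  assumes k5: "k \<ge> 5" and n: "n \<ge> 1" and m: "m \<ge> 1" and eq: "gen_fib k (int n) = int m * 2 ^ m + 1"
    and nu: "n < 2 ^ nu" and K: "K = 3145728 * k ^ 4 * nu ^ 2"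
    and n_big: "145 * K ^ 3 \<le> n"
    and nu2: "4097 * real k ^ 2 * real nu \<le> (27 / 20) ^ nu"
  shows False
proof -
  have nu1: "nu \<ge> 1" using nu n by (cases nu) auto
  have k4: "k \<le> k ^ 4" using k5 by (intro self_le_power) auto
  have n4: "nu \<le> nu ^ 2" using nu1 by (intro self_le_power) auto
  have K1: "nu + k \<le> K"
  proof -
    have "1 * nu \<le> k ^ 4 * nu ^ 2" using n4 k5 by (intro mult_le_mono) auto
    moreover have "k * 1 \<le> k ^ 4 * nu ^ 2" using k4 nu1 by (intro mult_le_mono) auto
    ultimately show ?thesis unfolding K by simp
  qed
  have K0: "K \<ge> 1" using K1 nu1 by linarith
  have K3: "K \<le> K ^ 3" using K0 by (intro self_le_power) auto
  have nK: "145 * K \<le> n" using K3 n_big by linarith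
  have n2: "n \<ge> 145" using nK K0 by linarith
  have m_n: "m \<le> n - 1" by (rule solution_m_less[OF n m eq])
  define Y where "Y = 4 * K"
  have Y0: "Y > 0" unfolding Y_def using K0 by simp
  define th where "th = real m / real (n - 1)"
  have n1: "real (n - 1) > 0" using n2 by simp
  have th: "0 \<le> th" "th \<le> 1" unfolding th_def using m_n n1 by auto
  obtain h p' where hp: "0 < p'" "p' \<le> int Y" "\<bar>of_int p' * th - of_int h\<bar> < 1 / Y"
    using Dirichlet_approx[OF Y0, of th] by blast
  define p where "p = nat p'"
  have p: "p \<ge> 1" "p \<le> Y" "real_of_int p' = real p" unfolding p_def using hp by auto
  have Y1: "1 / real Y \<le> 1" using Y0 by simp
  have pt: "0 \<le> real p * th" "real p * th \<le> real p" using th by (auto simp: mult_left_le)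
  have "real_of_int h > -1" using hp(3) pt Y1 unfolding p(3) by linarith
  hence h0: "h \<ge> 0" by linarith
  have "real_of_int h < real p + 1" using hp(3) pt Y1 unfolding p(3) by linarith
  hence hle: "h \<le> int p" by linarith
  define r where "r = nat h"
  have r: "r \<le> p" "real_of_int h = real r" unfolding r_def using h0 hle by auto
  define b where "b = (n - 1) div p"
  define n0 where "n0 = (n - 1) mod p"
  have bn: "n - 1 = b * p + n0" "n0 < p" unfolding b_def n0_def using p by auto
  define mm where "mm = nat \<bar>int m - int (b * r)\<bar>"
  have "real m = th * real (b * p + n0)" unfolding bn(1)[symmetric] th_def using n1 by simp
  hence "real m - real b * real r = real b * (real p * th - real r) + th * real n0" by (simp add: algebra_simps)
  hence "\<bar>real m - real b * real r\<bar> \<le> \<bar>real b * (real p * th - real r)\<bar> + \<bar>th * real n0\<bar>" by linarith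
  also have "\<bar>real b * (real p * th - real r)\<bar> \<le> real b * (1 / real Y)"
    unfolding abs_mult using hp(3) p(3) r(2) by (intro mult_mono) auto
  also have "\<bar>th * real n0\<bar> \<le> 1 * real p" unfolding abs_mult using th bn(2) by (intro mult_mono) auto
  finally have "\<bar>real m - real b * real r\<bar> \<le> real b * (1 / real Y) + real p" by simp
  moreover have "real mm = \<bar>real m - real b * real r\<bar>"
  proof -
    have "real mm = real_of_int \<bar>int m - int (b * r)\<bar>" unfolding mm_def by simp
    thus ?thesis by simp
  qed
  ultimately have mmb: "real mm \<le> real b * (1 / real Y) + real p" by simp
  have bp: "real p * real b \<le> real n"
  proof -
    have "p * b \<le> n" using bn(1) by (simp add: mult.commute)
    thus ?thesis by (metis of_nat_le_iff of_nat_mult)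
  qed
  have "real p * real mm \<le> real p * (real b * (1 / real Y) + real p)" using mmb by (intro mult_left_mono) auto
  also have "\<dots> = (real p * real b) / real Y + real p * real p" by (simp add: distrib_left)
  also have "\<dots> \<le> real n / real Y + real Y * real Y" using bp p Y0 by (intro add_mono divide_right_mono mult_mono) auto
  finally have pm: "real p * real mm \<le> real n / real Y + real Y * real Y" .
  have pp: "real p * real (nu + k + p) \<le> real Y * (real K + real Y)"
    using p K1 by (intro mult_mono) auto
  have "real K * (real p * real (nu + k + p) + real p * real mm) \<le> real K * (real Y * (real K + real Y) + (real n / real Y + real Y * real Y))"
    using pm pp by (intro mult_left_mono add_mono) auto
  also have "\<dots> = 36 * real K ^ 3 + real n / 4"
    using K0 unfolding Y_def by (simp add: field_simps power3_eq_cube)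
  also have "\<dots> \<le> real n / 4 + real n / 4"
  proof -
    have "real (145 * K ^ 3) \<le> real n" using n_big by (simp only: of_nat_le_iff)
    thus ?thesis by simp
  qed
  finally have "real K * (real p * real (nu + k + p) + real p * real mm) + 1 \<le> real n / 2 + 1" by simp
  moreover have "real n / 2 + 1 \<le> real m"
  proof -
    have "145 * real nu \<le> real n" using nK K1 by linarith
    thus ?thesis using solution_m_half[OF k5 n m eq nu] n2 by linarith
  qed
  ultimately have "real K * (real p * real (nu + k + p) + real p * real mm) + 1 \<le> real m" by linarith
  hence "real (K * p * (nu + k + p + mm) + 1) \<le> real m" by (simp add: algebra_simps)
  hence big: "3145728 * k ^ 4 * nu ^ 2 * p * (nu + k + p + mm) + 1 \<le> m" unfolding K by (simp only: of_nat_le_iff)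
  show False
    by (rule no_solution_of_approximation[OF k5 n m eq p(1) r(1) bn nu mm_def big nu2])
qed

end

section \<open>Binomial expansion\<close>

lemma fact_double: "\<exists>z. odd z \<and> fact (2 * n) = 2 ^ n * fact n * (z::nat)"
proof (induction n)
  case (Suc n)
  then obtain z where z: "odd z" "fact (2 * n) = 2 ^ n * fact n * (z::nat)" by blast
  have "fact (2 * Suc n) = (2 * n + 2) * ((2 * n + 1) * fact (2 * n) :: nat)" by simp
  also have "\<dots> = 2 ^ Suc n * fact (Suc n) * ((2 * n + 1) * z)" unfolding z(2) by (simp add: algebra_simps)
  finally show ?case using z(1) by (intro exI[of _ "(2 * n + 1) * z"]) auto
qed (auto intro: exI[of _ 1])

lemma multiplicity_two_mult: "x \<noteq> 0 \<Longrightarrow> y \<noteq> 0 \<Longrightarrow> multiplicity 2 (x * y) = multiplicity 2 x + multiplicity 2 (y::nat)"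
  by (rule prime_elem_multiplicity_mult_distrib) (auto simp: prime_imp_prime_elem)

lemma multiplicity_two_odd: "odd x \<Longrightarrow> multiplicity 2 (x::nat) = 0"
  by (rule not_dvd_imp_multiplicity_0) simp

lemma multiplicity_two_fact: "multiplicity 2 (fact n :: nat) = n div 2 + multiplicity 2 (fact (n div 2) :: nat)"
proof -
  have e: "multiplicity 2 (fact (2 * a) :: nat) = a + multiplicity 2 (fact a :: nat)" for a
  proof -
    obtain z where z: "odd z" "fact (2 * a) = 2 ^ a * fact a * (z::nat)" using fact_double by blast
    have "z \<noteq> 0" using z(1) by (cases z) auto
    thus ?thesis unfolding z(2) using z(1)
      by (simp add: multiplicity_two_mult multiplicity_two_odd multiplicity_same_power)
  qed
  show ?thesis
  proof (cases "even n")
    case True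
    then obtain a where "n = 2 * a" by (elim evenE)
    thus ?thesis using e[of a] by simp
  next
    case False
    then obtain a where n: "n = 2 * a + 1" by (elim oddE)
    have "fact n = (2 * a + 1) * (fact (2 * a) :: nat)" unfolding n by simp
    hence "multiplicity 2 (fact n :: nat) = multiplicity 2 (2 * a + 1) + multiplicity 2 (fact (2 * a) :: nat)"
      by (simp only:) (rule multiplicity_two_mult, auto)
    thus ?thesis using e[of a] n by (simp add: multiplicity_two_odd)
  qed
qed

text \<open>Kummer's carry count without digits. The case \<open>N = a + b + 1\<close> represents an
  incoming carry, and this shape survives halving all three numbers; each halving costs at most one
  factor 2, matched by \<open>2 * (N div 2) <= N\<close>.\<close>

lemma fact_carry_bound:
  assumes "a + b \<le> N" "N \<le> a + b + 1" "N \<ge> 1"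
  shows "2 ^ multiplicity 2 (fact N :: nat) \<le> N * 2 ^ (multiplicity 2 (fact a :: nat) + multiplicity 2 (fact b :: nat))"
  using assms
proof (induction N arbitrary: a b rule: less_induct)
  case (less N)
  let ?L = "\<lambda>n. multiplicity 2 (fact n :: nat)"
  show ?case
  proof (cases "N = 1")
    case False
    hence N2: "N \<ge> 2" using less.prems by simp
    have IH: "2 ^ ?L (N div 2) \<le> (N div 2) * 2 ^ (?L (a div 2) + ?L (b div 2))"
      using less.prems N2 by (intro less.IH) auto
    have "2 ^ ?L N = 2 ^ (N div 2) * (2::nat) ^ ?L (N div 2)"
      by (subst multiplicity_two_fact) (simp add: power_add)
    also have "\<dots> \<le> 2 ^ (a div 2 + b div 2 + 1) * ((N div 2) * 2 ^ (?L (a div 2) + ?L (b div 2)))"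
      using less.prems IH by (intro mult_le_mono power_increasing) auto
    also have "\<dots> = (2 * (N div 2)) * 2 ^ ((a div 2 + ?L (a div 2)) + (b div 2 + ?L (b div 2)))"
      by (simp add: power_add)
    also have "\<dots> = (2 * (N div 2)) * 2 ^ (?L a + ?L b)"
      by (simp only: multiplicity_two_fact[of a, symmetric] multiplicity_two_fact[of b, symmetric])
    also have "\<dots> \<le> N * 2 ^ (?L a + ?L b)" by (intro mult_le_mono1) simp
    finally show ?thesis .
  qed simp
qed

lemma multiplicity_two_binomial:
  assumes "j \<le> N" "N \<ge> 1"
  shows "2 ^ multiplicity 2 (N choose j) \<le> N"
proof -
  let ?L = "\<lambda>n. multiplicity 2 (fact n :: nat)"
  have "fact j * fact (N - j) * (N choose j) = (fact N :: nat)" by (rule binomial_fact_lemma[OF assms(1)])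
  hence "?L N = multiplicity 2 (fact j * fact (N - j) * (N choose j))" by (simp only:)
  hence L: "?L N = ?L j + ?L (N - j) + multiplicity 2 (N choose j)"
    using assms by (simp add: multiplicity_two_mult)
  have "(2::nat) ^ ?L N \<le> N * 2 ^ (?L j + ?L (N - j))" using assms by (intro fact_carry_bound) auto
  hence "(2::nat) ^ (?L j + ?L (N - j)) * 2 ^ multiplicity 2 (N choose j) \<le> 2 ^ (?L j + ?L (N - j)) * N"
    unfolding L power_add by (simp add: mult_ac)
  thus ?thesis by simp
qed

lemma multiplicity_two_le: "x \<ge> 1 \<Longrightarrow> 2 ^ multiplicity 2 x \<le> (x::nat)"
  by (rule dvd_imp_le[OF multiplicity_dvd]) simp

text \<open>The coefficients of \<open>1 / (1 - 2 x + x ^ (k + 1))\<close>.\<close>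

definition gf_coeff :: "nat \<Rightarrow> nat \<Rightarrow> int" where
  "gf_coeff k N = (\<Sum>c\<le>N. (-1) ^ c * 2 ^ (N - c * (k + 1)) * int ((N - k * c) choose c))"

lemma gf_coeff_term_zero: "k \<ge> 1 \<Longrightarrow> N < c * (k + 1) \<Longrightarrow> (N - k * c) choose c = 0"
  by (rule binomial_eq_0) (cases c, auto simp: algebra_simps)

text \<open>Pascal's rule applied to each term.\<close>

lemma gf_coeff_rec:
  assumes k: "k \<ge> 1"
  shows "gf_coeff k (Suc N) = 2 * gf_coeff k N - (if k \<le> N then gf_coeff k (N - k) else 0)"
proof -
  define t where "t N c = (-1) ^ c * 2 ^ (N - c * (k + 1)) * int ((N - k * c) choose c)" for N c
  have z: "t N c = 0" if "N < c * (k + 1)" for N c using gf_coeff_term_zero[OF k that] by (simp add: t_def)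
  have step: "t (Suc N) (Suc c) = 2 * t N (Suc c) - (if k \<le> N then t (N - k) c else 0)" for c
  proof (cases "k * Suc c \<le> N")
    case True
    define u where "u = N - k * Suc c"
    have kN: "k \<le> N" using True by (metis le_trans mult.right_neutral mult_le_mono2 le_add1 One_nat_def Suc_le_mono le0)
    have e1: "Suc N - k * Suc c = Suc u" "N - k * Suc c = u" "N - k - k * c = u" using True by (auto simp: u_def)
    have e2: "Suc N - Suc c * (k + 1) = N - k - c * (k + 1)" by (simp add: algebra_simps)
    \<comment> \<open>Where subtraction in the exponent truncates, the binomial coefficient is
      0.\<close>
    have "2 ^ (Suc N - Suc c * (k + 1)) * int (u choose Suc c) = 2 * 2 ^ (N - Suc c * (k + 1)) * int (u choose Suc c)"
    proof (cases "Suc c \<le> u")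
      case T: True
      hence "Suc c * (k + 1) \<le> N" using True by (simp add: u_def algebra_simps)
      hence "Suc N - Suc c * (k + 1) = Suc (N - Suc c * (k + 1))" by simp
      thus ?thesis by simp
    qed (simp add: binomial_eq_0)
    thus ?thesis using kN unfolding t_def e1 by (simp add: e2 algebra_simps)
  next
    case False
    hence a: "Suc N - k * Suc c = 0" "N - k * Suc c = 0" by auto
    have "t (N - k) c = 0" if "k \<le> N"
    proof -
      have "c \<noteq> 0" using False that by (cases c) auto
      moreover have "N - k - k * c = 0" using False by simp
      ultimately show ?thesis by (simp add: t_def)
    qed
    moreover have "t (Suc N) (Suc c) = 0" "t N (Suc c) = 0" unfolding t_def a by simp_all
    ultimately show ?thesis by simp
  qed
  have "gf_coeff k (Suc N) = (\<Sum>c\<le>Suc N. t (Suc N) c)" by (simp only: gf_coeff_def t_def)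
  also have "\<dots> = t (Suc N) 0 + (\<Sum>c\<le>N. t (Suc N) (Suc c))" by (rule sum.atMost_Suc_shift)
  also have "\<dots> = 2 * t N 0 + (\<Sum>c\<le>N. 2 * t N (Suc c) - (if k \<le> N then t (N - k) c else 0))"
    by (simp only: step) (simp add: t_def)
  also have "\<dots> = 2 * (t N 0 + (\<Sum>c\<le>N. t N (Suc c))) - (if k \<le> N then (\<Sum>c\<le>N. t (N - k) c) else 0)"
    by (simp add: sum_subtractf sum_distrib_left)
  also have "t N 0 + (\<Sum>c\<le>N. t N (Suc c)) = (\<Sum>c\<le>Suc N. t N c)" by (rule sum.atMost_Suc_shift[symmetric])
  also have "\<dots> = (\<Sum>c\<le>N. t N c)" using z[of N "Suc N"] by simp
  also have "\<dots> = gf_coeff k N" by (simp only: gf_coeff_def t_def)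
  also have "(if k \<le> N then (\<Sum>c\<le>N. t (N - k) c) else 0) = (if k \<le> N then gf_coeff k (N - k) else 0)"
  proof (cases "k \<le> N")
    case True
    have "(\<Sum>c\<le>N. t (N - k) c) = (\<Sum>c\<le>N - k. t (N - k) c)"
      by (rule sum.mono_neutral_right) (auto intro!: z)
    thus ?thesis using True by (simp only: gf_coeff_def t_def)
  qed simp
  finally show ?thesis .
qed

definition gf_coeff_int :: "nat \<Rightarrow> int \<Rightarrow> int" where "gf_coeff_int k N = (if N < 0 then 0 else gf_coeff k (nat N))"

lemma gf_coeff_int_rec: "k \<ge> 1 \<Longrightarrow> N \<ge> 0 \<Longrightarrow> gf_coeff_int k (N + 1) = 2 * gf_coeff_int k N - gf_coeff_int k (N - int k)"
proof -
  assume k: "k \<ge> 1" and N: "N \<ge> 0"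
  have "nat (N + 1) = Suc (nat N)" using N by simp
  moreover have "nat (N - int k) = nat N - k" by (simp add: nat_diff_distrib')
  moreover have "k \<le> nat N \<longleftrightarrow> \<not> N - int k < 0" using N by auto
  ultimately show ?thesis unfolding gf_coeff_int_def using N gf_coeff_rec[OF k, of "nat N"] by auto
qed

section \<open>The generating function and its expansion\<close>

lemma gen_fib_shift:
  assumes "n \<ge> 2"
  shows "gen_fib k (n + 1) = 2 * gen_fib k n - gen_fib k (n - int k)"
proof -
  have g: "gen_fib k n = (\<Sum>i=1..k. gen_fib k (n - int i))" using assms by (subst gen_fib.simps) auto
  have "gen_fib k (n + 1) = (\<Sum>i=1..k. gen_fib k (n + 1 - int i))" using assms by (subst gen_fib.simps) auto
  also have "\<dots> = (\<Sum>i<k. gen_fib k (n - int i))"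
    by (rule sum.reindex_bij_witness[where i = Suc and j = "\<lambda>i. i - 1"]) (auto simp: of_nat_diff algebra_simps)
  also have "\<dots> + gen_fib k (n - int k) = (\<Sum>i<Suc k. gen_fib k (n - int i))" by simp
  also have "\<dots> = gen_fib k n + (\<Sum>i<k. gen_fib k (n - int (Suc i)))" unfolding sum.lessThan_Suc_shift by simp
  also have "(\<Sum>i<k. gen_fib k (n - int (Suc i))) = (\<Sum>i=1..k. gen_fib k (n - int i))"
    by (rule sum.reindex_bij_witness[where j = Suc and i = "\<lambda>i. i - 1"]) auto
  finally show ?thesis using g by simp
qed

text \<open>Extraction of coefficients from \<open>x * (1 - x) / (1 - 2 * x + x ^ (k + 1))\<close>.
  The three base cases are needed because the three-term recurrence of \<open>gen_fib\<close> starts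
  only at index 2.\<close>

lemma gen_fib_eq_bz:
  assumes k: "k \<ge> 2"
  shows "gen_fib k n = gf_coeff_int k (n - 1) - gf_coeff_int k (n - 2)"
proof -
  have a0: "gf_coeff k 0 = 1" by (simp add: gf_coeff_def)
  have a1: "gf_coeff k (Suc 0) = 2" using gf_coeff_rec[of k 0] k a0 by simp
  have "gen_fib k (int j) = gf_coeff_int k (int j - 1) - gf_coeff_int k (int j - 2)" for j
  proof (induction j rule: less_induct)
    case (less j)
    consider "j = 0" | "j = 1" | "j = 2" | "j \<ge> 3" by linarith
    thus ?case
    proof cases
      case 1 thus ?thesis by (simp add: gf_coeff_int_def gen_fib.simps)
    next
      case 2 thus ?thesis by (simp add: gf_coeff_int_def gen_fib.simps a0)
    next
      case 3
      have "gen_fib k 2 = (\<Sum>i=1..k. gen_fib k (2 - int i))" by (subst gen_fib.simps) auto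
      also have "\<dots> = (\<Sum>i=1..k. if i = 1 then 1 else 0)"
        by (intro sum.cong) (auto simp: gen_fib.simps)
      also have "\<dots> = 1" using k by simp
      finally show ?thesis using 3 by (simp add: gf_coeff_int_def a0 a1)
    next
      case 4
      define N where "N = int j - 1"
      have N: "N \<ge> 2" using 4 by (simp add: N_def)
      have jN: "int j = N + 1" by (simp add: N_def)
      have "gen_fib k (N + 1) = 2 * gen_fib k N - gen_fib k (N - int k)" using N by (rule gen_fib_shift)
      also have "gen_fib k N = gf_coeff_int k (N - 1) - gf_coeff_int k (N - 2)"
        using less.IH[of "j - 1"] 4 by (simp add: N_def of_nat_diff)
      also have "gen_fib k (N - int k) = gf_coeff_int k (N - int k - 1) - gf_coeff_int k (N - int k - 2)"
      proof (cases "N - int k \<ge> 0")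
        case True
        thus ?thesis using less.IH[of "nat (N - int k)"] 4 k by (simp add: N_def)
      qed (simp add: gf_coeff_int_def gen_fib.simps)
      moreover have "gf_coeff_int k N = 2 * gf_coeff_int k (N - 1) - gf_coeff_int k (N - int k - 1)"
        using gf_coeff_int_rec[of k "N - 1"] k N by (simp add: algebra_simps)
      moreover have "gf_coeff_int k (N - 1) = 2 * gf_coeff_int k (N - 2) - gf_coeff_int k (N - int k - 2)"
        using gf_coeff_int_rec[of k "N - 2"] k N by (simp add: algebra_simps)
      ultimately show ?thesis unfolding jN by (simp add: algebra_simps)
    qed
  qed
  from this[of "nat n"] show ?thesis by (cases "n \<ge> 0") (auto simp: gf_coeff_int_def gen_fib.simps)
qed

text \<open>Summation in reverse order, \<open>c = q - s\<close>, arranges the terms by increasing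
  powers of 2, so that small \<open>s\<close> dominates 2-adically.\<close>

lemma gf_coeff_expand:
  assumes k: "k \<ge> 1" and r: "r \<le> k"
  shows "gf_coeff k ((k + 1) * q + r) = (\<Sum>s\<le>q. (-1) ^ (q - s) * 2 ^ (r + s * (k + 1)) * int ((q + r + s * k) choose (r + s * (k + 1))))"
proof -
  let ?N = "(k + 1) * q + r"
  define t where "t c = (-1) ^ c * 2 ^ (?N - c * (k + 1)) * int ((?N - k * c) choose c)" for c
  have z: "t c = 0" if "c > q" for c
  proof -
    have "?N < (q + 1) * (k + 1)" using r by (simp add: algebra_simps)
    also have "\<dots> \<le> c * (k + 1)" using that by (intro mult_le_mono1) simp
    finally show ?thesis using gf_coeff_term_zero[OF k, of ?N c] by (simp add: t_def)
  qed
  have "gf_coeff k ?N = (\<Sum>c\<le>?N. t c)" by (simp only: gf_coeff_def t_def)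
  also have "\<dots> = (\<Sum>c\<le>q. t c)"
    by (rule sum.mono_neutral_right) (auto intro: z)
  also have "\<dots> = (\<Sum>s\<le>q. t (q - s))"
    by (rule sum.reindex_bij_witness[where i = "\<lambda>s. q - s" and j = "\<lambda>s. q - s"]) auto
  also have "\<dots> = (\<Sum>s\<le>q. (-1) ^ (q - s) * 2 ^ (r + s * (k + 1)) * int ((q + r + s * k) choose (r + s * (k + 1))))"
  proof (rule sum.cong[OF refl])
    fix s assume "s \<in> {..q}"
    then obtain d where q: "q = s + d" using le_Suc_ex by auto
    have e1: "?N - (q - s) * (k + 1) = r + s * (k + 1)" unfolding q by (simp add: algebra_simps)
    have e2: "?N - k * (q - s) = q + r + s * k" unfolding q by (simp add: algebra_simps)
    have "(q + r + s * k) choose (q - s) = (q + r + s * k) choose (q + r + s * k - (q - s))"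
      by (rule binomial_symmetric) (simp add: q)
    also have "q + r + s * k - (q - s) = r + s * (k + 1)" unfolding q by (simp add: algebra_simps)
    finally show "t (q - s) = (-1) ^ (q - s) * 2 ^ (r + s * (k + 1)) * int ((q + r + s * k) choose (r + s * (k + 1)))"
      by (simp only: t_def e1 e2)
  qed
  finally show ?thesis .
qed

section \<open>2-adic divisibility of rationals\<close>

text \<open>Membership in \<open>2 ^ e\<close> times the localization of the integers at 2.\<close>

definition two_int :: "nat \<Rightarrow> rat \<Rightarrow> bool" where
  "two_int e x \<longleftrightarrow> (\<exists>a b::int. odd b \<and> x * of_int b = of_int (2 ^ e * a))"

lemma two_int_add: assumes "two_int e x" "two_int e y" shows "two_int e (x + y)"
proof -
  from assms obtain a b c d :: int where *: "odd b" "x * of_int b = of_int (2 ^ e * a)" "odd d" "y * of_int d = of_int (2 ^ e * c)"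
    unfolding two_int_def by blast
  have "(x + y) * of_int (b * d) = (x * of_int b) * of_int d + (y * of_int d) * of_int b" by (simp add: algebra_simps)
  also have "\<dots> = of_int (2 ^ e * (a * d + c * b))" unfolding * by (simp add: algebra_simps)
  finally show ?thesis unfolding two_int_def using * by (intro exI[of _ "a * d + c * b"] exI[of _ "b * d"]) auto
qed

lemma two_int_uminus: "two_int e x \<Longrightarrow> two_int e (- x)"
proof -
  assume "two_int e x"
  then obtain a b :: int where "odd b" "x * of_int b = of_int (2 ^ e * a)" unfolding two_int_def by blast
  thus ?thesis unfolding two_int_def by (intro exI[of _ "- a"] exI[of _ b]) auto
qed

lemma two_int_diff: "two_int e x \<Longrightarrow> two_int e y \<Longrightarrow> two_int e (x - y)"
  using two_int_add[of e x "- y"] two_int_uminus by simp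

lemma two_int_sign: "two_int e x \<Longrightarrow> two_int e ((-1) ^ s * x)"
  using two_int_uminus by (cases "even s") auto

lemma two_int_mono: assumes "two_int e x" "f \<le> e" shows "two_int f x"
proof -
  from assms obtain a b :: int where *: "odd b" "x * of_int b = of_int (2 ^ e * a)" unfolding two_int_def by blast
  have "(2::int) ^ e = 2 ^ f * 2 ^ (e - f)" using assms(2) by (simp add: power_add[symmetric])
  thus ?thesis unfolding two_int_def using * by (intro exI[of _ "2 ^ (e - f) * a"] exI[of _ b]) (auto simp: mult.assoc)
qed

lemma two_int_of_int: "2 ^ e dvd z \<Longrightarrow> two_int e (of_int z)"
  unfolding two_int_def by (elim dvdE, rule exI, rule exI[of _ 1]) auto

lemma two_int_of_intD: assumes "two_int e (of_int z)" shows "2 ^ e dvd z"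
proof -
  from assms obtain a b :: int where *: "odd b" "of_int z * of_int b = (of_int (2 ^ e * a) :: rat)" unfolding two_int_def by blast
  have "(of_int (z * b) :: rat) = of_int (2 ^ e * a)" using *(2) by simp
  hence "z * b = 2 ^ e * a" by (simp only: of_int_eq_iff)
  hence "2 ^ e dvd z * b" by simp
  moreover have "coprime (2 ^ e) b" using *(1) by simp
  ultimately show ?thesis by (simp add: coprime_dvd_mult_left_iff)
qed

lemma two_int_sum: "(\<And>i. i \<in> A \<Longrightarrow> two_int e (f i)) \<Longrightarrow> two_int e (\<Sum>i\<in>A. f i)"
proof (induction A rule: infinite_finite_induct)
  case (insert x F) thus ?case by (simp add: two_int_add)
qed (use two_int_of_int[of e 0] in auto)

lemma two_int_div:
  fixes D :: nat
  assumes x: "x * of_nat D = of_int (2 ^ f * y)" and v: "2 ^ v dvd y" and D: "D \<noteq> 0" and e: "multiplicity 2 D + e \<le> f + v"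
  shows "two_int e x"
proof -
  obtain D' where D': "D = 2 ^ multiplicity 2 D * D'" "\<not> 2 dvd D'" using multiplicity_decompose'[OF D, of 2] by auto
  obtain y' where y': "y = 2 ^ v * y'" using v by (rule dvdE)
  define u where "u = multiplicity 2 D"
  define g where "g = f + v - u - e"
  have fv: "f + v = u + (e + g)" using e unfolding u_def g_def by simp
  have "of_nat D = (2::rat) ^ u * of_nat D'" using D'(1) unfolding u_def by (metis of_nat_mult of_nat_numeral of_nat_power)
  hence "(2::rat) ^ u * (x * of_nat D') = x * of_nat D" by simp
  also have "\<dots> = 2 ^ (f + v) * of_int y'" unfolding x y' by (simp add: power_add)
  also have "\<dots> = 2 ^ u * (2 ^ e * 2 ^ g * of_int y')" unfolding fv by (simp add: power_add)
  finally have "x * of_nat D' = 2 ^ e * 2 ^ g * of_int y'" by simp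
  hence "x * of_int (int D') = of_int (2 ^ e * (2 ^ g * y'))" by simp
  moreover have "odd (int D')" using D'(2) by simp
  ultimately show ?thesis unfolding two_int_def by blast
qed

section \<open>Valuations of the denominators\<close>

text \<open>Multiplication by this number turns the bracket of the \<open>s\<close>-th term for
  \<open>n = (k + 1) q + 2\<close> into a multiple of whichever of \<open>q\<close> and
  \<open>q + 1\<close> is even.\<close>

definition branch_two_den :: "nat \<Rightarrow> nat \<Rightarrow> nat" where
  "branch_two_den k s = (s * (k + 1) + 1) * ((s * k) * ((s * (k + 1)) choose (s * k)))"

text \<open>The counterpart for \<open>n = (k + 1) q + 1\<close>: the denominator that remains once
  \<open>((q - 1 + k) choose k) / (k + 1)\<close> is split off from every term.\<close>

definition theta_den :: "nat \<Rightarrow> nat \<Rightarrow> nat" where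
  "theta_den k s = (s + 1) * ((((s + 1) * k + s) choose (s * k)) * ((k + s) choose k))"

lemma cubic_le_two_power: "y \<ge> 14 \<Longrightarrow> 4 * ((y + 1) * y ^ 2) \<le> (2::nat) ^ y"
proof (induction y rule: dec_induct)
  case (step y)
  have "14 * y \<le> y * y" using step.hyps by (intro mult_le_mono1) simp
  moreover have "(y + 2) * (y + 1) = y * y + 3 * y + 2" by (simp add: algebra_simps)
  ultimately have "(y + 2) * (y + 1) \<le> 2 * (y * y)" using step.hyps by linarith
  hence "(y + 1) * ((y + 2) * (y + 1)) \<le> (y + 1) * (2 * (y * y))" by (rule mult_le_mono2)
  moreover have "(Suc y + 1) * Suc y ^ 2 = (y + 1) * ((y + 2) * (y + 1))" by (simp add: power2_eq_square algebra_simps)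
  moreover have "(y + 1) * (2 * (y * y)) = 2 * ((y + 1) * y ^ 2)" by (simp add: power2_eq_square algebra_simps)
  ultimately have "4 * ((Suc y + 1) * Suc y ^ 2) \<le> 2 * (4 * ((y + 1) * y ^ 2))" by linarith
  also have "\<dots> \<le> 2 * 2 ^ y" using step.IH by (rule mult_le_mono2)
  finally show ?case by simp
qed simp

lemma quartic_le_two_power: "y \<ge> 19 \<Longrightarrow> 4 * y ^ 4 \<le> (2::nat) ^ y"
proof (induction y rule: dec_induct)
  case (step y)
  have "19 * y \<le> y * y" using step.hyps by (intro mult_le_mono1) simp
  moreover have "(y + 1) * (y + 1) = y * y + 2 * y + 1" by (simp add: algebra_simps)
  ultimately have "5 * ((y + 1) * (y + 1)) \<le> 7 * (y * y)" using step.hyps by linarith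
  hence "(5 * ((y + 1) * (y + 1))) * (5 * ((y + 1) * (y + 1))) \<le> (7 * (y * y)) * (7 * (y * y))"
    by (rule mult_le_mono) (use \<open>5 * ((y + 1) * (y + 1)) \<le> 7 * (y * y)\<close> in simp)
  moreover have "25 * Suc y ^ 4 = (5 * ((y + 1) * (y + 1))) * (5 * ((y + 1) * (y + 1)))" by (simp add: power4_eq_xxxx algebra_simps)
  moreover have "49 * y ^ 4 = (7 * (y * y)) * (7 * (y * y))" by (simp add: power4_eq_xxxx)
  ultimately have "25 * Suc y ^ 4 \<le> 49 * y ^ 4" by linarith
  hence "4 * Suc y ^ 4 \<le> 2 * (4 * y ^ 4)" by linarith
  also have "\<dots> \<le> 2 * 2 ^ y" using step.IH by (rule mult_le_mono2)
  finally show ?case by simp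
qed simp

lemma mult2_prod3_le:
  assumes "x \<noteq> 0" "y \<noteq> 0" "z \<noteq> (0::nat)" "2 ^ multiplicity 2 x \<le> (X::nat)" "2 ^ multiplicity 2 y \<le> Y" "2 ^ multiplicity 2 z \<le> Z"
  shows "2 ^ multiplicity 2 (x * (y * z)) \<le> X * (Y * Z)"
  using assms by (simp add: multiplicity_two_mult power_add mult_le_mono)

lemma branch_two_den_small: "\<forall>(k, s) \<in> set [(2,2),(2,3),(2,4),(3,1),(3,2),(3,3),(4,1),(4,2),(5,1),(5,2),(6,1),(7,1),(8,1),(9,1),(10,1),(11,1),(12,1)].
    \<not> 2 ^ (s * (k + 1) - 1) dvd branch_two_den k s"
  by (simp add: branch_two_den_def binomial_fact' fact_numeral)

lemma theta_den_small: "\<forall>(k, s) \<in> set [(2,1),(2,2),(2,3),(2,4),(3,1),(3,2),(3,3),(4,1),(4,2),(5,1),(5,2),(6,1),(7,1),(8,1),(9,1),(10,1),(11,1),(12,1)].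
    \<not> 2 ^ (s * (k + 1)) dvd theta_den k s"
  by (simp add: theta_den_def binomial_fact' fact_numeral)

lemma small_pairs:
  assumes "(k::nat) \<ge> 2" "s \<ge> 1" "s * (k + 1) < 14"
  shows "(k, s) = (2,1) \<or> (k, s) \<in> set [(2,2),(2,3),(2,4),(3,1),(3,2),(3,3),(4,1),(4,2),(5,1),(5,2),(6,1),(7,1),(8,1),(9,1),(10,1),(11,1),(12,1)]"
proof -
  define y where "y = s * (k + 1)"
  have y: "y < 14" using assms(3) by (simp only: y_def)
  have "k + 1 \<le> y" using mult_le_mono1[OF assms(2), of "k + 1"] by (simp only: y_def nat_mult_1)
  hence "k < 13" using y by linarith
  hence k: "k = 2 \<or> k = 3 \<or> k = 4 \<or> k = 5 \<or> k = 6 \<or> k = 7 \<or> k = 8 \<or> k = 9 \<or> k = 10 \<or> k = 11 \<or> k = 12"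
    using assms(1) by presburger
  have "s * 3 \<le> y" unfolding y_def using assms(1) by (intro mult_le_mono2) simp
  hence "s < 5" using y by linarith
  hence s: "s = 1 \<or> s = 2 \<or> s = 3 \<or> s = 4" using assms(2) by linarith
  show ?thesis using k s y unfolding y_def by (elim disjE) simp_all
qed

lemma multiplicity_less_of_not_dvd: "\<not> 2 ^ e dvd (x::nat) \<Longrightarrow> multiplicity 2 x < e"
  by (meson multiplicity_dvd' not_le)

text \<open>The 2-part of a binomial coefficient is at most its upper index, here
  \<open>y = s * (k + 1)\<close>. The resulting cubic bound beats \<open>2 ^ y\<close> from
  \<open>y = 14\<close> on; smaller pairs are computed. For the excluded pair the inequality is
  false.\<close>

lemma branch_two_den_bound:
  assumes k: "k \<ge> 2" and s: "s \<ge> 1" and ne: "\<not> (k = 2 \<and> s = 1)"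
  shows "multiplicity 2 (branch_two_den k s) + 2 \<le> s * (k + 1)"
proof (cases "s * (k + 1) < 14")
  case True
  have "\<not> 2 ^ (s * (k + 1) - 1) dvd branch_two_den k s" using branch_two_den_small small_pairs[OF k s True] ne by blast
  hence "multiplicity 2 (branch_two_den k s) < s * (k + 1) - 1" by (rule multiplicity_less_of_not_dvd)
  thus ?thesis by linarith
next
  case False
  define y where "y = s * (k + 1)"
  have y: "y \<ge> 14" using False by (simp add: y_def)
  have sk: "s * k \<ge> 1" using k s by simp
  have sky: "s * k \<le> y" by (simp add: y_def)
  have "2 ^ multiplicity 2 (branch_two_den k s) \<le> (y + 1) * (y * y)" unfolding branch_two_den_def y_def[symmetric]
  proof (rule mult2_prod3_le)
    show "2 ^ multiplicity 2 (y + 1) \<le> y + 1" by (rule multiplicity_two_le) simp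
    show "2 ^ multiplicity 2 (s * k) \<le> y" using multiplicity_two_le[OF sk] sky by simp
    show "2 ^ multiplicity 2 (y choose (s * k)) \<le> y" using sky y by (intro multiplicity_two_binomial) auto
  qed (use sk sky in auto)
  hence "4 * 2 ^ multiplicity 2 (branch_two_den k s) \<le> 4 * ((y + 1) * y ^ 2)" by (simp add: power2_eq_square)
  also have "\<dots> \<le> 2 ^ y" using y by (rule cubic_le_two_power)
  finally have "2 ^ (multiplicity 2 (branch_two_den k s) + 2) \<le> (2::nat) ^ y" by (simp add: power_add)
  thus ?thesis unfolding y_def by (simp only: power_increasing_iff one_less_numeral_iff semiring_norm)
qed

lemma theta_den_nonzero: "theta_den k s \<noteq> 0"
  unfolding theta_den_def by (simp add: algebra_simps)

lemma theta_den_crude: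
  assumes k: "k \<ge> 2" and s: "s \<ge> 1"
  shows "2 ^ multiplicity 2 (theta_den k s) \<le> 2 * (s * (k + 1)) ^ 3"
proof -
  define y where "y = s * (k + 1)"
  define z where "z = s * k"
  have yz: "y = z + s" "(s + 1) * k + s = z + k + s" unfolding y_def z_def by (simp_all add: algebra_simps)
  have "k * 1 \<le> k * s" "s * 1 \<le> s * k" using k s by (intro mult_le_mono2; simp)+
  hence kz: "k \<le> z" "s \<le> z" unfolding z_def by (simp_all only: mult.commute[of k s] mult_1_right)
  have a: "s + 1 \<le> y" using yz kz k by linarith
  have b: "(s + 1) * k + s \<le> 2 * y" using yz kz by linarith
  have c: "k + s \<le> y" using yz kz by linarith
  have "2 ^ multiplicity 2 (theta_den k s) \<le> y * ((2 * y) * y)" unfolding theta_den_def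
  proof (rule mult2_prod3_le)
    show "2 ^ multiplicity 2 (s + 1) \<le> y" using multiplicity_two_le[of "s + 1"] a by simp
    show "2 ^ multiplicity 2 (((s + 1) * k + s) choose (s * k)) \<le> 2 * y"
      by (rule order_trans[OF multiplicity_two_binomial b]) (use s in \<open>auto simp: algebra_simps\<close>)
    show "2 ^ multiplicity 2 ((k + s) choose k) \<le> y"
      by (rule order_trans[OF multiplicity_two_binomial c]) (use s in auto)
  qed (auto simp: algebra_simps)
  thus ?thesis unfolding y_def[symmetric] by (simp add: power3_eq_cube mult_ac)
qed

lemma theta_den_bound:
  assumes k: "k \<ge> 2" and s: "s \<ge> 1"
  shows "multiplicity 2 (theta_den k s) + 1 \<le> s * (k + 1)"
proof (cases "s * (k + 1) < 14")
  case True
  have "(k, s) \<in> set [(2,1),(2,2),(2,3),(2,4),(3,1),(3,2),(3,3),(4,1),(4,2),(5,1),(5,2),(6,1),(7,1),(8,1),(9,1),(10,1),(11,1),(12,1)]"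
    using small_pairs[OF k s True] by auto
  hence "\<not> 2 ^ (s * (k + 1)) dvd theta_den k s" using theta_den_small by blast
  hence "multiplicity 2 (theta_den k s) < s * (k + 1)" by (rule multiplicity_less_of_not_dvd)
  thus ?thesis by linarith
next
  case False
  define y where "y = s * (k + 1)"
  have y: "y \<ge> 14" using False by (simp add: y_def)
  have "2 * 2 ^ multiplicity 2 (theta_den k s) \<le> 4 * y ^ 3" using theta_den_crude[OF k s] unfolding y_def by simp
  also have "y ^ 3 \<le> (y + 1) * y ^ 2" by (simp add: power2_eq_square power3_eq_cube)
  hence "4 * y ^ 3 \<le> 4 * ((y + 1) * y ^ 2)" by simp
  also have "\<dots> \<le> 2 ^ y" using y by (rule cubic_le_two_power)
  finally have "2 ^ (multiplicity 2 (theta_den k s) + 1) \<le> (2::nat) ^ y" by (simp add: power_add)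
  thus ?thesis unfolding y_def by (simp only: power_increasing_iff one_less_numeral_iff semiring_norm)
qed

lemma theta_den_lip_small: "\<forall>(k, s, w) \<in> set [(5,1,2),(5,2,3),(5,3,3),(9,1,3),(13,1,3),(17,1,4)]. s * k < (2::nat) ^ (w + 1) \<and> w < s * (k + 1) \<and> \<not> 2 ^ (s * (k + 1) - w) dvd theta_den k s"
  by (simp add: theta_den_def binomial_fact' fact_numeral)

text \<open>Differences of binomial coefficients with lower index up to \<open>s * k\<close> lose at
  most \<open>2 ^ w\<close>. The bound covers this loss with one factor 2 to spare, which makes each
  term with \<open>s >= 1\<close> contract 2-adic distances.\<close>

lemma theta_den_lipschitz:
  assumes k: "k \<ge> 5" "k mod 4 = 1" and s: "s \<ge> 1"
  shows "\<exists>w. s * k < 2 ^ (w + 1) \<and> multiplicity 2 (theta_den k s) + w + 1 \<le> s * (k + 1)"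
proof (cases "s * (k + 1) < 19")
  case True
  define y where "y = s * (k + 1)"
  have y: "y < 19" using True by (simp only: y_def)
  have "k + 1 \<le> y" using mult_le_mono1[OF s, of "k + 1"] by (simp only: y_def nat_mult_1)
  moreover have "s * 6 \<le> y" unfolding y_def using k by (intro mult_le_mono2) simp
  ultimately have ks: "k < 18" "s < 4" using y by linarith+
  have "k = 5 \<or> k = 9 \<or> k = 13 \<or> k = 17" using k ks by presburger
  moreover have "s = 1 \<or> s = 2 \<or> s = 3" using s ks by presburger
  ultimately have "\<exists>w. (k, s, w) \<in> set [(5,1,2),(5,2,3),(5,3,3),(9,1,3),(13,1,3),(17,1,4::nat)]" using True by auto
  then obtain w where "(k, s, w) \<in> set [(5,1,2),(5,2,3),(5,3,3),(9,1,3),(13,1,3),(17,1,4::nat)]" by blast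
  hence w: "s * k < 2 ^ (w + 1)" "w < s * (k + 1)" "\<not> 2 ^ (s * (k + 1) - w) dvd theta_den k s" using theta_den_lip_small by blast+
  have "multiplicity 2 (theta_den k s) < s * (k + 1) - w" using w(3) by (rule multiplicity_less_of_not_dvd)
  thus ?thesis using w by (intro exI[of _ w]) linarith
next
  case False
  define y where "y = s * (k + 1)"
  have y: "y \<ge> 19" using False by (simp add: y_def)
  have "s * k \<ge> 1" using s k by simp
  then obtain w where w: "2 ^ w \<le> s * k" "s * k < 2 ^ (w + 1)" using ex_power_ivl1[of 2 "s * k"] by auto
  have "2 ^ w \<le> y" using w by (simp add: y_def)
  hence "2 ^ multiplicity 2 (theta_den k s) * 2 ^ w \<le> (2 * y ^ 3) * y"
    using theta_den_crude[of k s] k s unfolding y_def by (intro mult_le_mono) auto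
  hence "2 * (2 ^ multiplicity 2 (theta_den k s) * 2 ^ w) \<le> 4 * y ^ 4" by (simp add: power3_eq_cube power4_eq_xxxx mult_ac)
  also have "\<dots> \<le> 2 ^ y" using y by (rule quartic_le_two_power)
  finally have "2 ^ (multiplicity 2 (theta_den k s) + w + 1) \<le> (2::nat) ^ y" by (simp add: power_add)
  hence "multiplicity 2 (theta_den k s) + w + 1 \<le> y" by (simp only: power_increasing_iff one_less_numeral_iff semiring_norm)
  thus ?thesis using w unfolding y_def by blast
qed

text \<open>Absorption contracts the two binomial coefficients coming from a difference of
  consecutive \<open>gf_coeff\<close> into a single product.\<close>

lemma bracket_identity:
  "int (L + 1) * (2 * int (Suc M choose (L + 1)) - int (M choose L)) = int (M choose L) * (2 * int M + 1 - int L)"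
proof -
  have "int (Suc L * (Suc M choose Suc L)) = int (Suc M * (M choose L))" by (simp only: Suc_times_binomial)
  hence "int (L + 1) * int (Suc M choose (L + 1)) = (int M + 1) * int (M choose L)" by (simp add: algebra_simps)
  thus ?thesis by (simp add: algebra_simps)
qed

lemma binomial_shift_mult: "j \<ge> 1 \<Longrightarrow> j \<le> N \<Longrightarrow> j * (N choose j) = (N - j + 1) * (N choose (j - 1))"
  using times_binomial_minus1_eq[of j N] binomial_absorb_comp[of N "j - 1"] by (simp add: Suc_diff_le)

section \<open>2-adic size of F(n) - 1\<close>

lemma int_two_power_dvd: "(2::int) ^ v dvd int x \<longleftrightarrow> 2 ^ v dvd x"
  by (metis of_nat_dvd_iff of_nat_numeral of_nat_power)

lemma gf_coeff_int_int: "gf_coeff_int k (int N) = gf_coeff k N"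
  by (simp add: gf_coeff_int_def)

lemma gen_fib_branch_two_sum:
  assumes k: "k \<ge> 2"
  shows "gen_fib k (int ((k + 1) * q + 2)) = (\<Sum>s\<le>q. (-1) ^ (q - s) * 2 ^ (s * (k + 1)) *
     (2 * int (Suc (q + s * k) choose (s * (k + 1) + 1)) - int ((q + s * k) choose (s * (k + 1)))))"
proof -
  have "gen_fib k (int ((k + 1) * q + 2)) = gf_coeff k ((k + 1) * q + 1) - gf_coeff k ((k + 1) * q + 0)"
  proof -
    have "int ((k + 1) * q + 2) - 1 = int ((k + 1) * q + 1)" "int ((k + 1) * q + 2) - 2 = int ((k + 1) * q + 0)" by simp_all
    thus ?thesis unfolding gen_fib_eq_bz[OF k] by (simp only: gf_coeff_int_int)
  qed
  also have "\<dots> = (\<Sum>s\<le>q. (-1) ^ (q - s) * 2 ^ (1 + s * (k + 1)) * int ((q + 1 + s * k) choose (1 + s * (k + 1)))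
      - (-1) ^ (q - s) * 2 ^ (0 + s * (k + 1)) * int ((q + 0 + s * k) choose (0 + s * (k + 1))))"
    unfolding sum_subtractf using k by (subst (1 2) gf_coeff_expand) auto
  also have "\<dots> = (\<Sum>s\<le>q. (-1) ^ (q - s) * 2 ^ (s * (k + 1)) *
     (2 * int (Suc (q + s * k) choose (s * (k + 1) + 1)) - int ((q + s * k) choose (s * (k + 1)))))"
  proof (rule sum.cong[OF refl])
    fix s
    have e: "q + 1 + s * k = Suc (q + s * k)" "1 + s * (k + 1) = s * (k + 1) + 1" "q + 0 + s * k = q + s * k" "0 + s * (k + 1) = s * (k + 1)" by auto
    show "(-1) ^ (q - s) * 2 ^ (1 + s * (k + 1)) * int ((q + 1 + s * k) choose (1 + s * (k + 1)))
      - (-1) ^ (q - s) * 2 ^ (0 + s * (k + 1)) * int ((q + 0 + s * k) choose (0 + s * (k + 1))) = (-1) ^ (q - s) * 2 ^ (s * (k + 1)) *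
     (2 * int (Suc (q + s * k) choose (s * (k + 1) + 1)) - int ((q + s * k) choose (s * (k + 1))))"
      unfolding e right_diff_distrib power_add by simp
  qed
  finally show ?thesis .
qed

text \<open>The zeroth term minus 1 will be \<open>2 * g\<close> up to sign, so
  \<open>2 ^ (v + 2)\<close> is exactly what makes the terms with \<open>s >= 1\<close>
  negligible.\<close>

lemma branch_two_term:
  assumes k: "k \<ge> 2" and s: "1 \<le> s" "s \<le> q" and g: "g = (if even q then q else q + 1)" and v: "2 ^ v dvd g"
  shows "2 ^ (v + 2) dvd (2::int) ^ (s * (k + 1)) *
     (2 * int (Suc (q + s * k) choose (s * (k + 1) + 1)) - int ((q + s * k) choose (s * (k + 1))))"
proof -
  define M where "M = q + s * k"
  define L where "L = s * (k + 1)"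
  define t where "t = 2 * int (Suc M choose (L + 1)) - int (M choose L)"
  have br: "int (L + 1) * t = int (M choose L) * (2 * int M + 1 - int L)" unfolding t_def by (rule bracket_identity)
  have vi: "2 ^ v dvd int g" using v by (simp only: int_two_power_dvd)
  have "two_int (v + 2) (of_int (2 ^ L * t))"
  proof (cases "k = 2 \<and> s = 1")
    \<comment> \<open>The denominator bound fails for this pair; instead
      \<open>12 * t = q * (q + 1) ^ 2 * (q + 2)\<close> contains one factor 2 beyond
      \<open>2 ^ v\<close>.\<close>
    case True
    have MLq: "M = q + 2" "L = 3" unfolding M_def L_def using True by auto
    define C3 where "C3 = (q + 2) choose 3"
    define C2 where "C2 = (q + 2) choose 2"
    have h1: "3 * C3 = q * C2" unfolding C3_def C2_def using binomial_shift_mult[of 3 "q + 2"] s by simp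
    have h2: "2 * C2 = (q + 1) * (q + 2)" unfolding C2_def using binomial_shift_mult[of 2 "q + 2"] by simp
    have i1: "3 * int C3 = int q * int C2" using arg_cong[OF h1, of int] by simp
    have i2: "2 * int C2 = (int q + 1) * (int q + 2)" using arg_cong[OF h2, of int] by (simp add: algebra_simps)
    have "6 * int C3 = 2 * (int q * int C2)" unfolding i1[symmetric] by simp
    also have "\<dots> = int q * (2 * int C2)" by simp
    also have "\<dots> = int q * (int q + 1) * (int q + 2)" unfolding i2 by simp
    finally have c: "6 * int ((q + 2) choose 3) = int q * (int q + 1) * (int q + 2)" unfolding C3_def .
    have "int (3 + 1) * t = int ((q + 2) choose 3) * (2 * int (q + 2) + 1 - int 3)" using br unfolding MLq .
    hence "4 * t = int ((q + 2) choose 3) * (2 * int q + 2)" by simp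
    hence "12 * t = (6 * int ((q + 2) choose 3)) * (int q + 1)" by (simp only: distrib_left)
    hence t12: "12 * t = int q * (int q + 1) * (int q + 2) * (int q + 1)" unfolding c .
    have "2 ^ (v + 1) dvd int q * (int q + 1) * (int q + 2) * (int q + 1)"
    proof (cases "even q")
      case True
      hence "2 ^ v * 2 dvd int q * (int q + 2)" using vi g by (intro mult_dvd_mono) auto
      hence "2 ^ v * 2 dvd (int q * (int q + 2)) * ((int q + 1) * (int q + 1))" by (rule dvd_mult2)
      thus ?thesis by (simp add: mult_ac)
    next
      case False
      have "2 ^ v dvd int q + 1" using vi g False by (simp add: add.commute)
      hence "2 ^ v * 2 dvd (int q + 1) * (int q + 1)" using False by (intro mult_dvd_mono) auto
      hence "2 ^ v * 2 dvd ((int q + 1) * (int q + 1)) * (int q * (int q + 2))" by (rule dvd_mult2)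
      thus ?thesis by (simp add: mult_ac)
    qed
    moreover have "multiplicity 2 (12::nat) = 2"
    proof -
      have "multiplicity 2 (12::nat) < 3" by (rule multiplicity_less_of_not_dvd) simp
      moreover have "2 \<le> multiplicity 2 (12::nat)" by (rule multiplicity_geI) auto
      ultimately show ?thesis by simp
    qed
    moreover have "of_int (2 ^ L * t) * of_nat 12 = (of_int (2 ^ 3 * (12 * t)) :: rat)" unfolding MLq by simp
    ultimately show ?thesis unfolding t12
      by (intro two_int_div[where D = 12 and f = 3 and v = "v + 1"]) auto
  next
    case False
    have Lsk: "s * k \<le> L" "L \<le> M" unfolding L_def M_def using s by (simp_all add: algebra_simps)
    have "(M choose L) * (L choose (s * k)) = (M choose (s * k)) * ((M - s * k) choose (L - s * k))"
      using Lsk by (rule choose_mult)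
    moreover have "M - s * k = q" "L - s * k = s" unfolding M_def L_def by (simp_all add: algebra_simps)
    ultimately have cc: "(M choose L) * (L choose (s * k)) = (M choose (s * k)) * (q choose s)" by (simp only:)
    \<comment> \<open>For even \<open>q\<close> absorption in \<open>q choose s\<close> extracts
      \<open>q\<close>; for odd \<open>q\<close> absorption in \<open>M choose (s * k)\<close>
      extracts \<open>M - s * k + 1 = q + 1\<close>.\<close>
    have "\<exists>z. (s * k) * ((M choose (s * k)) * (q choose s)) = g * z"
    proof (cases "even q")
      case True
      have "s * (q choose s) = q * ((q - 1) choose (s - 1))" using s by (intro times_binomial_minus1_eq) auto
      hence h: "(s * k) * ((M choose (s * k)) * (q choose s)) = q * (((q - 1) choose (s - 1)) * (k * (M choose (s * k))))"
        by (metis mult.assoc mult.commute mult.left_commute)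
      have gq: "g = q" using True g by simp
      show ?thesis unfolding gq by (rule exI, rule h)
    next
      case False
      have "(s * k) * (M choose (s * k)) = (M - s * k + 1) * (M choose (s * k - 1))"
        using s k Lsk by (intro binomial_shift_mult) auto
      also have "M - s * k + 1 = q + 1" unfolding M_def by simp
      finally have h: "(s * k) * ((M choose (s * k)) * (q choose s)) = (q + 1) * ((M choose (s * k - 1)) * (q choose s))"
        by (metis mult.assoc)
      have gq: "g = q + 1" using False g by simp
      show ?thesis unfolding gq by (rule exI, rule h)
    qed
    then obtain z where z: "(s * k) * ((M choose (s * k)) * (q choose s)) = g * z" by blast
    have "int (branch_two_den k s) * t = int ((s * k) * (L choose (s * k))) * (int (L + 1) * t)"
      unfolding branch_two_den_def L_def by (simp only: of_nat_mult mult_ac)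
    also have "\<dots> = int ((s * k) * ((M choose L) * (L choose (s * k)))) * (2 * int M + 1 - int L)" unfolding br by simp
    also have "\<dots> = int g * (int z * (2 * int M + 1 - int L))" unfolding cc z by simp
    finally have Dt: "int (branch_two_den k s) * t = int g * (int z * (2 * int M + 1 - int L))" .
    have "of_int (2 ^ L * t) * of_nat (branch_two_den k s) = (of_int (2 ^ L * (int (branch_two_den k s) * t)) :: rat)" by simp
    hence "of_int (2 ^ L * t) * of_nat (branch_two_den k s) = (of_int (2 ^ L * (int g * (int z * (2 * int M + 1 - int L)))) :: rat)"
      unfolding Dt .
    thus ?thesis
    proof (rule two_int_div)
      show "2 ^ v dvd int g * (int z * (2 * int M + 1 - int L))" using vi by simp
      show "branch_two_den k s \<noteq> 0" unfolding branch_two_den_def using k s by simp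
      show "multiplicity 2 (branch_two_den k s) + (v + 2) \<le> L + v" using branch_two_den_bound[OF k s(1) False] unfolding L_def by simp
    qed
  qed
  from two_int_of_intD[OF this] show ?thesis unfolding t_def M_def L_def .
qed

text \<open>The zeroth term minus 1 has valuation exactly \<open>v + 1\<close>, and all other terms
  are divisible by \<open>2 ^ (v + 2)\<close>; hence \<open>m <= v + 1\<close>, where
  \<open>2 ^ v\<close> divides \<open>q\<close> or \<open>q + 1\<close>.\<close>

lemma branch_two_bound:
  assumes k: "k \<ge> 2" and q: "q \<ge> 1" and m: "2 ^ m dvd gen_fib k (int ((k + 1) * q + 2)) - 1"
  shows "2 ^ m \<le> 2 * (q + 1)"
proof -
  define tau where "tau s = (-1) ^ (q - s) * 2 ^ (s * (k + 1)) *
     (2 * int (Suc (q + s * k) choose (s * (k + 1) + 1)) - int ((q + s * k) choose (s * (k + 1))))" for s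
  define g where "g = (if even q then q else q + 1)"
  define v where "v = multiplicity 2 g"
  have g0: "g \<ge> 1" "g \<le> q + 1" unfolding g_def using q by auto
  have vg: "2 ^ v dvd g" unfolding v_def by (rule multiplicity_dvd)
  have "gen_fib k (int ((k + 1) * q + 2)) = (\<Sum>s\<le>q. tau s)" unfolding tau_def by (rule gen_fib_branch_two_sum[OF k])
  also have "{..q} = insert 0 {1..q}" by auto
  also have "(\<Sum>s\<in>insert 0 {1..q}. tau s) = tau 0 + (\<Sum>s=1..q. tau s)" by simp
  finally have F: "gen_fib k (int ((k + 1) * q + 2)) - 1 = (tau 0 - 1) + (\<Sum>s=1..q. tau s)" by simp
  have rest: "2 ^ (v + 2) dvd (\<Sum>s=1..q. tau s)"
  proof (rule dvd_sum)
    fix s assume "s \<in> {1..q}"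
    hence "2 ^ (v + 2) dvd (2::int) ^ (s * (k + 1)) * (2 * int (Suc (q + s * k) choose (s * (k + 1) + 1)) - int ((q + s * k) choose (s * (k + 1))))"
      using branch_two_term[OF k _ _ g_def vg] by auto
    thus "2 ^ (v + 2) dvd tau s" unfolding tau_def mult.assoc by (rule dvd_mult)
  qed
  have t0: "tau 0 - 1 = 2 * int g \<or> tau 0 - 1 = - (2 * int g)" unfolding tau_def g_def by (cases "even q") auto
  have "m \<le> v + 1"
  proof (rule ccontr)
    assume "\<not> ?thesis"
    hence "(2::int) ^ (v + 2) dvd 2 ^ m" by (intro le_imp_power_dvd) auto
    hence "2 ^ (v + 2) dvd (tau 0 - 1) + (\<Sum>s=1..q. tau s)" using m unfolding F by (rule dvd_trans)
    hence "2 ^ (v + 2) dvd tau 0 - 1" using rest by (simp add: dvd_add_left_iff)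
    hence "2 ^ (v + 2) dvd 2 * int g" using t0 by (auto simp: dvd_minus_iff)
    moreover have "(2::int) ^ (v + 2) = 2 * 2 ^ (v + 1)" by simp
    ultimately have "2 * 2 ^ (v + 1) dvd 2 * int g" by (simp only:)
    hence "2 ^ (v + 1) dvd int g" by (metis dvd_mult_cancel_left zero_neq_numeral)
    hence "2 ^ (v + 1) dvd g" by (simp only: int_two_power_dvd)
    hence "v + 1 \<le> multiplicity 2 g" using g0 by (intro multiplicity_geI) auto
    thus False unfolding v_def by simp
  qed
  hence "(2::nat) ^ m \<le> 2 ^ (v + 1)" by (intro power_increasing) auto
  also have "\<dots> = 2 * 2 ^ v" by simp
  also have "\<dots> \<le> 2 * g" using multiplicity_two_le[OF g0(1)] unfolding v_def by simp
  also have "\<dots> \<le> 2 * (q + 1)" using g0 by simp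
  finally show ?thesis .
qed

section \<open>Indices that are 1 modulo \<open>k + 1\<close>\<close>

text \<open>Term \<open>s + 1\<close> of the first expansion is paired with term \<open>s\<close> of
  the second; the unpaired term is \<open>(-1) ^ Suc q'\<close>.\<close>

lemma gen_fib_branch_one_sum:
  assumes k: "k \<ge> 2"
  shows "gen_fib k (int ((k + 1) * Suc q' + 1)) = (-1) ^ Suc q' + (\<Sum>s\<le>q'. (-1) ^ (q' - s) * 2 ^ (k + s * (k + 1)) *
     (2 * int (Suc (q' + k + s * k) choose (k + s * (k + 1) + 1)) - int ((q' + k + s * k) choose (k + s * (k + 1)))))"
proof -
  have e1: "(k + 1) * Suc q' + 1 - 2 = (k + 1) * q' + k" by simp
  have "gen_fib k (int ((k + 1) * Suc q' + 1)) = gf_coeff k ((k + 1) * Suc q' + 0) - gf_coeff k ((k + 1) * q' + k)"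
  proof -
    have "int ((k + 1) * Suc q' + 1) - 1 = int ((k + 1) * Suc q' + 0)" "int ((k + 1) * Suc q' + 1) - 2 = int ((k + 1) * q' + k)"
      by (simp_all add: algebra_simps)
    thus ?thesis unfolding gen_fib_eq_bz[OF k] by (simp only: gf_coeff_int_int)
  qed
  also have "gf_coeff k ((k + 1) * Suc q' + 0) = (\<Sum>s\<le>Suc q'. (-1) ^ (Suc q' - s) * 2 ^ (0 + s * (k + 1)) * int ((Suc q' + 0 + s * k) choose (0 + s * (k + 1))))"
    using k by (intro gf_coeff_expand) auto
  also have "\<dots> = (-1) ^ Suc q' + (\<Sum>s\<le>q'. (-1) ^ (q' - s) * 2 ^ (Suc s * (k + 1)) * int ((Suc q' + Suc s * k) choose (Suc s * (k + 1))))"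
    unfolding sum.atMost_Suc_shift by simp
  also have "gf_coeff k ((k + 1) * q' + k) = (\<Sum>s\<le>q'. (-1) ^ (q' - s) * 2 ^ (k + s * (k + 1)) * int ((q' + k + s * k) choose (k + s * (k + 1))))"
    using k by (intro gf_coeff_expand) auto
  also have "(-1) ^ Suc q' + (\<Sum>s\<le>q'. (-1) ^ (q' - s) * 2 ^ (Suc s * (k + 1)) * int ((Suc q' + Suc s * k) choose (Suc s * (k + 1))))
     - (\<Sum>s\<le>q'. (-1) ^ (q' - s) * 2 ^ (k + s * (k + 1)) * int ((q' + k + s * k) choose (k + s * (k + 1))))
    = (-1) ^ Suc q' + (\<Sum>s\<le>q'. (-1) ^ (q' - s) * 2 ^ (Suc s * (k + 1)) * int ((Suc q' + Suc s * k) choose (Suc s * (k + 1)))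
     - (-1) ^ (q' - s) * 2 ^ (k + s * (k + 1)) * int ((q' + k + s * k) choose (k + s * (k + 1))))" by (simp add: sum_subtractf)
  also have "\<dots> = (-1) ^ Suc q' + (\<Sum>s\<le>q'. (-1) ^ (q' - s) * 2 ^ (k + s * (k + 1)) *
     (2 * int (Suc (q' + k + s * k) choose (k + s * (k + 1) + 1)) - int ((q' + k + s * k) choose (k + s * (k + 1)))))"
  proof (intro arg_cong2[where f = "(+)"] refl sum.cong)
    fix s
    have e: "Suc q' + Suc s * k = Suc (q' + k + s * k)" "Suc s * (k + 1) = k + s * (k + 1) + 1" by auto
    show "(-1) ^ (q' - s) * 2 ^ (Suc s * (k + 1)) * int ((Suc q' + Suc s * k) choose (Suc s * (k + 1)))
     - (-1) ^ (q' - s) * 2 ^ (k + s * (k + 1)) * int ((q' + k + s * k) choose (k + s * (k + 1))) = (-1) ^ (q' - s) * 2 ^ (k + s * (k + 1)) *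
     (2 * int (Suc (q' + k + s * k) choose (k + s * (k + 1) + 1)) - int ((q' + k + s * k) choose (k + s * (k + 1))))"
      unfolding e right_diff_distrib power_add[of 2 "k + s * (k + 1)" 1] by simp
  qed
  finally show ?thesis .
qed

text \<open>For even \<open>q\<close>, the number \<open>F ((k + 1) q + 1) - 1\<close> is the alternating sum of these terms up to
  the factor \<open>- 2 ^ k * ((q - 1 + k) choose k) / (k + 1)\<close>.\<close>

definition theta_term :: "nat \<Rightarrow> nat \<Rightarrow> nat \<Rightarrow> rat" where
  "theta_term k q s = 2 ^ (s * (k + 1)) * of_nat (((q - 1) choose s) * ((q - 1 + k + s * k) choose (s * k)) * (2 * q + (s + 1) * (k - 1))) / of_nat (theta_den k s)"

lemma theta_term_mult: "theta_term k q s * of_nat (theta_den k s) = of_int (2 ^ (s * (k + 1)) * int (((q - 1) choose s) * ((q - 1 + k + s * k) choose (s * k)) * (2 * q + (s + 1) * (k - 1))))"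
  unfolding theta_term_def using theta_den_nonzero[of k s] by simp

lemma theta_term_0: "k \<ge> 1 \<Longrightarrow> theta_term k q 0 = of_int (int (2 * q + (k - 1)))"
  unfolding theta_term_def theta_den_def by simp

text \<open>Two uses of \<open>choose_mult\<close> expose the factor
  \<open>(q' + k) choose k\<close>, which does not depend on \<open>s\<close> and can therefore be
  divided out of the whole sum.\<close>

lemma branch_one_bracket:
  assumes k: "k \<ge> 2" and s: "s \<le> q'"
  shows "of_int (int (k + 1) * (2 ^ (s * (k + 1)) * (2 * int (Suc (q' + k + s * k) choose (k + s * (k + 1) + 1)) - int ((q' + k + s * k) choose (k + s * (k + 1))))))
     = of_nat ((q' + k) choose k) * theta_term k (Suc q') s"
proof -
  define M where "M = q' + k + s * k"
  define L where "L = k + s * (k + 1)"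
  define t where "t = 2 * int (Suc M choose (L + 1)) - int (M choose L)"
  have br: "int (L + 1) * t = int (M choose L) * (2 * int M + 1 - int L)" unfolding t_def by (rule bracket_identity)
  have Lsk: "s * k \<le> L" "L \<le> M" unfolding L_def M_def using s by (simp_all add: algebra_simps)
  have "(M choose L) * (L choose (s * k)) = (M choose (s * k)) * ((M - s * k) choose (L - s * k))"
    using Lsk by (rule choose_mult)
  moreover have "M - s * k = q' + k" "L - s * k = k + s" unfolding M_def L_def by (simp_all add: algebra_simps)
  ultimately have c1: "(M choose L) * (L choose (s * k)) = (M choose (s * k)) * ((q' + k) choose (k + s))" by (simp only:)
  have "((q' + k) choose (k + s)) * ((k + s) choose k) = ((q' + k) choose k) * ((q' + k - k) choose (k + s - k))"
    using s by (intro choose_mult) auto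
  hence c2: "((q' + k) choose (k + s)) * ((k + s) choose k) = ((q' + k) choose k) * (q' choose s)" by simp
  have W: "theta_den k s = (s + 1) * ((L choose (s * k)) * ((k + s) choose k))" unfolding theta_den_def L_def by (simp add: algebra_simps)
  have f: "2 * int M + 1 - int L = int (2 * Suc q' + (s + 1) * (k - 1))"
  proof -
    obtain k1 where "k = Suc k1" using k by (cases k) auto
    thus ?thesis unfolding M_def L_def by (simp add: algebra_simps)
  qed
  have L1: "int (L + 1) = int (s + 1) * int (k + 1)" unfolding L_def by (simp add: algebra_simps)
  have "int (theta_den k s) * (int (k + 1) * t) = int ((L choose (s * k)) * ((k + s) choose k)) * (int (L + 1) * t)"
    unfolding W L1 by (simp add: algebra_simps)
  also have "\<dots> = int (((M choose L) * (L choose (s * k))) * ((k + s) choose k)) * int (2 * Suc q' + (s + 1) * (k - 1))"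
    unfolding br f by simp
  also have "\<dots> = int ((M choose (s * k)) * (((q' + k) choose (k + s)) * ((k + s) choose k))) * int (2 * Suc q' + (s + 1) * (k - 1))"
    unfolding c1 by simp
  also have "\<dots> = int ((q' + k) choose k) * int ((q' choose s) * (M choose (s * k)) * (2 * Suc q' + (s + 1) * (k - 1)))"
    unfolding c2 by (simp only: of_nat_mult mult_ac)
  finally have main: "int (theta_den k s) * (int (k + 1) * t) = int ((q' + k) choose k) * int ((q' choose s) * (M choose (s * k)) * (2 * Suc q' + (s + 1) * (k - 1)))" .
  have "of_int (int (k + 1) * (2 ^ (s * (k + 1)) * t)) * of_nat (theta_den k s) = (of_int (2 ^ (s * (k + 1)) * (int (theta_den k s) * (int (k + 1) * t))) :: rat)"
    by simp
  also have "\<dots> = of_nat ((q' + k) choose k) * (theta_term k (Suc q') s * of_nat (theta_den k s))"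
    unfolding main theta_term_mult M_def by simp
  finally show ?thesis using theta_den_nonzero[of k s] unfolding t_def M_def L_def by simp
qed

lemma branch_one_identity:
  assumes k: "k \<ge> 2" and q: "q \<ge> 1" and ev: "even q"
  shows "of_int (int (k + 1) * (gen_fib k (int ((k + 1) * q + 1)) - 1)) = - (2 ^ k * of_nat ((q - 1 + k) choose k) * (\<Sum>s<q. (-1) ^ s * theta_term k q s))"
proof -
  obtain q' where q': "q = Suc q'" using q by (cases q) auto
  define t where "t s = 2 * int (Suc (q' + k + s * k) choose (k + s * (k + 1) + 1)) - int ((q' + k + s * k) choose (k + s * (k + 1)))" for s
  have "gen_fib k (int ((k + 1) * q + 1)) - 1 = (\<Sum>s\<le>q'. (-1) ^ (q' - s) * 2 ^ (k + s * (k + 1)) * t s)"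
    using gen_fib_branch_one_sum[OF k, of q'] ev unfolding q' t_def by simp
  also have "\<dots> = (\<Sum>s\<le>q'. - (2 ^ k * ((-1) ^ s * (2 ^ (s * (k + 1)) * t s))))"
  proof (rule sum.cong[OF refl])
    fix s assume "s \<in> {..q'}"
    hence "(-1) ^ (q' - s) = - ((-1::int) ^ s)" using ev unfolding q' by (auto simp: minus_one_power_iff)
    thus "(-1) ^ (q' - s) * 2 ^ (k + s * (k + 1)) * t s = - (2 ^ k * ((-1) ^ s * (2 ^ (s * (k + 1)) * t s)))"
      by (simp add: power_add)
  qed
  finally have "int (k + 1) * (gen_fib k (int ((k + 1) * q + 1)) - 1) = (\<Sum>s\<le>q'. - (2 ^ k * ((-1) ^ s * (int (k + 1) * (2 ^ (s * (k + 1)) * t s)))))"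
    by (simp only: sum_distrib_left) (simp add: mult_ac)
  hence "of_int (int (k + 1) * (gen_fib k (int ((k + 1) * q + 1)) - 1)) = (\<Sum>s\<le>q'. - (2 ^ k * ((-1) ^ s * (of_int (int (k + 1) * (2 ^ (s * (k + 1)) * t s)) :: rat))))"
    by (simp only:) simp
  also have "\<dots> = (\<Sum>s\<le>q'. - (2 ^ k * of_nat ((q' + k) choose k) * ((-1) ^ s * theta_term k (Suc q') s)))"
    unfolding t_def by (intro sum.cong refl) (simp only: branch_one_bracket[OF k] atMost_iff, simp add: mult_ac)
  also have "\<dots> = - (2 ^ k * of_nat ((q' + k) choose k) * (\<Sum>s\<le>q'. (-1) ^ s * theta_term k (Suc q') s))"
    by (simp add: sum_negf sum_distrib_left)
  finally show ?thesis unfolding q' by (simp add: lessThan_Suc_atMost)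
qed

text \<open>For odd \<open>q\<close> the unpaired term is -1 and the rest is divisible by 4, so the
  number is 2 modulo 4.\<close>

lemma branch_one_odd:
  assumes k: "k \<ge> 2" and q: "odd q" and m: "2 ^ m dvd gen_fib k (int ((k + 1) * q + 1)) - 1"
  shows "m \<le> 1"
proof (rule ccontr)
  assume "\<not> m \<le> 1"
  hence "(2::int) ^ 2 dvd 2 ^ m" by (intro le_imp_power_dvd) auto
  hence d: "4 dvd gen_fib k (int ((k + 1) * q + 1)) - 1" using m dvd_trans by fastforce
  obtain q' where q': "q = Suc q'" using q by (cases q) auto
  define S where "S = (\<Sum>s\<le>q'. (-1) ^ (q' - s) * 2 ^ (k + s * (k + 1)) *
     (2 * int (Suc (q' + k + s * k) choose (k + s * (k + 1) + 1)) - int ((q' + k + s * k) choose (k + s * (k + 1)))))"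
  have "4 dvd S" unfolding S_def
  proof (rule dvd_sum)
    fix s
    have "(2::int) ^ 2 dvd 2 ^ (k + s * (k + 1))" using k by (intro le_imp_power_dvd) auto
    hence "4 dvd (2::int) ^ (k + s * (k + 1))" by simp
    thus "4 dvd (-1) ^ (q' - s) * 2 ^ (k + s * (k + 1)) *
     (2 * int (Suc (q' + k + s * k) choose (k + s * (k + 1) + 1)) - int ((q' + k + s * k) choose (k + s * (k + 1))))"
      by (intro dvd_mult2 dvd_mult)
  qed
  moreover have "gen_fib k (int ((k + 1) * q + 1)) - 1 = -2 + S"
  proof -
    have "(-1) ^ Suc q' = (-1::int)" using q unfolding q' by simp
    thus ?thesis using gen_fib_branch_one_sum[OF k, of q'] unfolding q' S_def[symmetric] by linarith
  qed
  ultimately have "4 dvd (-2::int)" using d by (metis dvd_add_left_iff)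
  thus False by simp
qed

lemma theta_term_two_int:
  assumes "multiplicity 2 (theta_den k s) + e \<le> s * (k + 1) + d" and "2 ^ d dvd 2 * q + (s + 1) * (k - 1)"
  shows "two_int e (theta_term k q s)"
proof (rule two_int_div[OF theta_term_mult _ theta_den_nonzero assms(1)])
  have "2 ^ d dvd ((q - 1) choose s) * ((q - 1 + k + s * k) choose (s * k)) * (2 * q + (s + 1) * (k - 1))"
    using assms(2) by (rule dvd_mult)
  thus "2 ^ d dvd int (((q - 1) choose s) * ((q - 1 + k + s * k) choose (s * k)) * (2 * q + (s + 1) * (k - 1)))"
    by (simp only: int_two_power_dvd)
qed

text \<open>The factor split off has 2-part at most \<open>2 ^ k * (q - 1 + k)\<close>, which is all
  that is lost when divisibility passes to the sum.\<close>

lemma sum_two_int_of_branch: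
  assumes k: "k \<ge> 2" and q: "q \<ge> 1" and ev: "even q" and m: "2 ^ m dvd gen_fib k (int ((k + 1) * q + 1)) - 1"
    and e: "2 ^ (e + k) * (q - 1 + k) \<le> 2 ^ m"
  shows "two_int e (\<Sum>s<q. (-1) ^ s * theta_term k q s)"
proof -
  define C where "C = (q - 1 + k) choose k"
  have C0: "C \<noteq> 0" unfolding C_def by simp
  obtain z where z: "gen_fib k (int ((k + 1) * q + 1)) - 1 = 2 ^ m * z" using m by (rule dvdE)
  have "2 ^ multiplicity 2 C \<le> q - 1 + k" unfolding C_def using k by (intro multiplicity_two_binomial) auto
  hence "2 ^ (e + k) * 2 ^ multiplicity 2 C \<le> (2::nat) ^ m" using e by (meson le_trans mult_le_mono2)
  hence "(2::nat) ^ (e + k + multiplicity 2 C) \<le> 2 ^ m" by (simp add: power_add)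
  hence em: "e + k + multiplicity 2 C \<le> m" by (simp only: power_increasing_iff one_less_numeral_iff semiring_norm)
  have "(\<Sum>s<q. (-1) ^ s * theta_term k q s) * of_nat (2 ^ k * C) = of_int (2 ^ m * (- int (k + 1) * z))"
  proof -
    have "of_int (2 ^ m * (- int (k + 1) * z)) = - (of_int (int (k + 1) * (2 ^ m * z)) :: rat)"
      by (simp add: algebra_simps)
    also have "\<dots> = 2 ^ k * of_nat C * (\<Sum>s<q. (-1) ^ s * theta_term k q s)"
      using branch_one_identity[OF k q ev] unfolding z C_def by (simp only: minus_minus)
    finally show ?thesis by (simp add: mult_ac)
  qed
  thus ?thesis
  proof (rule two_int_div[where v = 0])
    have "multiplicity 2 (2 ^ k * C) = k + multiplicity 2 C"
      using C0 by (simp add: multiplicity_two_mult multiplicity_same_power)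
    thus "multiplicity 2 (2 ^ k * C) + e \<le> m + 0" using em by simp
  qed (use C0 in auto)
qed

lemma sum_Psi_split: "q \<ge> 1 \<Longrightarrow> (\<Sum>s<q. (-1) ^ s * theta_term k q s) = theta_term k q 0 + (\<Sum>s=1..<q. (-1) ^ s * theta_term k q s)"
proof -
  assume "q \<ge> 1"
  hence "{..<q} = insert 0 {1..<q}" by auto
  thus ?thesis by simp
qed

text \<open>The term \<open>2 * q + (k - 1)\<close> of index 0 is odd for even \<open>k\<close> and,
  as \<open>q\<close> is even, 2 modulo 4 for \<open>k\<close> equal to 3 modulo 4. All other terms
  are divisible by one more factor 2, so the sum cannot be.\<close>

lemma branch_one_bound:
  assumes k: "k \<ge> 2" "k mod 4 \<noteq> 1" and q: "q \<ge> 1" and m: "2 ^ m dvd gen_fib k (int ((k + 1) * q + 1)) - 1"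
  shows "2 ^ m < 2 ^ (k + 2) * (q + k)"
proof (rule ccontr)
  assume neg: "\<not> ?thesis"
  have ev: "even q"
  proof (rule ccontr)
    assume "odd q"
    hence "m \<le> 1" using branch_one_odd[OF k(1) _ m] by simp
    hence "(2::nat) ^ m \<le> 2 ^ 1" by (intro power_increasing) auto
    hence a: "(2::nat) ^ m \<le> 2" by simp
    have "(2::nat) ^ 2 * 1 \<le> 2 ^ (k + 2) * (q + k)" using k q by (intro mult_le_mono power_increasing) auto
    hence "4 \<le> 2 ^ (k + 2) * (q + k)" by simp
    thus False using neg a by linarith
  qed
  \<comment> \<open>For odd \<open>k\<close> every numerator contains the even factor
    \<open>2 * q + (s + 1) * (k - 1)\<close>, which adds 1 to all valuations.\<close>
  define d where "d = (if even k then 0 else 1 :: nat)"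
  have "2 ^ (d + 1 + k) * (q - 1 + k) \<le> 2 ^ (k + 2) * (q + k)" unfolding d_def by (intro mult_le_mono power_increasing) auto
  hence S: "two_int (d + 1) (\<Sum>s<q. (-1) ^ s * theta_term k q s)"
    using neg by (intro sum_two_int_of_branch[OF k(1) q ev m]) linarith
  have "two_int (d + 1) (\<Sum>s=1..<q. (-1) ^ s * theta_term k q s)"
  proof (intro two_int_sum two_int_sign theta_term_two_int[where d = d])
    fix s assume "s \<in> {1..<q}"
    thus "multiplicity 2 (theta_den k s) + (d + 1) \<le> s * (k + 1) + d" using theta_den_bound[OF k(1), of s] by simp
    show "2 ^ d dvd 2 * q + (s + 1) * (k - 1)" unfolding d_def using k by auto
  qed
  hence "two_int (d + 1) (theta_term k q 0)" using two_int_diff[OF S] unfolding sum_Psi_split[OF q] by fastforce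
  hence "2 ^ (d + 1) dvd int (2 * q + (k - 1))" using k by (simp only: theta_term_0 two_int_of_intD)
  hence dd: "2 ^ (d + 1) dvd 2 * q + (k - 1)" by (simp only: int_two_power_dvd)
  show False
  proof (cases "even k")
    case True
    thus False using dd k unfolding d_def by auto
  next
    case False
    hence "4 dvd 2 * q + (k - 1)" using dd unfolding d_def by simp
    moreover obtain j where "q = 2 * j" using ev by (elim evenE)
    moreover have "k mod 4 = 3" using False k(2) by presburger
    ultimately show False by presburger
  qed
qed

section \<open>The isometry \<open>theta\<close>\<close>

text \<open>Halving makes the leading term \<open>q + (k - 1) div 2\<close> for odd
  \<open>k\<close>. The number \<open>n\<close> of terms is kept apart from the argument
  \<open>q\<close>, so that values at different \<open>q\<close> can be compared term by term; terms
  with \<open>s >= q >= 1\<close> vanish.\<close>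

definition theta :: "nat \<Rightarrow> nat \<Rightarrow> nat \<Rightarrow> rat" where
  "theta k q n = (\<Sum>s<n. (-1) ^ s * (theta_term k q s / 2))"

definition theta_num :: "nat \<Rightarrow> nat \<Rightarrow> nat \<Rightarrow> nat" where
  "theta_num k q s = ((q - 1) choose s) * ((q - 1 + k + s * k) choose (s * k)) * (q + (s + 1) * ((k - 1) div 2))"

lemma theta_term_half:
  assumes "odd k"
  shows "theta_term k q s / 2 * of_nat (theta_den k s) = of_int (2 ^ (s * (k + 1)) * int (theta_num k q s))"
proof -
  have "k - 1 = 2 * ((k - 1) div 2)" using assms by simp
  hence "2 * q + (s + 1) * (k - 1) = 2 * (q + (s + 1) * ((k - 1) div 2))" by (metis distrib_left mult.left_commute)
  hence "((q - 1) choose s) * ((q - 1 + k + s * k) choose (s * k)) * (2 * q + (s + 1) * (k - 1)) = 2 * theta_num k q s"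
    unfolding theta_num_def by (simp only: mult_ac)
  hence "theta_term k q s * of_nat (theta_den k s) = of_int (2 ^ (s * (k + 1)) * int (2 * theta_num k q s))" using theta_term_mult[of k q s] by simp
  thus ?thesis by simp
qed

lemma theta_two_int:
  assumes k: "k \<ge> 2" and q: "q \<ge> 1" and ev: "even q" and m: "2 ^ m dvd gen_fib k (int ((k + 1) * q + 1)) - 1"
    and e: "2 ^ (e + 1 + k) * (q - 1 + k) \<le> 2 ^ m"
  shows "two_int e (theta k q q)"
proof -
  have "two_int (e + 1) (\<Sum>s<q. (-1) ^ s * theta_term k q s)" by (rule sum_two_int_of_branch[OF k q ev m e])
  then obtain a b :: int where ab: "odd b" "(\<Sum>s<q. (-1) ^ s * theta_term k q s) * of_int b = of_int (2 ^ (e + 1) * a)"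
    unfolding two_int_def by blast
  have t2: "2 * theta k q q = (\<Sum>s<q. (-1) ^ s * theta_term k q s)" unfolding theta_def sum_distrib_left by (intro sum.cong) auto
  have "2 * (theta k q q * of_int b) = (2 * theta k q q) * of_int b" by simp
  also have "\<dots> = 2 * of_int (2 ^ e * a)" unfolding t2 ab(2) by simp
  finally have "theta k q q * of_int b = of_int (2 ^ e * a)" by simp
  thus ?thesis unfolding two_int_def using ab(1) by blast
qed

lemma theta_extend: assumes "q \<ge> 1" "q \<le> n" shows "theta k q n = theta k q q"
  unfolding theta_def
proof (rule sum.mono_neutral_right)
  show "\<forall>i\<in>{..<n} - {..<q}. (-1) ^ i * (theta_term k q i / 2) = 0"
  proof
    fix i assume "i \<in> {..<n} - {..<q}"
    hence "(q - 1) choose i = 0" using assms by (intro binomial_eq_0) auto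
    thus "(-1) ^ i * (theta_term k q i / 2) = 0" unfolding theta_term_def by simp
  qed
qed (use assms in auto)

lemma theta_term_half_two_int:
  assumes "odd k" and "multiplicity 2 (theta_den k s) + e \<le> s * (k + 1)"
  shows "two_int e (theta_term k q s / 2)"
  by (rule two_int_div[OF theta_term_half[OF assms(1)], where v = 0]) (use assms theta_den_nonzero in auto)

text \<open>By Vandermonde the difference is a combination of \<open>d choose i\<close> with
  \<open>1 <= i <= j\<close>; since \<open>i * (d choose i)\<close> is a multiple of
  \<open>d\<close>, such a coefficient loses only the 2-part of \<open>i\<close>, at most
  \<open>2 ^ w\<close>.\<close>

lemma binomial_diff_dvd:
  assumes v: "2 ^ v dvd (d::nat)" and j: "j < 2 ^ (w + 1)"
  shows "2 ^ v dvd 2 ^ w * (int ((x + d) choose j) - int (x choose j))"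
proof -
  have "(x + d) choose j = (\<Sum>i\<le>j. (d choose i) * (x choose (j - i)))" using vandermonde[of d x j] by (simp add: add.commute)
  also have "{..j} = insert 0 {1..j}" by auto
  also have "(\<Sum>i\<in>insert 0 {1..j}. (d choose i) * (x choose (j - i))) = (x choose j) + (\<Sum>i=1..j. (d choose i) * (x choose (j - i)))" by simp
  finally have "2 ^ w * (int ((x + d) choose j) - int (x choose j)) = int (\<Sum>i=1..j. 2 ^ w * (d choose i) * (x choose (j - i)))"
    by (simp add: sum_distrib_left mult.assoc)
  moreover have "2 ^ v dvd (\<Sum>i=1..j. 2 ^ w * (d choose i) * (x choose (j - i)))"
  proof (rule dvd_sum)
    fix i assume i: "i \<in> {1..j}"
    obtain i' where i': "i = 2 ^ multiplicity 2 i * i'" "\<not> 2 dvd i'" using multiplicity_decompose'[of i 2] i by auto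
    define u where "u = multiplicity 2 i"
    have "2 ^ u \<le> i" unfolding u_def using i by (intro multiplicity_two_le) auto
    also have "i < 2 ^ (w + 1)" using i j by simp
    finally have "u < w + 1" by (simp only: power_strict_increasing_iff one_less_numeral_iff semiring_norm)
    hence uw: "u \<le> w" by simp
    have "2 ^ v dvd i * (d choose i)" using v i times_binomial_minus1_eq[of i d] by auto
    hence "2 ^ v dvd i' * (2 ^ u * (d choose i))" using i'(1) unfolding u_def by (metis mult.assoc mult.commute)
    moreover have "coprime (2 ^ v) i'" using i'(2) by simp
    ultimately have "2 ^ v dvd 2 ^ u * (d choose i)" by (simp add: coprime_dvd_mult_right_iff)
    hence "2 ^ v dvd 2 ^ (w - u) * (2 ^ u * (d choose i))" by (rule dvd_mult)
    moreover have "2 ^ (w - u) * (2 ^ u * (d choose i)) = 2 ^ w * (d choose i)"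
      using uw by (simp add: power_add[symmetric] mult.assoc[symmetric])
    ultimately have "2 ^ v dvd 2 ^ w * (d choose i)" by simp
    thus "2 ^ v dvd 2 ^ w * (d choose i) * (x choose (j - i))" by (rule dvd_mult2)
  qed
  ultimately show ?thesis by (simp only: int_two_power_dvd)
qed

lemma theta_num_diff_dvd:
  assumes q: "q \<ge> 1" and v: "2 ^ v dvd (d::nat)" and w: "s * k < 2 ^ (w + 1)" and k: "k \<ge> 1"
  shows "2 ^ v dvd 2 ^ w * (int (theta_num k (q + d) s) - int (theta_num k q s))"
proof -
  define a0 b0 c0 where "a0 = int ((q - 1) choose s)" and "b0 = int ((q - 1 + k + s * k) choose (s * k))" and "c0 = int (q + (s + 1) * ((k - 1) div 2))"
  define a1 b1 c1 where "a1 = int ((q - 1 + d) choose s)" and "b1 = int ((q - 1 + k + s * k + d) choose (s * k))" and "c1 = int (q + d + (s + 1) * ((k - 1) div 2))"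
  have e: "q + d - 1 = q - 1 + d" "q - 1 + d + k + s * k = q - 1 + k + s * k + d" using q by auto
  have "s * 1 \<le> s * k" using k by (intro mult_le_mono2)
  hence sw: "s < 2 ^ (w + 1)" using w by linarith
  have A: "2 ^ v dvd 2 ^ w * (a1 - a0)" unfolding a1_def a0_def using v sw by (rule binomial_diff_dvd)
  have B: "2 ^ v dvd 2 ^ w * (b1 - b0)" unfolding b1_def b0_def using v w by (rule binomial_diff_dvd)
  have "2 ^ v dvd int d" using v by (simp only: int_two_power_dvd)
  hence C: "2 ^ v dvd 2 ^ w * (c1 - c0)" unfolding c1_def c0_def by (simp add: dvd_mult)
  have "2 ^ w * (a1 * b1 * c1 - a0 * b0 * c0) = (2 ^ w * (a1 - a0)) * (b1 * c1) + (2 ^ w * (b1 - b0)) * (a0 * c1) + (2 ^ w * (c1 - c0)) * (a0 * b0)"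
    by (simp add: algebra_simps)
  moreover have "2 ^ v dvd \<dots>" by (rule dvd_add[OF dvd_add[OF dvd_mult2[OF A] dvd_mult2[OF B]] dvd_mult2[OF C]])
  ultimately have "2 ^ v dvd 2 ^ w * (a1 * b1 * c1 - a0 * b0 * c0)" by simp
  moreover have "int (theta_num k (q + d) s) = a1 * b1 * c1" unfolding theta_num_def e a1_def b1_def c1_def by simp
  moreover have "int (theta_num k q s) = a0 * b0 * c0" unfolding theta_num_def a0_def b0_def c0_def by simp
  ultimately show ?thesis by simp
qed

lemma theta_term_diff_two_int:
  assumes k: "k \<ge> 5" "k mod 4 = 1" and s: "s \<ge> 1" and q: "q \<ge> 1" and v: "2 ^ v dvd (d::nat)"
  shows "two_int (v + 1) (theta_term k (q + d) s / 2 - theta_term k q s / 2)"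
proof -
  obtain w where w: "s * k < 2 ^ (w + 1)" "multiplicity 2 (theta_den k s) + w + 1 \<le> s * (k + 1)" using theta_den_lipschitz[OF k s] by blast
  have ok: "odd k" using k by presburger
  define y where "y = s * (k + 1)"
  have "(2::int) ^ y = 2 ^ (y - w) * 2 ^ w" using w(2) by (simp add: y_def power_add[symmetric])
  hence "(theta_term k (q + d) s / 2 - theta_term k q s / 2) * of_nat (theta_den k s) = of_int (2 ^ (y - w) * (2 ^ w * (int (theta_num k (q + d) s) - int (theta_num k q s))))"
    unfolding left_diff_distrib theta_term_half[OF ok] y_def[symmetric] by (simp add: algebra_simps)
  thus ?thesis
  proof (rule two_int_div)
    show "2 ^ v dvd 2 ^ w * (int (theta_num k (q + d) s) - int (theta_num k q s))" using k by (intro theta_num_diff_dvd[OF q v w(1)]) auto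
    show "multiplicity 2 (theta_den k s) + (v + 1) \<le> y - w + v" using w(2) unfolding y_def by linarith
  qed (rule theta_den_nonzero)
qed

lemma theta_term_half_0: "odd k \<Longrightarrow> theta_term k q 0 / 2 = of_int (int (q + (k - 1) div 2))"
  using theta_term_half[of k q 0] by (simp add: theta_den_def theta_num_def)

text \<open>All terms with \<open>s \<ge> 1\<close> have Lipschitz constant at most 1/2 in the 2-adic metric, so \<open>theta\<close> is an
  isometry in \<open>q\<close> and has at most one zero.\<close>

lemma theta_unique:
  assumes k: "k \<ge> 5" "k mod 4 = 1" and q: "q \<ge> 1" "d \<ge> 1" and n: "n \<ge> 1"
    and J: "two_int J (theta k q n)" "two_int J (theta k (q + d) n)"
  shows "2 ^ J \<le> d"
proof -
  define v where "v = multiplicity 2 d"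
  have vd: "2 ^ v dvd d" unfolding v_def by (rule multiplicity_dvd)
  have ok: "odd k" using k by presburger
  have n': "{..<n} = insert 0 {1..<n}" using n by auto
  have "theta k (q + d) n - theta k q n = (\<Sum>s<n. (-1) ^ s * (theta_term k (q + d) s / 2 - theta_term k q s / 2))"
    unfolding theta_def sum_subtractf[symmetric] right_diff_distrib ..
  also have "\<dots> = (theta_term k (q + d) 0 / 2 - theta_term k q 0 / 2) + (\<Sum>s=1..<n. (-1) ^ s * (theta_term k (q + d) s / 2 - theta_term k q s / 2))"
    unfolding n' by simp
  also have "theta_term k (q + d) 0 / 2 - theta_term k q 0 / 2 = of_int (int d)" unfolding theta_term_half_0[OF ok] by simp
  finally have eq: "theta k (q + d) n - theta k q n = of_int (int d) + (\<Sum>s=1..<n. (-1) ^ s * (theta_term k (q + d) s / 2 - theta_term k q s / 2))" .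
  have rest: "two_int (v + 1) (\<Sum>s=1..<n. (-1) ^ s * (theta_term k (q + d) s / 2 - theta_term k q s / 2))"
    using k q vd by (intro two_int_sum two_int_sign theta_term_diff_two_int) auto
  have "J \<le> v"
  proof (rule ccontr)
    assume "\<not> J \<le> v"
    hence "v + 1 \<le> J" by simp
    with two_int_diff[OF J(2,1)] have "two_int (v + 1) (theta k (q + d) n - theta k q n)" by (rule two_int_mono)
    hence "two_int (v + 1) (of_int (int d) :: rat)" using two_int_diff[OF _ rest] unfolding eq by fastforce
    hence "2 ^ (v + 1) dvd int d" by (rule two_int_of_intD)
    hence "2 ^ (v + 1) dvd d" by (simp only: int_two_power_dvd)
    hence "v + 1 \<le> multiplicity 2 d" using q by (intro multiplicity_geI) auto
    thus False unfolding v_def by simp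
  qed
  hence "(2::nat) ^ J \<le> 2 ^ v" by (intro power_increasing) auto
  also have "\<dots> \<le> d" unfolding v_def using q by (intro multiplicity_two_le)
  finally show ?thesis .
qed

lemma cubic_tail:
  assumes "y0 \<ge> 5" "2 ^ J * (2 * y0 ^ 3) \<le> (2::nat) ^ y0" "y \<ge> y0"
  shows "2 ^ J * (2 * y ^ 3) \<le> 2 ^ y"
  using assms(3)
proof (induction y rule: dec_induct)
  case (step y)
  have "5 * y \<le> y * y" using step.hyps assms(1) by (intro mult_le_mono1) simp
  have c: "Suc y ^ 3 = y * (y * y) + 3 * (y * y) + 3 * y + 1" by (simp add: power3_eq_cube algebra_simps)
  have "5 * (y * y) \<le> y * (y * y)" using step.hyps assms(1) by (intro mult_le_mono1) simp
  moreover have "y ^ 3 = y * (y * y)" by (simp add: power3_eq_cube)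
  moreover have "5 \<le> y" using step.hyps assms(1) by simp
  ultimately have "Suc y ^ 3 \<le> 2 * y ^ 3" using \<open>5 * y \<le> y * y\<close> c by linarith
  hence "2 ^ J * (2 * Suc y ^ 3) \<le> 2 ^ J * (2 * (2 * y ^ 3))" by (intro mult_le_mono2)
  also have "\<dots> = 2 * (2 ^ J * (2 * y ^ 3))" by simp
  also have "\<dots> \<le> 2 * 2 ^ y" using step.IH by (rule mult_le_mono2)
  finally show ?case by simp
qed (rule assms(2))

lemma theta_term_tail_two_int:
  assumes k: "k \<ge> 2" "odd k" and s: "s \<ge> s0" "s0 \<ge> 1" and y0: "s0 * (k + 1) \<ge> 5" "2 ^ J * (2 * (s0 * (k + 1)) ^ 3) \<le> (2::nat) ^ (s0 * (k + 1))"
  shows "two_int J (theta_term k q s / 2)"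
proof (rule theta_term_half_two_int[OF k(2)])
  have "2 ^ J * 2 ^ multiplicity 2 (theta_den k s) \<le> 2 ^ J * (2 * (s * (k + 1)) ^ 3)"
    using theta_den_crude[OF k(1), of s] s by (intro mult_le_mono2) auto
  also have "\<dots> \<le> 2 ^ (s * (k + 1))" using s by (intro cubic_tail[OF y0]) (intro mult_le_mono1)
  finally have "(2::nat) ^ (multiplicity 2 (theta_den k s) + J) \<le> 2 ^ (s * (k + 1))" by (simp add: power_add mult.commute)
  thus "multiplicity 2 (theta_den k s) + J \<le> s * (k + 1)" by (simp only: power_increasing_iff one_less_numeral_iff semiring_norm)
qed

text \<open>Terms from \<open>s0\<close> on are divisible by \<open>2 ^ J\<close>, so
  \<open>s0\<close> terms decide divisibility of any longer sum.\<close>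

lemma theta_tail:
  assumes k: "k \<ge> 2" "odd k" and s: "s0 \<ge> 1" "s0 \<le> n" and y0: "s0 * (k + 1) \<ge> 5" "2 ^ J * (2 * (s0 * (k + 1)) ^ 3) \<le> (2::nat) ^ (s0 * (k + 1))"
    and J: "two_int J (theta k q s0)"
  shows "two_int J (theta k q n)"
proof -
  have "{..<n} = {..<s0} \<union> {s0..<n}" using s by auto
  hence "theta k q n = theta k q s0 + (\<Sum>s=s0..<n. (-1) ^ s * (theta_term k q s / 2))"
    unfolding theta_def by (simp add: sum.union_disjoint ivl_disj_int)
  moreover have "two_int J (\<Sum>s=s0..<n. (-1) ^ s * (theta_term k q s / 2))"
    by (intro two_int_sum two_int_sign theta_term_tail_two_int[OF k _ s(1) y0]) simp
  ultimately show ?thesis using two_int_add[OF J] by simp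
qed

text \<open>For such \<open>k\<close> already the term \<open>s = 1\<close> is divisible by
  \<open>2 ^ (k div 2)\<close>, and hence so is the leading term
  \<open>q + (k - 1) div 2\<close>.\<close>

lemma theta_lower:
  assumes k: "k \<ge> 159" "k mod 4 = 1" and q: "q \<ge> 1" and J: "two_int (k div 2) (theta k q q)"
  shows "2 ^ (k div 2) \<le> q + k"
proof -
  have ok: "odd k" using k by presburger
  have q': "{..<q} = insert 0 {1..<q}" using q by auto
  have c: "2 ^ (k div 2) * (2 * (1 * (k + 1)) ^ 3) \<le> (2::nat) ^ (1 * (k + 1))"
  proof -
    define h where "h = k div 2"
    have h: "k + 1 = 2 * h + 2" "h \<ge> 79" unfolding h_def using ok k by presburger+
    have "(2 * h + 2) ^ 3 \<le> (3 * h) ^ 3" using h by (intro power_mono) auto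
    hence "2 * (2 * h + 2) ^ 3 \<le> 54 * h ^ 3" by (simp add: power_mult_distrib)
    also have "\<dots> \<le> (4 * h) * h ^ 3" using h by (intro mult_le_mono1) simp
    also have "\<dots> = 4 * h ^ 4" by (simp add: power3_eq_cube power4_eq_xxxx)
    also have "\<dots> \<le> 2 ^ h" using h by (intro quartic_le_two_power) simp
    finally have "2 ^ h * (2 * (2 * h + 2) ^ 3) \<le> 2 ^ h * 2 ^ h" by (rule mult_le_mono2)
    also have "\<dots> \<le> 2 ^ (2 * h + 2)" by (simp add: power_add[symmetric] mult_2[symmetric])
    finally show ?thesis unfolding h_def[symmetric] mult_1 h(1) .
  qed
  have "two_int (k div 2) (\<Sum>s=1..<q. (-1) ^ s * (theta_term k q s / 2))"
    using k by (intro two_int_sum two_int_sign theta_term_tail_two_int[OF _ ok _ _ _ c]) auto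
  moreover have "theta k q q = of_int (int (q + (k - 1) div 2)) + (\<Sum>s=1..<q. (-1) ^ s * (theta_term k q s / 2))"
    unfolding theta_def q' using theta_term_half_0[OF ok, of q] by simp
  ultimately have "two_int (k div 2) (of_int (int (q + (k - 1) div 2)) :: rat)" using two_int_diff[OF J] by fastforce
  hence "2 ^ (k div 2) dvd int (q + (k - 1) div 2)" by (rule two_int_of_intD)
  hence "2 ^ (k div 2) dvd q + (k - 1) div 2" by (simp only: int_two_power_dvd)
  hence "2 ^ (k div 2) \<le> q + (k - 1) div 2" using q by (intro dvd_imp_le) auto
  thus ?thesis by simp
qed

section \<open>Certified 2-adic digits of the zero of theta\<close>

definition ratio :: "nat \<Rightarrow> nat \<Rightarrow> nat \<Rightarrow> rat" where
  "ratio k q s = 2 ^ (k + 1) * of_int ((int q - 1 - int s) * pochhammer (int q + (int s + 1) * int k) k)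
     / of_int (pochhammer ((int s + 1) * int k + int s + 1) (k + 1))"

fun theta_horner :: "nat \<Rightarrow> nat \<Rightarrow> nat \<Rightarrow> nat \<Rightarrow> rat" where
  "theta_horner k q 0 s = 0"
| "theta_horner k q (Suc n) s =
     of_nat (q + (s + 1) * ((k - 1) div 2)) / of_nat (s + 1) - ratio k q s * theta_horner k q n (s + 1)"

text \<open>\<open>theta_term k q s / 2\<close> without the factor
  \<open>(q + (s + 1) * ((k - 1) div 2)) / (s + 1)\<close>. What remains has the consecutive
  quotients \<open>ratio\<close>, which makes a Horner scheme possible.\<close>

definition ecoef :: "nat \<Rightarrow> nat \<Rightarrow> nat \<Rightarrow> rat" where
  "ecoef k q s = 2 ^ (s * (k + 1)) * of_nat (((q - 1) choose s) * ((q - 1 + k + s * k) choose (s * k)))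
     / of_nat ((((s + 1) * k + s) choose (s * k)) * ((k + s) choose k))"

lemma theta_term_half_ecoef:
  assumes "odd k"
  shows "theta_term k q s / 2 = ecoef k q s * (of_nat (q + (s + 1) * ((k - 1) div 2)) / of_nat (s + 1))"
proof -
  have W: "of_nat (theta_den k s) \<noteq> (0::rat)" using theta_den_nonzero[of k s] by simp
  define A B C where "A = ((q - 1) choose s) * ((q - 1 + k + s * k) choose (s * k))"
    and "B = q + (s + 1) * ((k - 1) div 2)" and "C = (((s + 1) * k + s) choose (s * k)) * ((k + s) choose k)"
  have Wc: "theta_den k s = (s + 1) * C" unfolding theta_den_def C_def by simp
  have N: "theta_num k q s = A * B" unfolding theta_num_def A_def B_def by simp
  have C0: "of_nat C \<noteq> (0::rat)" using W unfolding Wc by (metis mult_zero_right of_nat_0 of_nat_mult)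
  have "theta_term k q s / 2 = 2 ^ (s * (k + 1)) * of_nat (A * B) / of_nat ((s + 1) * C)"
    using theta_term_half[OF assms, of q s] W unfolding Wc N by (simp add: eq_divide_eq)
  also have "\<dots> = 2 ^ (s * (k + 1)) * of_nat A / of_nat C * (of_nat B / of_nat (s + 1))"
    unfolding of_nat_mult times_divide_times_eq by (simp only: mult_ac)
  finally show ?thesis unfolding ecoef_def A_def B_def C_def .
qed

lemma fact_pochhammer: "fact (a + n) = fact a * pochhammer (of_nat a + 1 :: 'a::{comm_semiring_1,semiring_char_0}) n"
proof (induction n)
  case (Suc n)
  have "fact (a + Suc n) = (of_nat a + 1 + of_nat n) * (fact (a + n) :: 'a)" by (simp add: algebra_simps)
  thus ?case unfolding Suc by (simp add: pochhammer_Suc algebra_simps)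
qed simp

lemma ecoef_fact:
  assumes s: "s < q"
  shows "ecoef k q s * (fact (q - 1 - s) * fact (q - 1 + k) * fact ((s + 1) * k + s))
    = 2 ^ (s * (k + 1)) * (fact (q - 1) * fact (q - 1 + k + s * k) * fact k)"
proof -
  have b1: "(of_nat ((q - 1) choose s) :: rat) = fact (q - 1) / (fact s * fact (q - 1 - s))"
    using s by (intro binomial_fact) auto
  have b2: "(of_nat ((q - 1 + k + s * k) choose (s * k)) :: rat) = fact (q - 1 + k + s * k) / (fact (s * k) * fact (q - 1 + k))"
    using binomial_fact[of "s * k" "q - 1 + k + s * k", where 'a = rat] by simp
  have b3: "(of_nat (((s + 1) * k + s) choose (s * k)) :: rat) = fact ((s + 1) * k + s) / (fact (s * k) * fact (k + s))"
    using binomial_fact[of "s * k" "(s + 1) * k + s", where 'a = rat] by simp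
  have b4: "(of_nat ((k + s) choose k) :: rat) = fact (k + s) / (fact k * fact s)"
    using binomial_fact[of k "k + s", where 'a = rat] by simp
  show ?thesis unfolding ecoef_def of_nat_mult b1 b2 b3 b4 by simp
qed

lemma ecoef_0: "k \<ge> 1 \<Longrightarrow> ecoef k q 0 = 1"
  unfolding ecoef_def by simp

lemma ecoef_Suc:
  assumes s: "Suc s < q"
  shows "ecoef k q (Suc s) = ratio k q s * ecoef k q s"
proof -
  define f1 f2 f3 f4 f5 f6 :: rat where "f1 = fact (q - 1 - s)" and "f2 = fact (q - 1 + k)" and "f3 = fact ((s + 1) * k + s)"
    and "f4 = fact (q - 1)" and "f5 = fact (q - 1 + k + s * k)" and "f6 = fact k"
  define P D d :: rat where "P = pochhammer (of_nat q + (of_nat s + 1) * of_nat k) k"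
    and "D = pochhammer ((of_nat s + 1) * of_nat k + of_nat s + 1) (k + 1)" and "d = of_nat q - 1 - of_nat s"
  define g1 where "g1 = (fact (q - 1 - Suc s) :: rat)"
  have "q - 1 - s = Suc (q - 1 - Suc s)" using s by simp
  hence g1: "f1 = d * g1" unfolding f1_def g1_def d_def using s by (simp add: of_nat_diff)
  have e3: "(Suc s + 1) * k + Suc s = (s + 1) * k + s + (k + 1)" by simp
  have g3: "(fact ((Suc s + 1) * k + Suc s) :: rat) = f3 * D" unfolding e3 f3_def D_def fact_pochhammer[of "(s + 1) * k + s" "k + 1"]
    by (simp add: algebra_simps)
  have e5: "q - 1 + k + Suc s * k = q - 1 + k + s * k + k" by simp
  have "(of_nat (q - 1 + k + s * k) + 1 :: rat) = of_nat q + (of_nat s + 1) * of_nat k" using s by (simp add: of_nat_diff algebra_simps)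
  hence g5: "(fact (q - 1 + k + Suc s * k) :: rat) = f5 * P" unfolding e5 f5_def P_def fact_pochhammer[of "q - 1 + k + s * k" k] by simp
  have D: "D > 0" unfolding D_def by (intro pochhammer_pos add_nonneg_pos) auto
  have pos: "f1 > 0" "f2 > 0" "f3 > 0" "g1 > 0" unfolding f1_def f2_def f3_def g1_def by simp_all
  have E0: "ecoef k q s * (f1 * f2 * f3) = 2 ^ (s * (k + 1)) * (f4 * f5 * f6)"
    using ecoef_fact[of s q k] s unfolding f1_def f2_def f3_def f4_def f5_def f6_def by simp
  have E1: "ecoef k q (Suc s) * (g1 * f2 * (f3 * D)) = 2 ^ (Suc s * (k + 1)) * (f4 * (f5 * P) * f6)"
    using ecoef_fact[OF s, of k] unfolding g3 g5 f2_def g1_def f4_def f6_def by simp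
  have "ratio k q s = 2 ^ (k + 1) * (d * P) / D"
    unfolding ratio_def P_def D_def d_def by (simp add: pochhammer_of_int[symmetric])
  hence R: "ratio k q s * D = 2 ^ (k + 1) * (d * P)" using D by simp
  have "ecoef k q (Suc s) * (g1 * f2 * (f3 * D)) = 2 ^ (k + 1) * P * (2 ^ (s * (k + 1)) * (f4 * f5 * f6))"
    unfolding E1 by (simp add: power_add)
  also have "\<dots> = (2 ^ (k + 1) * (d * P)) * (ecoef k q s * (g1 * f2 * f3))" unfolding E0[symmetric] g1 by simp
  also have "\<dots> = ratio k q s * ecoef k q s * (g1 * f2 * (f3 * D))" unfolding R[symmetric] by simp
  finally show ?thesis using pos D by simp
qed

lemma theta_horner_ecoef:
  assumes "odd k" and "s + n \<le> q"
  shows "ecoef k q s * theta_horner k q n s = (\<Sum>j<n. (-1) ^ j * (theta_term k q (s + j) / 2))"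
  using assms(2)
proof (induction n arbitrary: s)
  case (Suc n)
  have "ecoef k q s * (ratio k q s * theta_horner k q n (s + 1)) = (\<Sum>j<n. (-1) ^ j * (theta_term k q (s + 1 + j) / 2))"
  \<comment> \<open>For an empty tail \<open>s + 1\<close> may equal \<open>q\<close>, where
    \<open>ecoef_Suc\<close> does not apply.\<close>
  proof (cases "n = 0")
    case False
    hence "ecoef k q s * (ratio k q s * theta_horner k q n (s + 1)) = ecoef k q (s + 1) * theta_horner k q n (s + 1)"
      using ecoef_Suc[of s q k] Suc.prems by (simp del: theta_horner.simps mult_cancel_right)
    also have "\<dots> = (\<Sum>j<n. (-1) ^ j * (theta_term k q (s + 1 + j) / 2))" using Suc.prems by (intro Suc.IH) simp
    finally show ?thesis .
  qed simp
  hence "ecoef k q s * theta_horner k q (Suc n) s = theta_term k q s / 2 - (\<Sum>j<n. (-1) ^ j * (theta_term k q (s + 1 + j) / 2))"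
    unfolding theta_term_half_ecoef[OF assms(1), of q s] by (simp add: algebra_simps)
  also have "\<dots> = (\<Sum>j<Suc n. (-1) ^ j * (theta_term k q (s + j) / 2))"
    unfolding sum.lessThan_Suc_shift by (simp add: sum_negf[symmetric])
  finally show ?case .
qed simp

lemma theta_eq_horner:
  assumes "odd k" and "n \<le> q"
  shows "theta k q n = theta_horner k q n 0"
proof -
  have "k \<ge> 1" using assms(1) by (cases k) auto
  thus ?thesis using theta_horner_ecoef[of k 0 n q] assms ecoef_0[of k q] unfolding theta_def by simp
qed

section \<open>Evaluation of the Horner scheme modulo powers of 2\<close>

fun prod_exact :: "nat \<Rightarrow> int \<Rightarrow> int \<Rightarrow> int" where
  "prod_exact 0 a x = x"
| "prod_exact (Suc n) a x = prod_exact n (a + 1) (x * a)"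

text \<open>With \<open>b = 2 ^ M - 1\<close>, the bitwise \<open>and\<close> reduces each partial
  product modulo \<open>2 ^ M\<close> and keeps the numbers short.\<close>

fun prod_mask :: "nat \<Rightarrow> int \<Rightarrow> int \<Rightarrow> int \<Rightarrow> int" where
  "prod_mask 0 a b x = x"
| "prod_mask (Suc n) a b x = prod_mask n (a + 1) b (and (x * a) b)"

lemma prod_exact_eq: "prod_exact n a x = x * pochhammer a n"
  by (induction n arbitrary: a x) (simp_all add: pochhammer_rec mult.assoc)

lemma and_mask_dvd: "2 ^ M dvd and x (2 ^ M - 1) - (x::int)"
proof -
  have "and x (2 ^ M - 1) = x mod 2 ^ M" by (simp add: take_bit_eq_mod[symmetric] take_bit_eq_mask mask_eq_exp_minus_1)
  thus ?thesis by (simp add: mod_eq_dvd_iff[symmetric])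
qed

lemma prod_mask_dvd:
  assumes "2 ^ M dvd a - a'"
  shows "2 ^ M dvd prod_mask n a (2 ^ M - 1) x - x * pochhammer a' n"
  using assms
proof (induction n arbitrary: a a' x)
  case (Suc n)
  define y where "y = and (x * a) (2 ^ M - 1)"
  have 1: "2 ^ M dvd prod_mask n (a + 1) (2 ^ M - 1) y - y * pochhammer (a' + 1) n" by (rule Suc.IH) (use Suc.prems in simp)
  have 2: "2 ^ M dvd (y - x * a) * pochhammer (a' + 1) n" unfolding y_def by (intro dvd_mult2 and_mask_dvd)
  have 3: "2 ^ M dvd (a - a') * (x * pochhammer (a' + 1) n)" using Suc.prems by (intro dvd_mult2)
  have "prod_mask (Suc n) a (2 ^ M - 1) x - x * pochhammer a' (Suc n)
     = (prod_mask n (a + 1) (2 ^ M - 1) y - y * pochhammer (a' + 1) n) + (y - x * a) * pochhammer (a' + 1) n + (a - a') * (x * pochhammer (a' + 1) n)"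
    unfolding y_def by (simp add: pochhammer_rec algebra_simps)
  thus ?case using dvd_add[OF dvd_add[OF 1 2] 3] by simp
qed simp

text \<open>\<open>V\<close> and \<open>U\<close> are residues of a denominator and a numerator of \<open>2 ^ w\<close> times the Horner tail.\<close>

definition horner_inv :: "nat \<Rightarrow> nat \<Rightarrow> nat \<Rightarrow> nat \<Rightarrow> nat \<Rightarrow> nat \<Rightarrow> nat \<Rightarrow> int \<Rightarrow> int \<Rightarrow> bool" where
  "horner_inv k q J n s w M V U \<longleftrightarrow> (\<exists>a b. of_int a = 2 ^ w * theta_horner k q n s * of_int b \<and> odd b \<and> 2 ^ J dvd b - V \<and> 2 ^ M dvd a - U)"

text \<open>The Horner recursion multiplied by \<open>2 ^ w * os * dd * b'\<close>. The ratio is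
  \<open>2 ^ (k + 1 + e)\<close> over \<open>2 ^ dl\<close>, times an odd denominator's inverse and
  an integer; the equation \<open>dl + w' + z = w + k + 1 + e\<close> says that exactly
  \<open>2 ^ z\<close> is left in front of the scaled tail, so \<open>M'\<close> known bits of it
  yield up to \<open>z + M'\<close> bits.\<close>

lemma horner_inv_step:
  assumes inv: "horner_inv k q J n (s + 1) w' M' V' U'"
    and D: "pochhammer ((int s + 1) * int k + int s + 1) (k + 1) = 2 ^ dl * dd" "odd dd"
    and o: "int s + 1 = 2 ^ vs * os" "odd os"
    and w: "vs \<le> w" "dl + w' + z = w + k + 1 + e" and M: "M \<le> z + M'" "M \<le> J"
    and V: "2 ^ J dvd V - os * dd * V'"
    and Q: "2 ^ (M - z + e) dvd 2 ^ e * Q - (int q - 1 - int s) * pochhammer (int q + (int s + 1) * int k) k"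
    and U: "2 ^ M dvd U - (2 ^ (w - vs) * (int q + (int s + 1) * ((int k - 1) div 2)) * dd * V' - 2 ^ z * (os * Q * U'))"
    and k: "k \<ge> 1"
  shows "horner_inv k q J (Suc n) s w M V U"
proof -
  obtain a' b' where ab: "of_int a' = 2 ^ w' * theta_horner k q n (s + 1) * of_int b'" "odd b'" "2 ^ J dvd b' - V'" "2 ^ M' dvd a' - U'"
    using inv unfolding horner_inv_def by blast
  define c where "c = int q + (int s + 1) * ((int k - 1) div 2)"
  have "(2::int) ^ e dvd 2 ^ (M - z + e)" by (rule le_imp_power_dvd) simp
  hence "2 ^ e dvd 2 ^ e * Q - (int q - 1 - int s) * pochhammer (int q + (int s + 1) * int k) k" using Q by (rule dvd_trans)
  hence "2 ^ e dvd (int q - 1 - int s) * pochhammer (int q + (int s + 1) * int k) k" by (simp add: dvd_diff_right_iff)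
  then obtain P where P: "(int q - 1 - int s) * pochhammer (int q + (int s + 1) * int k) k = 2 ^ e * P" by (rule dvdE)
  have "2 ^ e * 2 ^ (M - z) dvd 2 ^ e * (Q - P)" using Q unfolding P by (simp add: power_add algebra_simps)
  hence QP: "2 ^ (M - z) dvd Q - P" by simp
  define a where "a = 2 ^ (w - vs) * c * dd * b' - 2 ^ z * os * P * a'"
  define b where "b = os * dd * b'"
  define T where "T = theta_horner k q n (s + 1)"
  have c': "(of_nat (q + (s + 1) * ((k - 1) div 2)) :: rat) = of_int c"
  proof -
    have "int (q + (s + 1) * ((k - 1) div 2)) = c" unfolding c_def using k by (simp add: of_nat_diff zdiv_int algebra_simps)
    thus ?thesis by (metis of_int_of_nat_eq)
  qed
  have s1: "(of_nat (s + 1) :: rat) = 2 ^ vs * of_int os"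
  proof -
    have "(of_int (int s + 1) :: rat) = of_int (2 ^ vs * os)" unfolding o(1) ..
    thus ?thesis by (simp add: add.commute)
  qed
  have nz: "of_int os \<noteq> (0::rat)" "of_int dd \<noteq> (0::rat)" using o(2) D(2) by auto
  have dd0: "dd \<noteq> 0" using D(2) by auto
  have rt: "ratio k q s = 2 ^ (k + 1) * (2 ^ e * of_int P) / (2 ^ dl * of_int dd)"
    unfolding ratio_def D(1) P by simp
  have "of_int b * (2 ^ w * theta_horner k q (Suc n) s) =
      2 ^ w * of_int b * (of_int c / (2 ^ vs * of_int os)) - 2 ^ w * of_int b * (2 ^ (k + 1) * (2 ^ e * of_int P) / (2 ^ dl * of_int dd)) * T"
    unfolding theta_horner.simps c' s1 rt T_def by (simp add: algebra_simps)
  also have "2 ^ w * of_int b * (of_int c / (2 ^ vs * of_int os)) = (of_int (2 ^ (w - vs) * c * dd * b') :: rat)"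
  proof -
    have "(2::rat) ^ w = 2 ^ (w - vs) * 2 ^ vs" using w(1) by (simp add: power_add[symmetric])
    thus ?thesis unfolding b_def using nz by simp
  qed
  also have "2 ^ w * of_int b * (2 ^ (k + 1) * (2 ^ e * of_int P) / (2 ^ dl * of_int dd)) * T = of_int (2 ^ z * os * P * a')"
  proof -
    have "(2::rat) ^ w * 2 ^ (k + 1) * 2 ^ e = 2 ^ dl * 2 ^ w' * 2 ^ z" using w(2) by (simp add: power_add[symmetric] add.assoc)
    hence "2 ^ w * of_int b * (2 ^ (k + 1) * (2 ^ e * of_int P) / (2 ^ dl * of_int dd)) * T
       = (2 ^ dl * 2 ^ w' * 2 ^ z) * of_int b * of_int P / (2 ^ dl * of_int dd) * T" by (simp add: field_simps)
    also have "\<dots> = 2 ^ z * of_int os * of_int P * (2 ^ w' * T * of_int b')" unfolding b_def using nz by simp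
    finally show ?thesis unfolding ab(1)[symmetric, folded T_def] by simp
  qed
  finally have A: "of_int a = 2 ^ w * theta_horner k q (Suc n) s * of_int b" unfolding a_def by (simp add: mult_ac)
  have B: "2 ^ J dvd b - V"
  proof -
    have "2 ^ J dvd os * dd * (b' - V') - (V - os * dd * V')" by (rule dvd_diff[OF dvd_mult[OF ab(3)] V])
    thus ?thesis unfolding b_def by (simp add: algebra_simps)
  qed
  have C: "2 ^ M dvd a - U"
  proof -
    have MJ: "(2::int) ^ M dvd 2 ^ J" using M(2) by (rule le_imp_power_dvd)
    have 1: "2 ^ M dvd 2 ^ (w - vs) * c * dd * (b' - V')" using dvd_trans[OF MJ ab(3)] by (rule dvd_mult)
    have "(2::int) ^ M dvd 2 ^ (z + M')" using M(1) by (rule le_imp_power_dvd)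
    moreover have "2 ^ (z + M') dvd 2 ^ z * (a' - U')" using ab(4) by (simp add: power_add)
    ultimately have "2 ^ M dvd 2 ^ z * (a' - U')" by (rule dvd_trans)
    hence 2: "2 ^ M dvd 2 ^ z * (a' - U') * (os * P)" by (rule dvd_mult2)
    have "(2::int) ^ M dvd 2 ^ (z + (M - z))" by (rule le_imp_power_dvd) simp
    moreover have "2 ^ (z + (M - z)) dvd 2 ^ z * ((Q - P) * (os * U'))" using dvd_mult2[OF QP, of "os * U'"] by (simp add: power_add)
    ultimately have 3: "2 ^ M dvd 2 ^ z * ((Q - P) * (os * U'))" by (rule dvd_trans)
    have "a - U = 2 ^ (w - vs) * c * dd * (b' - V') - 2 ^ z * (a' - U') * (os * P) + 2 ^ z * ((Q - P) * (os * U'))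
       - (U - (2 ^ (w - vs) * c * dd * V' - 2 ^ z * (os * Q * U')))" unfolding a_def by (simp add: algebra_simps)
    moreover have "2 ^ M dvd \<dots>" by (rule dvd_diff[OF dvd_add[OF dvd_diff[OF 1 2] 3] U[folded c_def]])
    ultimately show ?thesis by (simp only:)
  qed
  have "odd b" unfolding b_def using o D ab(2) by simp
  thus ?thesis unfolding horner_inv_def using A B C by blast
qed

text \<open>A row \<open>(dl, vs, os, e, w, z, M)\<close> for the index \<open>t = s + 1\<close> records the 2-adic valuations \<open>dl\<close> and \<open>e\<close> of
  the denominator and the numerator of \<open>ratio\<close>, the factorization \<open>t = 2 ^ vs * os\<close>, the scaling exponent \<open>w\<close>, the power
  \<open>2 ^ z\<close> multiplying the next tail, and the precision \<open>M\<close>. Rows are listed from the last term to the first.\<close>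

type_synonym row = "nat \<times> nat \<times> int \<times> nat \<times> nat \<times> nat \<times> nat"

definition row_ok :: "nat \<Rightarrow> nat \<Rightarrow> int \<Rightarrow> row \<Rightarrow> nat \<Rightarrow> nat \<Rightarrow> int \<Rightarrow> int \<Rightarrow> int \<Rightarrow> int \<Rightarrow> bool" where
  "row_ok k J t r w' M' D dd X Q = (case r of (dl, vs, os, e, w, z, M) \<Rightarrow>
     D = 2 ^ dl * dd \<and> and dd 1 = 1 \<and> t = 2 ^ vs * os \<and> and os 1 = 1 \<and> X = 2 ^ e * Q \<and>
     vs \<le> w \<and> dl + w' + z = w + k + 1 + e \<and> M \<le> z + M' \<and> M \<le> J)"

definition row_prod :: "nat \<Rightarrow> int \<Rightarrow> int \<Rightarrow> row \<Rightarrow> int" where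
  "row_prod k q t r = (case r of (dl, vs, os, e, w, z, M) \<Rightarrow>
     prod_mask k (and (q + t * int k) (2 ^ (M - z + e) - 1)) (2 ^ (M - z + e) - 1) (q - t))"

definition new_V :: "int \<Rightarrow> row \<Rightarrow> int \<Rightarrow> int \<Rightarrow> int" where
  "new_V bJ r dd V' = (case r of (dl, vs, os, e, w, z, M) \<Rightarrow> and (os * dd * V') bJ)"

definition new_U :: "nat \<Rightarrow> int \<Rightarrow> int \<Rightarrow> row \<Rightarrow> int \<Rightarrow> int \<Rightarrow> int \<Rightarrow> int \<Rightarrow> int" where
  "new_U k q t r dd Q V' U' = (case r of (dl, vs, os, e, w, z, M) \<Rightarrow>
     and (2 ^ (w - vs) * (q + t * ((int k - 1) div 2)) * dd * V' - 2 ^ z * (os * Q * U')) (2 ^ M - 1))"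

text \<open>The step is split into functions of their intermediate results because rewriting normalizes
  arguments before unfolding, so that each product is computed only once.\<close>

definition horner_step :: "nat \<Rightarrow> int \<Rightarrow> nat \<Rightarrow> int \<Rightarrow> int \<Rightarrow> row \<Rightarrow> nat \<Rightarrow> nat \<Rightarrow> int \<Rightarrow> int \<Rightarrow>
    (nat \<Rightarrow> nat \<Rightarrow> int \<Rightarrow> int \<Rightarrow> bool) \<Rightarrow> int \<Rightarrow> int \<Rightarrow> int \<Rightarrow> int \<Rightarrow> bool" where
  "horner_step k q J bJ t r w M V U cont D X dd Q \<longleftrightarrow> row_ok k J t r w M D dd X Q \<and>
     cont (fst (snd (snd (snd (snd r))))) (snd (snd (snd (snd (snd (snd r)))))) (new_V bJ r dd V) (new_U k q t r dd Q V U)"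

definition horner_div :: "nat \<Rightarrow> int \<Rightarrow> nat \<Rightarrow> int \<Rightarrow> int \<Rightarrow> row \<Rightarrow> nat \<Rightarrow> nat \<Rightarrow> int \<Rightarrow> int \<Rightarrow>
    (nat \<Rightarrow> nat \<Rightarrow> int \<Rightarrow> int \<Rightarrow> bool) \<Rightarrow> int \<Rightarrow> int \<Rightarrow> bool" where
  "horner_div k q J bJ t r w M V U cont D X =
     horner_step k q J bJ t r w M V U cont D X (D div 2 ^ fst r) (X div 2 ^ fst (snd (snd (snd r))))"

primrec horner_check :: "nat \<Rightarrow> int \<Rightarrow> nat \<Rightarrow> int \<Rightarrow> row list \<Rightarrow> int \<Rightarrow> nat \<Rightarrow> nat \<Rightarrow> int \<Rightarrow> int \<Rightarrow> bool" where
  "horner_check k q J bJ [] t w M V U \<longleftrightarrow> t = 0 \<and> w = 0 \<and> M = J \<and> U = 0"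
| "horner_check k q J bJ (r # rs) t w M V U \<longleftrightarrow>
     horner_div k q J bJ t r w M V U (horner_check k q J bJ rs (t - 1)) (prod_exact (k + 1) (t * int k + t) 1) (row_prod k q t r)"

lemma and_1_odd: "and x (1::int) = 1 \<Longrightarrow> odd x"
  by (auto simp: and_one_eq)

lemma horner_check_sound:
  assumes "horner_check k (int q) J (2 ^ J - 1) rs (int (length rs)) w M V U"
    and "horner_inv k q J n (length rs) w M V U" and k: "k \<ge> 1"
  shows "two_int J (theta_horner k q (length rs + n) 0)"
  using assms(1,2)
proof (induction rs arbitrary: n w M V U)
  case Nil
  hence "w = 0" "M = J" "U = 0" by auto
  hence "\<exists>a b. of_int a = theta_horner k q n 0 * of_int b \<and> odd b \<and> 2 ^ J dvd a" using Nil(2) by (auto simp: horner_inv_def)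
  then obtain a b where "of_int a = theta_horner k q n 0 * of_int b" "odd b" "2 ^ J dvd a" by blast
  thus ?case unfolding two_int_def by (auto elim!: dvdE) metis
next
  case (Cons r rs)
  obtain dl vs os e w2 z M2 where r: "r = (dl, vs, os, e, w2, z, M2)" by (cases r) auto
  define t where "t = int (length (r # rs))"
  define s where "s = length rs"
  have t: "t = int s + 1" "length (r # rs) = s + 1" unfolding t_def s_def by simp_all
  define D where "D = prod_exact (k + 1) (t * int k + t) 1"
  define X where "X = row_prod k (int q) t r"
  define dd Q where "dd = D div 2 ^ dl" and "Q = X div 2 ^ e"
  define V2 U2 where "V2 = new_V (2 ^ J - 1) r dd V" and "U2 = new_U k (int q) t r dd Q V U"
  have "row_ok k J t r w M D dd X Q \<and> horner_check k (int q) J (2 ^ J - 1) rs (t - 1) w2 M2 V2 U2"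
    using Cons.prems(1) unfolding t_def[symmetric] horner_check.simps(2) D_def[symmetric] X_def[symmetric]
      horner_div_def horner_step_def V2_def U2_def dd_def Q_def by (simp add: r)
  hence ok: "row_ok k J t r w M D dd X Q" and rest: "horner_check k (int q) J (2 ^ J - 1) rs (int (length rs)) w2 M2 V2 U2"
    by (simp_all add: t_def)
  have "horner_inv k q J (Suc n) s w2 M2 V2 U2"
  proof (rule horner_inv_step[where dd = dd and Q = Q and e = e])
    show "horner_inv k q J n (s + 1) w M V U" using Cons.prems(2) unfolding t(2) .
    have "D = pochhammer ((int s + 1) * int k + int s + 1) (k + 1)" unfolding D_def prod_exact_eq t by (simp add: add.assoc)
    thus "pochhammer ((int s + 1) * int k + int s + 1) (k + 1) = 2 ^ dl * dd" using ok unfolding row_ok_def r by simp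
    show "odd dd" "int s + 1 = 2 ^ vs * os" "odd os" "vs \<le> w2" "dl + w + z = w2 + k + 1 + e" "M2 \<le> z + M" "M2 \<le> J"
      using ok unfolding row_ok_def r t(1) by (auto dest: and_1_odd)
    show "2 ^ J dvd V2 - os * dd * V" unfolding V2_def new_V_def r by (simp add: and_mask_dvd)
    have e: "int q - t = int q - 1 - int s" unfolding t by simp
    have X: "X = 2 ^ e * Q" using ok unfolding row_ok_def r by simp
    show "2 ^ (M2 - z + e) dvd 2 ^ e * Q - (int q - 1 - int s) * pochhammer (int q + (int s + 1) * int k) k"
      unfolding X[symmetric] X_def row_prod_def r prod.case e t(1)[symmetric] by (intro prod_mask_dvd and_mask_dvd)
    show "2 ^ M2 dvd U2 - (2 ^ (w2 - vs) * (int q + (int s + 1) * ((int k - 1) div 2)) * dd * V - 2 ^ z * (os * Q * U))"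
      unfolding U2_def new_U_def t(1)[symmetric] r prod.case by (rule and_mask_dvd)
  qed (rule k)
  from Cons.IH[OF rest this[unfolded s_def]] show ?case by simp
qed

lemma theta_two_int_of_check:
  assumes "horner_check k (int q) J (2 ^ J - 1) rs (int n) 0 0 1 0" "length rs = n" and k: "odd k" and q: "n \<le> q"
  shows "two_int J (theta k q n)"
proof -
  have "k \<ge> 1" using k by (cases k) auto
  \<comment> \<open>The evaluation starts from the empty tail, the fraction
    \<open>0 / 1\<close>.\<close>
  moreover have "horner_inv k q J 0 n 0 0 1 0" unfolding horner_inv_def by (intro exI[of _ 0] exI[of _ 1]) simp
  ultimately have "two_int J (theta_horner k q (n + 0) 0)" using horner_check_sound[of k q J rs 0 0 1 0 0] assms(1,2) by simp
  thus ?thesis using theta_eq_horner[OF k q] by simp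
qed

text \<open>\<open>R\<close> is the zero of \<open>theta\<close> modulo \<open>2 ^ J\<close>. It exceeds every \<open>q\<close> with \<open>(k + 1) q < 2 ^ N\<close>, and the
  Archimedean bound excludes \<open>n \<ge> 2 ^ N\<close>.\<close>

definition cert :: "nat \<Rightarrow> int \<Rightarrow> nat \<Rightarrow> nat \<Rightarrow> row list \<Rightarrow> bool" where
  "cert k R J N rs \<longleftrightarrow> k \<ge> 5 \<and> k mod 4 = 1 \<and> rs \<noteq> [] \<and> int (length rs) \<le> R \<and> R < 2 ^ J \<and> 2 ^ N \<le> (int k + 1) * R \<and>
     2 ^ J * (2 * (int (length rs) * (int k + 1)) ^ 3) \<le> (2::int) ^ (length rs * (k + 1)) \<and>
     10 \<le> N \<and> N \<le> 200 \<and> J \<le> 200 \<and> 290 * (3145728 * int k ^ 4) ^ 3 * int (N + 1) ^ 6 \<le> 2 ^ (N + 1) \<and>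
     horner_check k R J (2 ^ J - 1) rs (int (length rs)) 0 0 1 0"

text \<open>If \<open>q < R\<close>, then \<open>theta\<close> vanishes modulo \<open>2 ^ J\<close>
  at both \<open>q\<close> and \<open>R\<close>. Uniqueness of the zero forces
  \<open>2 ^ J <= R - q\<close>, contrary to \<open>R < 2 ^ J\<close>.\<close>

lemma cert_no_solution:
  assumes c: "cert k R J N rs" and q: "q \<ge> 1" "even q" and m: "2 ^ m dvd gen_fib k (int ((k + 1) * q + 1)) - 1"
    and small: "(k + 1) * q + 1 < 2 ^ N" and mbig: "J + 1 + k + N \<le> m"
  shows False
proof -
  have c': "k \<ge> 5" "k mod 4 = 1" "rs \<noteq> []" "int (length rs) \<le> R" "R < 2 ^ J" "2 ^ N \<le> (int k + 1) * R"
     "2 ^ J * (2 * (int (length rs) * (int k + 1)) ^ 3) \<le> (2::int) ^ (length rs * (k + 1))"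
     "horner_check k R J (2 ^ J - 1) rs (int (length rs)) 0 0 1 0"
    using c unfolding cert_def by auto
  define r where "r = nat R"
  have R: "R = int r" using c'(4) unfolding r_def by simp
  have odd: "odd k" using c'(2) by presburger
  have lr: "length rs \<le> r" using c'(4) R by simp
  have "int (2 ^ N) \<le> int ((k + 1) * r)" using c'(6) unfolding R by (simp add: algebra_simps)
  hence "2 ^ N \<le> (k + 1) * r" by (simp only: of_nat_le_iff)
  hence "(k + 1) * q < (k + 1) * r" using small by linarith
  hence qr: "q < r" by (simp only: mult_less_cancel1)
  have "int r < int (2 ^ J)" using c'(5) unfolding R by simp
  hence rJ: "r < 2 ^ J" by (simp only: of_nat_less_iff)
  have "k \<le> q * k" "(k + 1) * q = q * k + q" using q by (simp_all add: algebra_simps)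
  hence "q - 1 + k \<le> 2 ^ N" using small by linarith
  hence "2 ^ (J + 1 + k) * (q - 1 + k) \<le> 2 ^ (J + 1 + k) * (2 ^ N :: nat)" by (rule mult_le_mono2)
  also have "\<dots> = 2 ^ (J + 1 + k + N)" by (rule power_add[symmetric])
  also have "\<dots> \<le> 2 ^ m" using mbig by (intro power_increasing) auto
  finally have "two_int J (theta k q q)" using c'(1) by (intro theta_two_int[OF _ q m]) auto
  hence 1: "two_int J (theta k q r)" using theta_extend[of q r k] q qr by simp
  have rs: "length rs \<ge> 1" using c'(3) by (simp add: Suc_le_eq)
  have "5 \<le> 1 * (k + 1)" using c'(1) by simp
  also have "\<dots> \<le> length rs * (k + 1)" using rs by (rule mult_le_mono1)
  finally have len: "length rs * (k + 1) \<ge> 5" .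
  have "int (2 ^ J * (2 * (length rs * (k + 1)) ^ 3)) \<le> int (2 ^ (length rs * (k + 1)))" using c'(7) by (simp add: algebra_simps)
  hence len2: "2 ^ J * (2 * (length rs * (k + 1)) ^ 3) \<le> (2::nat) ^ (length rs * (k + 1))" by (simp only: of_nat_le_iff)
  have "two_int J (theta k r (length rs))" by (rule theta_two_int_of_check[OF c'(8)[unfolded R] refl odd lr])
  hence "two_int J (theta k r r)" using c'(1) by (intro theta_tail[OF _ odd rs lr len len2]) auto
  hence 2: "two_int J (theta k (q + (r - q)) r)" using qr by simp
  have "2 ^ J \<le> r - q" using qr by (intro theta_unique[OF c'(1,2) q(1) _ _ 1 2]) auto
  thus False using rJ by simp
qed

section \<open>Certificates\<close>

lemma cert_5: "cert 5 2030792354611485314560166088400798851723022 141 143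
    [(6, 2, 7, 5, 2, 7, 0), (4, 0, 27, 4, 0, 4, 0), (8, 1, 13, 9, 1, 8, 0), (5, 0, 25, 3, 0, 3, 0), (7, 3, 3, 6, 3, 8, 2), (4, 0, 23, 3, 0, 2, 4),
     (6, 1, 11, 13, 1, 14, 18), (9, 0, 21, 4, 0, 0, 18), (6, 2, 5, 5, 2, 7, 25), (4, 0, 19, 5, 0, 5, 30), (7, 1, 9, 8, 1, 8, 38), (5, 0, 17, 3, 0, 3, 41),
     (8, 4, 1, 8, 4, 10, 51), (4, 0, 15, 3, 0, 1, 52), (6, 1, 7, 14, 1, 15, 67), (6, 0, 13, 5, 0, 4, 71), (6, 2, 3, 5, 2, 7, 78), (4, 0, 11, 4, 0, 4, 82),
     (9, 1, 5, 11, 1, 9, 91), (5, 0, 9, 3, 0, 3, 94), (7, 3, 1, 6, 3, 8, 102), (4, 0, 7, 3, 0, 2, 104), (6, 1, 3, 10, 1, 11, 115), (7, 0, 5, 4, 0, 2, 117),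
     (6, 2, 1, 5, 2, 7, 124), (4, 0, 3, 6, 0, 6, 130), (7, 1, 1, 8, 1, 8, 138), (5, 0, 1, 3, 0, 3, 141)]"
  by code_simp

lemma cert_9: "cert 9 3922870793857769045983536697532393190324326908 152 154
    [(9, 1, 9, 11, 1, 13, 0), (9, 0, 17, 7, 0, 7, 0), (12, 4, 1, 12, 4, 14, 7), (8, 0, 15, 7, 0, 5, 12), (10, 1, 7, 13, 1, 14, 26), (8, 0, 13, 7, 0, 8, 34),
     (14, 2, 3, 15, 2, 13, 47), (9, 0, 11, 9, 0, 8, 55), (9, 1, 5, 9, 1, 11, 66), (10, 0, 9, 8, 0, 7, 73), (11, 3, 1, 11, 3, 13, 86), (8, 0, 7, 10, 0, 9, 95),
     (12, 1, 3, 9, 1, 8, 103), (8, 0, 5, 8, 0, 9, 112), (11, 2, 1, 15, 2, 16, 128), (10, 0, 3, 7, 0, 5, 133), (9, 1, 1, 10, 1, 12, 145), (9, 0, 1, 7, 0, 7, 152)]"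
  by code_simp

lemma cert_13: "cert 13 11727714864056063419829872309847935059332654014458 164 161
    [(14, 1, 7, 16, 1, 17, 0), (15, 0, 13, 10, 0, 8, 0), (14, 2, 3, 15, 2, 17, 12), (13, 0, 11, 11, 0, 10, 22), (14, 1, 5, 21, 1, 22, 44), (16, 0, 9, 12, 0, 9, 53),
     (14, 3, 1, 12, 3, 15, 68), (11, 0, 7, 13, 0, 13, 81), (15, 1, 3, 16, 1, 16, 97), (13, 0, 5, 13, 0, 13, 110), (16, 2, 1, 14, 2, 14, 124), (12, 0, 3, 10, 0, 10, 134),
     (15, 1, 1, 18, 1, 18, 152), (13, 0, 1, 12, 0, 12, 164)]"
  by code_simp

lemma cert_17: "cert 17 8456425350921394803832623814571136071203207512056 163 166
    [(16, 0, 11, 17, 0, 19, 0), (19, 1, 5, 17, 1, 17, 2), (16, 0, 9, 16, 0, 17, 19), (20, 3, 1, 26, 3, 27, 46), (19, 0, 7, 15, 0, 11, 57), (17, 1, 3, 18, 1, 20, 77),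
     (17, 0, 5, 15, 0, 15, 92), (18, 2, 1, 21, 2, 23, 115), (18, 0, 3, 15, 0, 13, 128), (17, 1, 1, 18, 1, 20, 148), (17, 0, 1, 15, 0, 15, 163)]"
  by code_simp

lemma cert_21: "cert 21 200800534511272317520228972655146846883626855432182 168 170
    [(20, 0, 9, 20, 0, 22, 0), (24, 3, 1, 23, 3, 24, 17), (20, 0, 7, 18, 0, 17, 34), (21, 1, 3, 28, 1, 30, 64), (24, 0, 5, 21, 0, 18, 82), (22, 2, 1, 20, 2, 22, 104),
     (19, 0, 3, 21, 0, 22, 126), (24, 1, 1, 25, 1, 24, 150), (21, 0, 1, 18, 0, 18, 168)]"
  by code_simp

lemma cert_25: "cert 25 3073561399465978731792928730182394038920334968618996 172 173
    [(27, 3, 1, 29, 3, 31, 0), (25, 0, 7, 22, 0, 20, 15), (26, 1, 3, 26, 1, 27, 42), (23, 0, 5, 25, 0, 27, 69), (29, 2, 1, 31, 2, 30, 99), (25, 0, 3, 25, 0, 24, 123),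
     (26, 1, 1, 24, 1, 25, 148), (25, 0, 1, 24, 0, 24, 172)]"
  by code_simp

lemma cert_29: "cert 29 2855634515219720934376186091582589393640256671055858 171 175
    [(27, 0, 7, 29, 0, 32, 0), (31, 1, 3, 32, 1, 32, 24), (29, 0, 5, 25, 0, 25, 49), (32, 2, 1, 32, 2, 32, 81), (28, 0, 3, 27, 0, 27, 108), (31, 1, 1, 35, 1, 35, 143),
     (29, 0, 1, 28, 0, 28, 171)]"
  by code_simp

lemma cert_33: "cert 33 390720462538370931860199596726374396190767171659366384 179 178
    [(33, 1, 3, 34, 1, 36, 13), (33, 0, 5, 31, 0, 31, 44), (34, 2, 1, 37, 2, 39, 83), (34, 0, 3, 31, 0, 29, 112), (33, 1, 1, 34, 1, 36, 148), (33, 0, 1, 31, 0, 31, 179)]"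
  by code_simp

lemma cert_37: "cert 37 193520067030640974514933287213677005072369244128149486 178 180
    [(40, 1, 3, 41, 1, 40, 0), (39, 0, 5, 36, 0, 34, 26), (37, 2, 1, 36, 2, 39, 65), (37, 0, 3, 39, 0, 38, 103), (38, 1, 1, 40, 1, 41, 144), (37, 0, 1, 34, 0, 34, 178)]"
  by code_simp

lemma cert_41: "cert 41 315396813471666012043633454611026942891615988503019500 178 182
    [(39, 0, 5, 41, 0, 44, 11), (43, 2, 1, 45, 2, 46, 57), (43, 0, 3, 40, 0, 37, 94), (40, 1, 1, 43, 1, 46, 140), (41, 0, 1, 38, 0, 38, 178)]"
  by code_simp

lemma cert_45: "cert 45 398439033929214903335771069941254217994893629581164522 179 183
    [(47, 0, 5, 42, 0, 41, 0), (47, 2, 1, 47, 2, 48, 43), (43, 0, 3, 43, 0, 44, 87), (48, 1, 1, 48, 1, 47, 134), (45, 0, 1, 45, 0, 45, 179)]"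
  by code_simp

lemma cert_49: "cert 49 7066358393052321766574439916770864454631857900413255656 183 185
    [(51, 0, 5, 50, 0, 49, 0), (49, 2, 1, 51, 2, 54, 38), (49, 0, 3, 49, 0, 48, 86), (50, 1, 1, 48, 1, 49, 135), (49, 0, 1, 48, 0, 48, 183)]"
  by code_simp

lemma cert_53: "cert 53 4595187335931447561297215716116832011827896284067397606 182 186
    [(56, 2, 1, 53, 2, 53, 23), (51, 0, 3, 50, 0, 51, 74), (56, 1, 1, 58, 1, 57, 131), (53, 0, 1, 51, 0, 51, 182)]"
  by code_simp

lemma cert_57: "cert 57 10741225091426032904031219188965691776115444046549221348 183 188
    [(61, 2, 1, 66, 2, 65, 13), (57, 0, 3, 56, 0, 55, 68), (58, 1, 1, 58, 1, 59, 127), (57, 0, 1, 56, 0, 56, 183)]"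
  by code_simp

lemma cert_61: "cert 61 59921316919056270747212789451262280049489215340964478946 186 189
    [(64, 2, 1, 64, 2, 64, 0), (60, 0, 3, 59, 0, 59, 58), (63, 1, 1, 68, 1, 68, 126), (61, 0, 1, 60, 0, 60, 186)]"
  by code_simp

lemma cert_exists:
  assumes "k \<ge> 5" "k mod 4 = 1" "k \<le> 61"
  shows "\<exists>R J N rs. cert k R J N rs"
proof -
  have "k = 5 \<or> k = 9 \<or> k = 13 \<or> k = 17 \<or> k = 21 \<or> k = 25 \<or> k = 29 \<or> k = 33 \<or> k = 37 \<or> k = 41 \<or> k = 45
     \<or> k = 49 \<or> k = 53 \<or> k = 57 \<or> k = 61" using assms by presburger
  thus ?thesis using cert_5 cert_9 cert_13 cert_17 cert_21 cert_25 cert_29 cert_33 cert_37 cert_41 cert_45 cert_49 cert_53 cert_57 cert_61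
    by (elim disjE) blast+
qed

section \<open>Conclusion\<close>

text \<open>In the induction step the right side grows by \<open>b\<close>, the left by
  \<open>((x + 1) / x) ^ d\<close>; Bernoulli's inequality and the hypothesis on \<open>d\<close>
  show that the latter is at most \<open>b\<close>.\<close>

lemma power_growth:
  fixes c b :: real
  assumes c: "c \<ge> 0" and b: "b \<ge> 1" and d: "real d * b \<le> (b - 1) * (real x0 + 1)"
    and base: "c * real x0 ^ d \<le> b ^ x0" and x: "x0 \<le> x"
  shows "c * real x ^ d \<le> b ^ x"
  using x
proof (induction x rule: dec_induct)
  case base show ?case by (rule assms(4))
next
  case (step x)
  define y where "y = real x + 1"
  have y: "y \<ge> 1" unfolding y_def by simp
  have "(b - 1) * (real x0 + 1) \<le> (b - 1) * y" using step.hyps b by (intro mult_left_mono) (auto simp: y_def)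
  hence "real d * b \<le> (b - 1) * y" using d by linarith
  hence "1 / b \<le> 1 + real d * (- 1 / y)" using y b by (simp add: field_simps)
  also have "\<dots> \<le> (1 + (- 1 / y)) ^ d" using y by (intro Bernoulli_inequality) (simp add: field_simps)
  also have "1 + (- 1 / y) = real x / y" using y by (simp add: field_simps y_def)
  finally have "y ^ d \<le> b * real x ^ d" using y b by (simp add: power_divide field_simps)
  hence "c * y ^ d \<le> c * (b * real x ^ d)" using c by (rule mult_left_mono)
  also have "\<dots> \<le> b * b ^ x" using step.IH b by (simp add: mult.left_commute)
  finally show ?case unfolding y_def by (simp add: add.commute)
qed

lemma power_growth_nat:
  fixes c :: nat
  assumes "2 * d \<le> x0 + 1" and base: "c * x0 ^ d \<le> 2 ^ x0" and "x0 \<le> x"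
  shows "c * x ^ d \<le> 2 ^ x"
proof -
  have "real (c * x0 ^ d) \<le> real (2 ^ x0)" using base by (simp only: of_nat_le_iff)
  moreover have "real (2 * d) \<le> real (x0 + 1)" using assms(1) by (simp only: of_nat_le_iff)
  ultimately have "real c * real x ^ d \<le> 2 ^ x" using assms(3) by (intro power_growth[of "real c" 2 d x0 x]) simp_all
  hence "real (c * x ^ d) \<le> real (2 ^ x)" by simp
  thus ?thesis by (simp only: of_nat_le_iff)
qed

lemma exponential_dominates:
  assumes "nu \<ge> 80" and "k < 2 * nu"
  shows "4097 * real k ^ 2 * real nu \<le> (27 / 20) ^ nu"
proof -
  have "real k ^ 2 \<le> (2 * real nu) ^ 2" using assms by (intro power_mono) auto
  hence "4097 * real k ^ 2 * real nu \<le> 4097 * (2 * real nu) ^ 2 * real nu" by (intro mult_right_mono mult_left_mono) auto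
  also have "\<dots> = 16388 * real nu ^ 3" by (simp add: power2_eq_square power3_eq_cube)
  also have "\<dots> \<le> (27 / 20) ^ nu" by (rule power_growth[OF _ _ _ _ assms(1)]) (simp_all add: power_divide)
  finally show ?thesis .
qed

lemma linear_le_two_power: "nu \<ge> 8 \<Longrightarrow> 24 * nu + 32 \<le> (2::nat) ^ nu"
  by (induction nu rule: dec_induct) auto

context kfib
begin

text \<open>If \<open>8 * K <= 2 ^ k\<close>, the estimate with \<open>p = r = 1\<close> applies.
  Otherwise \<open>k\<close> is so small against \<open>nu\<close> that the cubic condition of the
  Dirichlet version holds.\<close>

lemma no_solution_index_large:
  assumes k65: "k \<ge> 65" and n: "n \<ge> 1" and m: "m \<ge> 1" and eq: "gen_fib k (int n) = int m * 2 ^ m + 1"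
    and nu: "2 ^ nu \<le> 2 * n" "n < 2 ^ nu" "nu \<ge> 80" "k < 2 * nu"
  shows False
proof -
  define K where "K = 3145728 * k ^ 4 * nu ^ 2"
  have k5: "k \<ge> 5" using k65 by simp
  note nu2 = exponential_dominates[OF nu(3,4)]
  show False
  proof (cases "8 * K \<le> 2 ^ k")
    case True
    have "k ^ 4 \<le> (2 * nu) ^ 4" using nu(4) by (intro power_mono) auto
    hence "K \<le> 3145728 * (2 * nu) ^ 4 * nu ^ 2" unfolding K_def by (intro mult_le_mono) auto
    also have "\<dots> = 50331648 * nu ^ 6" by (simp add: power_mult_distrib power_add[symmetric])
    finally have "4 * K * (2 * nu + k + 6) \<le> 4 * (50331648 * nu ^ 6) * (5 * nu)" using nu(3,4) by (intro mult_le_mono) auto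
    also have "\<dots> = 1006632960 * nu ^ 7" by (simp add: power_Suc[symmetric] power_Suc2[symmetric] del: power_Suc)
    finally have 1: "4 * K * (2 * nu + k + 6) \<le> 1006632960 * nu ^ 7" .
    have "4294967296 * nu ^ 7 \<le> 2 ^ nu" by (rule power_growth_nat[OF _ _ nu(3)]) simp_all
    hence 2: "4294967296 * nu ^ 7 \<le> 2 * n" using nu(1) by (rule order_trans)
    have "nu ^ 7 \<ge> 1" using nu(3) by simp
    hence "4 * K * (2 * nu + k + 6) + 8 \<le> n" using 1 2 by linarith
    thus False by (rule no_solution_near_two[OF k5 n m eq nu(2) K_def True _ nu2])
  next
    case False
    \<comment> \<open>With \<open>nu <= 4 * k\<close> the number \<open>8 * K\<close> would be at
      most \<open>402653184 * k ^ 6\<close>, which is below \<open>2 ^ k\<close> from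
      \<open>k = 65\<close> on: the origin of that threshold.\<close>
    have k_nu: "4 * k < nu"
    proof (rule ccontr)
      assume "\<not> 4 * k < nu"
      hence "nu ^ 2 \<le> (4 * k) ^ 2" by (intro power_mono) auto
      hence "8 * K \<le> 8 * (3145728 * k ^ 4 * (4 * k) ^ 2)" unfolding K_def by (intro mult_le_mono) auto
      also have "\<dots> = 402653184 * k ^ 6" by (simp add: power_mult_distrib power_add[symmetric])
      also have "\<dots> \<le> 2 ^ k" by (rule power_growth_nat[OF _ _ k65]) simp_all
      finally show False using False by simp
    qed
    hence nu261: "nu \<ge> 261" using k65 by simp
    have "(4 * k) ^ 4 \<le> nu ^ 4" using k_nu by (intro power_mono) auto
    hence "256 * k ^ 4 \<le> nu ^ 4" by (simp add: power_mult_distrib)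
    hence "12288 * (256 * k ^ 4) * nu ^ 2 \<le> 12288 * nu ^ 4 * nu ^ 2" by (intro mult_le_mono) auto
    moreover have "K = 12288 * (256 * k ^ 4) * nu ^ 2" "12288 * nu ^ 4 * nu ^ 2 = 12288 * nu ^ 6"
      unfolding K_def by (simp_all add: power_add[symmetric])
    ultimately have "K \<le> 12288 * nu ^ 6" by linarith
    hence "K ^ 3 \<le> (12288 * nu ^ 6) ^ 3" by (intro power_mono) auto
    also have "\<dots> = 1855425871872 * nu ^ 18" by (simp add: power_mult_distrib power_mult[symmetric])
    finally have 1: "K ^ 3 \<le> 1855425871872 * nu ^ 18" .
    have "538073502842880 * nu ^ 18 \<le> 2 ^ nu" by (rule power_growth_nat[OF _ _ nu261]) simp_all
    hence "538073502842880 * nu ^ 18 \<le> 2 * n" using nu(1) by (rule order_trans)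
    hence "145 * K ^ 3 \<le> n" using 1 by linarith
    thus False by (rule no_solution_large[OF k5 n m eq nu(2) K_def _ nu2])
  qed
qed

text \<open>If \<open>nu > N\<close>, the growth inequality in the certificate, with
  \<open>290 = 2 * 145\<close> because of \<open>2 ^ nu <= 2 * n\<close>, feeds the Dirichlet
  version; otherwise \<open>n < 2 ^ N\<close> and the digits of the zero decide.\<close>

lemma no_solution_cert:
  assumes c: "cert k R J N rs" and m: "m \<ge> 1" and eq: "gen_fib k (int n) = int m * 2 ^ m + 1"
    and nq: "n = (k + 1) * q + 1" "q \<ge> 1" "even q"
    and nu: "2 ^ nu \<le> 2 * n" "n < 2 ^ nu" "nu \<ge> 80" "k < 2 * nu"
  shows False
proof -
  have k5: "k \<ge> 5" and N: "10 \<le> N" "N \<le> 200" "J \<le> 200"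
    and cN: "290 * (3145728 * int k ^ 4) ^ 3 * int (N + 1) ^ 6 \<le> 2 ^ (N + 1)" using c unfolding cert_def by auto
  have n: "n \<ge> 1" using nq by simp
  show False
  proof (cases "N + 1 \<le> nu")
    case True
    define K where "K = 3145728 * k ^ 4 * nu ^ 2"
    have "int (290 * (3145728 * k ^ 4) ^ 3 * (N + 1) ^ 6) \<le> int (2 ^ (N + 1))" using cN by simp
    hence "290 * (3145728 * k ^ 4) ^ 3 * (N + 1) ^ 6 \<le> 2 ^ (N + 1)" by (simp only: of_nat_le_iff)
    hence "290 * (3145728 * k ^ 4) ^ 3 * nu ^ 6 \<le> 2 ^ nu" using N by (intro power_growth_nat[OF _ _ True]) simp_all
    moreover have "K ^ 3 = (3145728 * k ^ 4) ^ 3 * nu ^ 6" unfolding K_def by (simp add: power_mult_distrib power_mult[symmetric])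
    ultimately have "145 * K ^ 3 \<le> n" using nu(1) by linarith
    thus False by (rule no_solution_large[OF k5 n m eq nu(2) K_def _ exponential_dominates[OF nu(3,4)]])
  next
    case False
    have "(2::nat) ^ nu \<le> 2 ^ N" using False by (intro power_increasing) auto
    hence small: "(k + 1) * q + 1 < 2 ^ N" by (rule less_le_trans[OF nu(2)[unfolded nq(1)]])
    have "(2::nat) ^ 80 \<le> 2 ^ nu" using nu(3) by (intro power_increasing) auto
    hence "n \<ge> 10000" using nu(1) by simp
    hence "real m \<ge> real (J + 1 + k + N)" using solution_m_half[OF k5 n m eq nu(2)] N nu(4) False by simp
    hence mb: "J + 1 + k + N \<le> m" by (simp only: of_nat_le_iff)
    have "2 ^ m dvd gen_fib k (int ((k + 1) * q + 1)) - 1" using eq unfolding nq(1) by simp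
    thus False by (rule cert_no_solution[OF c nq(2,3) _ small mb])
  qed
qed

end

section \<open>Reduction to the residues 1 and 2 of the index\<close>

text \<open>For remainders 1 to \<open>k\<close> every term of \<open>gf_coeff\<close> contains a
  positive power of 2; when \<open>r >= 2\<close>, both \<open>r\<close> and \<open>r - 1\<close>
  are such remainders.\<close>

lemma gen_fib_even:
  assumes k: "k \<ge> 2" and r: "2 \<le> r" "r \<le> k"
  shows "even (gen_fib k (int ((k + 1) * q + r + 1)))"
proof -
  have ev: "even (gf_coeff k ((k + 1) * q + i))" if "1 \<le> i" "i \<le> k" for i
  proof -
    have "gf_coeff k ((k + 1) * q + i) = (\<Sum>s\<le>q. (-1) ^ (q - s) * 2 ^ (i + s * (k + 1)) * int ((q + i + s * k) choose (i + s * (k + 1))))"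
      using k that by (intro gf_coeff_expand) auto
    moreover have "even \<dots>" using that by (intro dvd_sum) auto
    ultimately show ?thesis by simp
  qed
  have "int ((k + 1) * q + r + 1) - 1 = int ((k + 1) * q + r)" "int ((k + 1) * q + r + 1) - 2 = int ((k + 1) * q + (r - 1))"
    using r by (simp_all add: of_nat_diff)
  hence "gen_fib k (int ((k + 1) * q + r + 1)) = gf_coeff k ((k + 1) * q + r) - gf_coeff k ((k + 1) * q + (r - 1))"
    unfolding gen_fib_eq_bz[OF k] by (simp only: gf_coeff_int_int)
  thus ?thesis using ev[of r] ev[of "r - 1"] r by simp
qed

lemma gen_fib_two: "k \<ge> 2 \<Longrightarrow> gen_fib k 2 = 1"
  using gen_fib_branch_two_sum[of k 0] by simp

context kfib
begin

lemma no_solution_branch_one: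
  assumes m: "m \<ge> 1" and eq: "gen_fib k (int n) = int m * 2 ^ m + 1"
    and big: "n \<ge> 950000000000000000000000 \<or> k \<ge> 159" and nq: "n = (k + 1) * q + 1" "q \<ge> 1"
    and nu: "2 ^ nu \<le> 2 * n" "n < 2 ^ nu" and lin: "12 * nu + 16 \<le> n" and half: "real m \<ge> real n / 2 - 4 - real nu"
  shows False
proof -
  have n: "n \<ge> 1" using nq by simp
  have dv: "2 ^ m dvd gen_fib k (int ((k + 1) * q + 1)) - 1" using eq unfolding nq(1) by simp
  have lin': "12 * real nu + 16 \<le> real n" using lin by linarith
  have ev: "even q"
  proof (rule ccontr)
    assume "odd q"
    hence "m \<le> 1" using branch_one_odd[OF k2 _ dv] by simp
    hence "real m \<le> 1" by simp
    thus False using half lin' by linarith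
  qed
  hence q2: "q \<ge> 2" using nq(2) by (cases "q = 1") auto
  have "(k + 1) * 2 \<le> (k + 1) * q" using q2 by (rule mult_le_mono2)
  hence kn: "2 * k + 3 \<le> n" using nq(1) by simp
  have "k \<le> q * k" "n = q * k + q + 1" using nq by (simp_all add: algebra_simps)
  hence qk: "q + k \<le> n" by linarith
  \<comment> \<open>Outside this class \<open>m\<close> is less than \<open>k + 2 + nu\<close>,
    while \<open>m\<close> has the order of \<open>n\<close>, and
    \<open>n >= 2 * k + 3\<close>.\<close>
  have km: "k mod 4 = 1"
  proof (rule ccontr)
    assume k4: "k mod 4 \<noteq> 1"
    have "2 ^ m < 2 ^ (k + 2) * (q + k)" by (rule branch_one_bound[OF k2 k4 nq(2) dv])
    also have "\<dots> \<le> 2 ^ (k + 2) * 2 ^ nu" using qk nu(2) by (intro mult_le_mono2) simp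
    finally have "(2::nat) ^ m < 2 ^ (k + 2 + nu)" by (simp add: power_add)
    hence "m < k + 2 + nu" by (simp only: power_strict_increasing_iff one_less_numeral_iff semiring_norm)
    hence mk: "real m \<le> real k + 1 + real nu" by linarith
    show False
    proof (cases "k \<ge> 5")
      case True
      thus False using solution_m_half[OF True n m eq nu(2)] mk lin' kn by linarith
    next
      case False
      moreover have "nu \<ge> 1" using nu(2) n by (cases nu) auto
      ultimately show False using half mk lin' by linarith
    qed
  qed
  hence k5: "k \<ge> 5" using k2 by presburger
  \<comment> \<open>For \<open>k >= 159\<close> this comes from
    \<open>2 ^ (k div 2) < 2 ^ nu\<close>, otherwise from the assumed size of
    \<open>n\<close>.\<close>
  have "nu \<ge> 80 \<and> k < 2 * nu"
  proof (cases "k \<ge> 159")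
    case True
    define e where "e = k div 2"
    have e: "2 * e \<le> k" "k \<le> 2 * e + 1" unfolding e_def by auto
    have "real (e + 1 + k + nu) \<le> real m" using solution_m_half[OF k5 n m eq nu(2)] lin' kn e by linarith
    hence mb: "e + 1 + k + nu \<le> m" by (simp only: of_nat_le_iff)
    have "2 ^ (e + 1 + k) * (q - 1 + k) \<le> 2 ^ (e + 1 + k) * (2 ^ nu :: nat)" using qk nu(2) by (intro mult_le_mono2) simp
    also have "\<dots> = 2 ^ (e + 1 + k + nu)" by (rule power_add[symmetric])
    also have "\<dots> \<le> 2 ^ m" using mb by (intro power_increasing) auto
    finally have "two_int e (theta k q q)" by (rule theta_two_int[OF k2 nq(2) ev dv])
    hence "2 ^ e \<le> q + k" unfolding e_def by (rule theta_lower[OF True km nq(2)])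
    hence "(2::nat) ^ e < 2 ^ nu" using qk nu(2) by linarith
    hence "e < nu" by (simp only: power_strict_increasing_iff one_less_numeral_iff semiring_norm)
    thus ?thesis using e True by linarith
  next
    case False
    hence big': "n \<ge> 950000000000000000000000" using big by simp
    have "nu \<ge> 80"
    proof (rule ccontr)
      assume "\<not> nu \<ge> 80"
      hence "(2::nat) ^ nu \<le> 2 ^ 79" by (intro power_increasing) auto
      hence "n < 2 ^ 79" using nu(2) by (rule less_le_trans[rotated])
      thus False using big' by simp
    qed
    thus ?thesis using False by simp
  qed
  hence nu': "nu \<ge> 80" "k < 2 * nu" by auto
  show False
  proof (cases "k \<ge> 65")
    case True
    show False by (rule no_solution_index_large[OF True n m eq nu nu'])
  next
    case False
    hence "k \<le> 61" using km by presburger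
    then obtain R J N rs where "cert k R J N rs" using cert_exists[OF k5 km] by blast
    thus False by (rule no_solution_cert[OF _ m eq nq ev nu nu'])
  qed
qed

lemma no_solution_large_or_steep:
  assumes m: "m \<ge> 1" and n: "n \<ge> 1" and eq: "gen_fib k (int n) = int m * 2 ^ m + 1"
    and big: "n \<ge> 950000000000000000000000 \<or> k \<ge> 159"
  shows False
proof -
  have "(1::int) * 2 ^ 1 \<le> int m * 2 ^ m" using m by (intro mult_mono power_increasing) auto
  hence "2 \<le> int m * 2 ^ m" by (simp only: power_one_right mult_1)
  hence not1: "gen_fib k (int n) \<noteq> 1" using eq by linarith
  have od: "odd (gen_fib k (int n))" using eq m by simp
  define q r where "q = (n - 1) div (k + 1)" and "r = (n - 1) mod (k + 1)"
  have "n - 1 = (k + 1) * q + r" unfolding q_def r_def by (rule mult_div_mod_eq[symmetric])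
  hence nqr: "n = (k + 1) * q + r + 1" using n by simp
  have "r < k + 1" unfolding r_def by (rule mod_less_divisor) simp
  hence "\<not> 2 \<le> r" using gen_fib_even[OF k2, of r q] od nqr by auto
  hence r: "r = 0 \<or> r = 1" by auto
  \<comment> \<open>For \<open>q = 0\<close> the sequence has the value 1, but the equation demands
    at least 3.\<close>
  have q1: "q \<ge> 1"
  proof (rule ccontr)
    assume "\<not> q \<ge> 1"
    hence "n = 1 \<or> n = 2" using nqr r by auto
    thus False using not1 gen_fib_one[of k] gen_fib_two[OF k2] by auto
  qed
  have "(k + 1) * 1 \<le> (k + 1) * q" using q1 by (rule mult_le_mono2)
  hence n160: "n \<ge> 160" using nqr big by auto
  obtain e where e: "2 ^ e \<le> n" "n < 2 ^ (e + 1)" using ex_power_ivl1[of 2 n] n by auto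
  define nu where "nu = e + 1"
  have nu: "2 ^ nu \<le> 2 * n" "n < 2 ^ nu" using e unfolding nu_def by auto
  have "nu \<ge> 8"
  proof (rule ccontr)
    assume "\<not> nu \<ge> 8"
    hence "(2::nat) ^ nu \<le> 2 ^ 7" by (intro power_increasing) auto
    thus False using nu(2) n160 by simp
  qed
  hence lin: "12 * nu + 16 \<le> n" using linear_le_two_power[of nu] nu(1) by linarith
  have "(2::real) ^ 2 \<le> 2 ^ k" using k2 by (intro power_increasing) auto
  hence "2 * real n / 2 ^ k \<le> 2 * real n / 4" by (intro divide_left_mono) auto
  hence half: "real m \<ge> real n / 2 - 4 - real nu" using solution_m_lower[OF n m eq nu(2)] by simp
  show False
  proof (cases "r = 0")
    case True
    show False by (rule no_solution_branch_one[OF m eq big _ q1 nu lin half]) (use nqr True in simp)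
  next
    case False
    hence n2: "n = (k + 1) * q + 2" using nqr r by simp
    have "2 ^ m \<le> 2 * (q + 1)" by (rule branch_two_bound[OF k2 q1]) (use eq n2 in simp)
    also have "q + 1 \<le> n" using n2 by simp
    hence "2 * (q + 1) \<le> 2 * n" by simp
    also have "2 * n < 2 ^ (nu + 1)" using nu(2) by simp
    finally have "(2::nat) ^ m < 2 ^ (nu + 1)" .
    hence "m < nu + 1" by (simp only: power_strict_increasing_iff one_less_numeral_iff semiring_norm)
    thus False using half lin by linarith
  qed
qed

end

theorem theorem2:
  fixes m n k :: nat
  assumes "k \<ge> 2" and "m \<ge> 1" and "n \<ge> 1"
    and "gen_fib k (int n) = int m * 2 ^ m + 1"
  shows "real m < 9.5 * 10 ^ 23 \<and> real n < 2.4 * 10 ^ 24 \<and> k \<le> 158"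
proof -
  obtain al :: real where "2 - 2 / 2 ^ k \<le> al" "al < 2" "al ^ k * (2 - al) = 1"
    using dominant_root_exists[OF assms(1)] by blast
  then interpret kfib k al using assms(1) by unfold_locales
  have "\<not> (n \<ge> 950000000000000000000000 \<or> k \<ge> 159)" using no_solution_large_or_steep[OF assms(2-4)] by blast
  hence n: "n < 950000000000000000000000" and k: "k \<le> 158" by auto
  have "real n < real 950000000000000000000000" using n by (simp only: of_nat_less_iff)
  moreover have "real m \<le> real n" using solution_m_less[OF assms(3,2,4)] by simp
  ultimately show ?thesis using k by simp
qed

end
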